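(* Assume the setting, the algorithm and the weights $w_{j,\ell}^i$ described in the context. Suppose the Lipschitz property (constant $L\ge 0$), the three-point property (constants $\gamma_{K,j}\in\mathbb R$, $L_3\ge0$, $p\in[1,2]$, $\theta_A$) and the monotonicity property (constants $\gamma_{G,j},\gamma_{F^*,\ell}\ge0$) hold, with $\gamma_{G,j}+\gamma_{K,j}> 0$ for $j=1,\dots,m$, and suppose that for some $\alpha_y>0$ and $\zeta_\ell\ge0$ (with $\zeta_\ell>0$ if $p>1$) the numbers $$\bar\gamma_{F^*,\ell}:=\begin{cases}\gamma_{F^*,\ell}, & Q_\ell P_{NL}=0,\\ \gamma_{F^*,\ell}-(p-1)\zeta_\ell-\alpha_y, & Q_\ell P_{NL}\neq0,\end{cases}$$ satisfy $\bar\gamma_{F^*,\ell}\ge 0$ for $\ell=1,\dots,n$. Let $0<\tilde\gamma_{G,j}<\pi_j(\gamma_{G,j}+\gamma_{K,j})$ for all $j$. Let the iterates $u^i=(x^i,y^i)$ be generated by the algorithm with $$\sigma_\ell^{i+1}:=\frac{\sigma_\ell^i}{\bar\omega^i},\qquad \tau_j^{i+1}:=\frac{1}{1+2\tau_j^i\tilde\gamma_{G,j}}\,\frac{\tau_j^i}{\bar\omega^i},\qquad \bar\omega^i:=\max_{j=1,\dots,m}\frac1{\sqrt{1+2\tau_j^i\tilde\gamma_{G,j}}},$$ where the initial $\tau_j^0,\sigma_\ell^0>0$ satisfy, for some $0<\delta\le\kappa<1$, $\rho_x,\rho_\ell\ge0$, and for all $i\in\mathbb N$, $j=1,\dots,m$,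 $\ell=1,\dots,n$, $$1-\kappa\ge\Big\|\sum_{j\in S(i)}\sqrt{\tfrac{w_{j,\ell}^i\sigma_\ell^0\tau_j^0}{\pi_j}}\,Q_\ell\nabla K(x^i)P_j\Big\|^2,$$ $$\delta\ge\tau_j^0\Big(\bar L+2(1-\pi_j)(\gamma_{G,j}+\gamma_{K,j})\frac{\gamma_{G,j}+\gamma_{K,j}-\tilde\gamma_{G,j}}{\pi_j(\gamma_{G,j}+\gamma_{K,j})-\tilde\gamma_{G,j}}\Big),$$ where $$\bar L:=L_3+\frac{L}{\bar\omega^0}\Big(\max_{j=1,\dots,m}\Big(\frac1{\pi_j}+1\Big)^2\sum_{\ell=1}^n\rho_\ell+\frac{nL}{2\alpha_y}\rho_x^2\Big).$$ Assume moreover for all $i\in\mathbb N$, with $A:=\sum_{j\in S(i)}\pi_j^{-1}P_j$, that $$\mathbb E[\theta_A\mid\mathcal O_{i-1}]\ge p^{-p}\sum_{\ell=1}^n\zeta_\ell^{1-p}\rho_\ell^{2-p}/\bar\omega^0,$$ $$\mathbb P\big[\|x^{i+1}-\hat x\|\le\rho_x,\ \|Q_\ell(y^{i+1}-\hat y)\|_{P_{NL}}\le\rho_\ell\ (\ell=1,\dots,n)\,\big|\,\mathcal O_{i-1}\big]=1 .$$ Then $\mathbb E[\|P_j(x^N-\hat x)\|^2]\to0$ at the rate $O(1/N^2)$ for all $j=1,\dots,m$.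
   Context: Setting. $X,Y$ are real Hilbert spaces and $K\in C^1(X;Y)$ has derivative $\nabla K(x)$ (a bounded linear operator $X\to Y$) with adjoint $\nabla K(x)^*$. $P_1,\dots,P_m$ on $X$ and $Q_1,\dots,Q_n$ on $Y$ are families of mutually orthogonal orthogonal projections, each family summing to the identity; $x_j:=P_jx$, $y_\ell:=Q_\ell y$. $G_j:X\to(-\infty,\infty]$ and $F_\ell:Y\to(-\infty,\infty]$ are convex, proper, lower semicontinuous, $F_\ell^*$ is the Fenchel conjugate, $G(x):=\sum_jG_j(P_jx)$, $F^*(y):=\sum_\ell F_\ell^*(Q_\ell y)$. $\hat u=(\hat x,\hat y)$ is a critical point: $-\nabla K(\hat x)^*\hat y\in\partial G(\hat x)$ and $K(\hat x)\in\partial F^*(\hat y)$. $Y_L:=\{y\in Y: x\mapsto\langle y,K(x)\rangle\text{ is linear}\}$, $P_{NL}$ is the orthogonal projection onto $Y_{NL}:=Y_L^\perp$. For a positive semidefinite operator $T$, $\|z\|_T:=\sqrt{\langle Tz,z\rangle}$; for general self-adjoint $T$, $\|z\|_T^2:=\langle Tz,z\rangle$; $\langle z,z'\rangle_T:=\langle Tz,z'\rangle$. Convention $0^0=1$. Properties. Lipschitz property: there is a neighbourhood $\mathcal X_K$ of $\hat x$ with $\|\nabla K(x)-\nabla K(x')\|\le L\|x-x'\|$ for $x,x'\in\mathcal X_K$. Three-point property: for a neighbourhood $\mathcal X_K$ of $\hat x$, with $\Gamma_K:=\sum_j\gamma_{K,j}P_j$, for every $A=\sum_ja_jP_j$ with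 $a_j\ge0$ there is $\theta_A\ge0$ such that for all $x,x'\in\mathcal X_K$: $\langle[\nabla K(x)-\nabla K(\hat x)]^*\hat y,x'-\hat x\rangle_A\ge\|x'-\hat x\|^2_{A\Gamma_K}+\theta_A\|K(\hat x)-K(x)-\nabla K(x)(\hat x-x)\|^p-\frac{L_3}{2}\|x'-x\|_A^2$. Monotonicity property: there are neighbourhoods $\mathcal X_G$ of $\hat x$ and $\mathcal Y_{F^*}$ of $\hat y$ such that for every $\hat q\in\partial G(\hat x)$, $x\in\mathcal X_G$, $q\in\partial G(x)$: $\langle q-\hat q,x-\hat x\rangle\ge\sum_j\gamma_{G,j}\|P_j(x-\hat x)\|^2$; and for every $\hat r\in\partial F^*(\hat y)$, $y\in\mathcal Y_{F^*}$, $r\in\partial F^*(y)$: $\langle r-\hat r,y-\hat y\rangle\ge\sum_\ell\gamma_{F^*,\ell}\|Q_\ell(y-\hat y)\|^2$. Probability. $(\Omega,\mathcal O,\mathbb P)$ is a probability space with increasing sub-$\sigma$-algebras $\mathcal O_{-1}\subseteq\mathcal O_0\subseteq\mathcal O_1\subseteq\cdots\subseteq\mathcal O$. $S(i)\subseteq\{1,\dots,m\}$ is an $\mathcal O_i$-measurable random set with $\mathbb P[j\in S(i)\mid\mathcal O_{i-1}]=\pi_j>0$ independent of $i$. Conditions involving random quantities are meant almost surely. Algorithm (full dual updates). Given an initial iterate $(x^0,y^0)\in X\times Y$ and step length parameters $\tau_j^i,\sigma_\ell^{i+1},\bar\omega^i>0$, for $i=0,1,2,\dots$ put, for all $j$ and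 $\ell$, $x_j^{i+1}:=(I+\tau_j^iP_j\partial G_jP_j)^{-1}(x_j^i-\tau_j^iP_j\nabla K(x^i)^*y^i)$ if $j\in S(i)$ and $x_j^{i+1}:=x_j^i$ if $j\notin S(i)$; $\bar x_j^{i+1}:=x_j^{i+1}+\bar\omega^i(x_j^{i+1}-x_j^i)/\pi_j$ if $j\in S(i)$ and $\bar x_j^{i+1}:=x_j^i$ if $j\notin S(i)$; $y_\ell^{i+1}:=(I+\sigma_\ell^{i+1}Q_\ell\partial F_\ell^*Q_\ell)^{-1}(y_\ell^i+\sigma_\ell^{i+1}Q_\ell K(\bar x^{i+1}))$. Here $(I+\tau P_j\partial G_jP_j)^{-1}(v)$ for $v\in P_jX$ is the proximal point, i.e. the minimiser over $z\in P_jX$ of $G_j(z)+\|z-v\|^2/(2\tau)$; similarly for $F_\ell^*$ on $Q_\ell Y$. Weights. $w_{j,\ell,k}=1/w_{j,k,\ell}>0$ ($j\le m$; $\ell,k\le n$) are some fixed numbers, $\bar{\mathcal V}_j^i(\ell):=\{k: Q_\ell\nabla K(x^i)P_j\nabla K(x^i)^*Q_k\ne0,\ j\in S(i)\}$, and $w_{j,\ell}^i:=\sum_{k\in\bar{\mathcal V}_j^i(\ell)}w_{j,\ell,k}$ if $Q_\ell\nabla K(x^i)P_j\ne0$, $w_{j,\ell}^i:=0$ otherwise.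
   Formalization: Added, a.s. for all i≥1: the segment from x^i to x̄^{i+1} lies in X_K, x̂+P_j(x^i−x̂) lies in X_G for j∈S(i−1), and y^i lies in Y_{F*}. Without such localisation the claim fails: iterates may stay at a fixed point outside the neighbourhoods. Vacuous if the properties are global. *)

theory Defs
  imports "HOL-Probability.Probability" "HOL-Library.Landau_Symbols"
begin

section \<open>Convex analysis for extended-real-valued functions\<close>

definition proper_fun :: "('a \<Rightarrow> ereal) \<Rightarrow> bool" where
  "proper_fun f \<longleftrightarrow> (\<forall>x. f x \<noteq> -\<infinity>) \<and> (\<exists>x. f x \<noteq> \<infinity>)"

definition convex_fun :: "('a::real_vector \<Rightarrow> ereal) \<Rightarrow> bool" where
  "convex_fun f \<longleftrightarrow> convex {(x, r::real). f x \<le> ereal r}"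

definition lsc_fun :: "('a::topological_space \<Rightarrow> ereal) \<Rightarrow> bool" where
  "lsc_fun f \<longleftrightarrow> (\<forall>x. f x \<le> Liminf (at x) f)"

definition fenchel_conj :: "('a::real_inner \<Rightarrow> ereal) \<Rightarrow> 'a \<Rightarrow> ereal" where
  "fenchel_conj f y = (SUP z. ereal (y \<bullet> z) - f z)"

definition subdiff :: "('a::real_inner \<Rightarrow> ereal) \<Rightarrow> 'a \<Rightarrow> 'a set" where
  "subdiff f x = {q. \<bar>f x\<bar> \<noteq> \<infinity> \<and> (\<forall>z. f z \<ge> f x + ereal (q \<bullet> (z - x)))}"

text \<open>The proximal point of \<open>f\<close> on the subspace \<open>range P\<close>, as a relation: \<open>z\<close> minimises
  \<open>f z + \<parallel>z - v\<parallel>\<^sup>2 / (2 t)\<close> over \<open>z \<in> range P\<close>.\<close>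

definition is_prox ::
  "('a::real_inner \<Rightarrow>\<^sub>L 'a) \<Rightarrow> real \<Rightarrow> ('a \<Rightarrow> ereal) \<Rightarrow> 'a \<Rightarrow> 'a \<Rightarrow> bool" where
  "is_prox P t f v z \<longleftrightarrow>
     is_arg_min (\<lambda>z. f z + ereal ((norm (z - v))\<^sup>2 / (2 * t)))
       (\<lambda>z. z \<in> range (blinfun_apply P)) z"

definition separable_sum ::
  "('k::finite \<Rightarrow> 'a::real_inner \<Rightarrow>\<^sub>L 'a) \<Rightarrow> ('k \<Rightarrow> 'a \<Rightarrow> ereal) \<Rightarrow> 'a \<Rightarrow> ereal" where
  "separable_sum P f x = (\<Sum>j\<in>UNIV. f j (P j x))"


section \<open>Operators\<close>

definition orth_projection :: "('a::real_inner \<Rightarrow>\<^sub>L 'a) \<Rightarrow> bool" where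
  "orth_projection P \<longleftrightarrow> P o\<^sub>L P = P \<and> (\<forall>x y. P x \<bullet> y = x \<bullet> P y)"

definition orth_decomposition :: "('k::finite \<Rightarrow> 'a::real_inner \<Rightarrow>\<^sub>L 'a) \<Rightarrow> bool" where
  "orth_decomposition P \<longleftrightarrow> (\<forall>j. orth_projection (P j)) \<and>
     (\<forall>j k. j \<noteq> k \<longrightarrow> P j o\<^sub>L P k = 0) \<and> (\<Sum>j\<in>UNIV. P j) = id_blinfun"

definition op_inner :: "('a::real_inner \<Rightarrow>\<^sub>L 'a) \<Rightarrow> 'a \<Rightarrow> 'a \<Rightarrow> real" where
  "op_inner T z z' = T z \<bullet> z'"

definition op_norm :: "('a::real_inner \<Rightarrow>\<^sub>L 'a) \<Rightarrow> 'a \<Rightarrow> real" where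
  "op_norm T z = sqrt (op_inner T z z)"

definition block_op ::
  "('k::finite \<Rightarrow> 'a::real_inner \<Rightarrow>\<^sub>L 'a) \<Rightarrow> ('k \<Rightarrow> real) \<Rightarrow> 'a \<Rightarrow>\<^sub>L 'a" where
  "block_op P a = (\<Sum>j\<in>UNIV. a j *\<^sub>R P j)"

definition Y_lin :: "('a::real_inner \<Rightarrow> 'b::real_inner) \<Rightarrow> 'b set" where
  "Y_lin K = {y. linear (\<lambda>x. y \<bullet> K x)}"

definition Y_nonlin :: "('a::real_inner \<Rightarrow> 'b::real_inner) \<Rightarrow> 'b set" where
  "Y_nonlin K = orthogonal_comp (Y_lin K)"

text \<open>Power with real exponent and \<open>0\<^sup>0 = 1\<close>; the library has \<open>0 powr 0 = 0\<close>.\<close>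

definition rpow :: "real \<Rightarrow> real \<Rightarrow> real" where
  "rpow b e = (if e = 0 then 1 else b powr e)"


section \<open>Assumptions on the data\<close>

text \<open>In this section \<open>D x\<close> is the derivative of \<open>K\<close> at \<open>x\<close>.\<close>

definition C1_with_derivative ::
  "('a::real_normed_vector \<Rightarrow> 'b::real_normed_vector) \<Rightarrow> ('a \<Rightarrow> 'a \<Rightarrow>\<^sub>L 'b) \<Rightarrow> bool" where
  "C1_with_derivative K D \<longleftrightarrow>
     (\<forall>x. (K has_derivative blinfun_apply (D x)) (at x)) \<and> continuous_on UNIV D"

definition lipschitz_property ::
  "('a::real_inner \<Rightarrow> 'a \<Rightarrow>\<^sub>L 'b::real_inner) \<Rightarrow> real \<Rightarrow> 'a set \<Rightarrow> bool" where
  "lipschitz_property D L XK \<longleftrightarrow> (\<forall>x\<in>XK. \<forall>x'\<in>XK. norm (D x - D x') \<le> L * norm (x - x'))"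

definition three_point_property ::
  "('a::real_inner \<Rightarrow> 'b::real_inner) \<Rightarrow> ('a \<Rightarrow> 'a \<Rightarrow>\<^sub>L 'b) \<Rightarrow> ('k::finite \<Rightarrow> 'a \<Rightarrow>\<^sub>L 'a) \<Rightarrow>
   ('k \<Rightarrow> real) \<Rightarrow> real \<Rightarrow> real \<Rightarrow> (('a \<Rightarrow>\<^sub>L 'a) \<Rightarrow> real) \<Rightarrow> 'a \<Rightarrow> 'b \<Rightarrow> 'a set \<Rightarrow> bool" where
  "three_point_property K D P \<gamma>K L3 p \<theta> xh yh XK \<longleftrightarrow>
     (\<forall>a. (\<forall>j. 0 \<le> a j) \<longrightarrow>
        (let A = block_op P a; \<Gamma>K = block_op P \<gamma>K in
          0 \<le> \<theta> A \<and>
          (\<forall>x\<in>XK. \<forall>x'\<in>XK.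
             op_inner A (adjoint (blinfun_apply (D x - D xh)) yh) (x' - xh)
             \<ge> op_inner (A o\<^sub>L \<Gamma>K) (x' - xh) (x' - xh)
               + \<theta> A * norm (K xh - K x - D x (xh - x)) powr p
               - L3 / 2 * op_inner A (x' - x) (x' - x))))"

definition monotonicity_property ::
  "('a::real_inner \<Rightarrow> ereal) \<Rightarrow> ('k::finite \<Rightarrow> 'a \<Rightarrow>\<^sub>L 'a) \<Rightarrow> ('k \<Rightarrow> real) \<Rightarrow> 'a \<Rightarrow> 'a set \<Rightarrow> bool" where
  "monotonicity_property f P \<gamma> xh U \<longleftrightarrow>
     (\<forall>qh\<in>subdiff f xh. \<forall>x\<in>U. \<forall>q\<in>subdiff f x.
        (q - qh) \<bullet> (x - xh) \<ge> (\<Sum>j\<in>UNIV. \<gamma> j * (norm (P j (x - xh)))\<^sup>2))"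


section \<open>One iteration of the algorithm\<close>

text \<open>\<open>(x, y)\<close> is the current iterate, \<open>S\<close> the set of selected primal blocks, \<open>xb\<close> the
  over-relaxed point and \<open>(x', y')\<close> the next iterate. The dual step length is the one with index
  \<open>i + 1\<close>. \<open>Fs l\<close> is the conjugate of the dual function of block \<open>l\<close>.\<close>

definition pd_step ::
  "('m::finite \<Rightarrow> 'a::real_inner \<Rightarrow> ereal) \<Rightarrow> ('n::finite \<Rightarrow> 'b::real_inner \<Rightarrow> ereal) \<Rightarrow>
   ('a \<Rightarrow> 'b) \<Rightarrow> ('a \<Rightarrow> 'a \<Rightarrow>\<^sub>L 'b) \<Rightarrow> ('m \<Rightarrow> 'a \<Rightarrow>\<^sub>L 'a) \<Rightarrow> ('n \<Rightarrow> 'b \<Rightarrow>\<^sub>L 'b) \<Rightarrow> ('m \<Rightarrow> real) \<Rightarrow>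
   ('m \<Rightarrow> real) \<Rightarrow> ('n \<Rightarrow> real) \<Rightarrow> real \<Rightarrow> 'm set \<Rightarrow> 'a \<Rightarrow> 'b \<Rightarrow> 'a \<Rightarrow> 'a \<Rightarrow> 'b \<Rightarrow> bool" where
  "pd_step G Fs K D P Q \<pi> \<tau> \<sigma> \<omega>b S x y xb x' y' \<longleftrightarrow>
     (\<forall>j. if j \<in> S
          then is_prox (P j) (\<tau> j) (G j) (P j x - \<tau> j *\<^sub>R P j (adjoint (blinfun_apply (D x)) y)) (P j x')
            \<and> P j xb = P j x' + (\<omega>b / \<pi> j) *\<^sub>R (P j x' - P j x)
          else P j x' = P j x \<and> P j xb = P j x) \<and>
     (\<forall>l. is_prox (Q l) (\<sigma> l) (Fs l) (Q l y + \<sigma> l *\<^sub>R Q l (K xb)) (Q l y'))"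


section \<open>Weights\<close>

text \<open>Below \<open>B\<close> is the derivative of \<open>K\<close> at the current primal iterate.\<close>

definition V_bar ::
  "('m \<Rightarrow> 'a::real_inner \<Rightarrow>\<^sub>L 'a) \<Rightarrow> ('n \<Rightarrow> 'b::real_inner \<Rightarrow>\<^sub>L 'b) \<Rightarrow> ('a \<Rightarrow>\<^sub>L 'b) \<Rightarrow> 'm set \<Rightarrow> 'm \<Rightarrow> 'n \<Rightarrow> 'n set" where
  "V_bar P Q B S j l =
     {k. (\<lambda>y. Q l (B (P j (adjoint (blinfun_apply B) (Q k y))))) \<noteq> (\<lambda>y. 0) \<and> j \<in> S}"

definition block_weight ::
  "('m \<Rightarrow> 'a::real_inner \<Rightarrow>\<^sub>L 'a) \<Rightarrow> ('n::finite \<Rightarrow> 'b::real_inner \<Rightarrow>\<^sub>L 'b) \<Rightarrow> ('m \<Rightarrow> 'n \<Rightarrow> 'n \<Rightarrow> real) \<Rightarrow>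
   ('a \<Rightarrow>\<^sub>L 'b) \<Rightarrow> 'm set \<Rightarrow> 'm \<Rightarrow> 'n \<Rightarrow> real" where
  "block_weight P Q w B S j l =
     (if Q l o\<^sub>L B o\<^sub>L P j \<noteq> 0 then \<Sum>k\<in>V_bar P Q B S j l. w j l k else 0)"

end

theory Submission
  imports Defs
begin

text \<open>Weighting block \<open>j\<close> of the primal variable by \<open>\<eta> i / (\<pi> j * \<tau> i j)\<close> and block \<open>l\<close> of the dual
  variable by \<open>1 / \<sigma> 0 l\<close>, where \<open>\<eta> i\<close> is the product of the \<open>1 / \<omega>b k\<close> with \<open>k < i\<close>, the squared
  distance to the critical point minus
  \<open>2 * \<eta> i * ((y i - yh) \<bullet> D (x i) (x i - xh))\<close> has nonincreasing expectation. The expectation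
  over \<open>S i\<close> turns \<open>D (x i)\<close> applied to the sampled blocks, scaled by \<open>1 / \<pi> j\<close>, into \<open>D (x i) (x i - xh)\<close>; the
  linearisation errors of \<open>K\<close> lie in \<open>Y_nonlin K\<close> and are absorbed by the three-point property and by
  the strong monotonicity of the dual functions. By the bound on \<open>1 - \<kappa>\<close> the correction term leaves
  \<open>\<kappa>\<close> times the weighted primal distance, whose weights grow quadratically. The first iteration is
  excluded because the local properties are only available from the first iterate on. As \<open>x i\<close> and
  \<open>y i\<close> are functions of the finitely many possible histories \<open>S 0, \<dots>, S (i - 1)\<close>, no
  measurability or integrability issues arise.\<close>


section \<open>Adjoints in Hilbert spaces\<close>

text \<open>The primal estimate is scaled by \<open>\<eta> i\<close> and the dual one by
  \<open>\<eta> (Suc i)\<close>. Over-relaxation with \<open>\<omega>b i\<close> brings the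
  extrapolated dual term back to the scale \<open>\<eta> i\<close>; together with the primal
  coupling term it leaves a product of increments and a term linear in the sampled primal error,
  whose mean is the cross term above. The step length rules are what this scaling asks for:
  \<open>\<eta> i / \<sigma> i l\<close> stays constant and \<open>\<eta> i / \<tau> i j\<close>
  grows by \<open>2 * \<eta> i * \<gamma>Gt j\<close>. The obstacle is that this growth affects
  every block, while strong monotonicity acts only on sampled ones. An added term of mean zero moves
  the missing part to the old error of the sampled blocks, where \<open>sampling_trade_off\<close>
  pays for it; this is the origin of
  \<open>\<gamma>Gt j < \<pi> j * (\<gamma>G j + \<gamma>K j)\<close>. The bound on
  \<open>1 - \<kappa>\<close> also sees sampled blocks only, so the final lower bound is proved in
  expectation rather than pathwise.\<close>

text \<open>The library constructs adjoints only in Euclidean spaces. The representing vector of \<open>f\<close>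
  is the minimiser of \<open>x \<mapsto> \<parallel>x\<parallel>\<^sup>2 / 2 - f x\<close>: minimising sequences are Cauchy by the
  parallelogram law.\<close>

lemma riesz_representation:
  fixes f :: "'a::{real_inner,complete_space} \<Rightarrow> real"
  assumes f: "bounded_linear f"
  shows "\<exists>z. \<forall>x. f x = x \<bullet> z"
proof -
  interpret f: bounded_linear f by (rule f)
  define J where "J x = x \<bullet> x / 2 - f x" for x
  obtain C where C: "\<And>x. norm (f x) \<le> norm x * C"
    using f.bounded by blast
  have J_lower: "- (C\<^sup>2 / 2) \<le> J x" for x
  proof -
    have "f x \<le> norm x * C" using C[of x] by simp
    moreover have "0 \<le> (norm x - C)\<^sup>2" by simp
    ultimately show ?thesis
      unfolding J_def by (simp add: power2_norm_eq_inner[symmetric] power2_eq_square algebra_simps)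
  qed
  define I where "I = Inf (range J)"
  have bdd: "bdd_below (range J)" using J_lower by (auto intro!: bdd_belowI[where m="- (C\<^sup>2 / 2)"])
  have I_le: "I \<le> J x" for x unfolding I_def by (intro cInf_lower bdd) simp
  have "\<exists>x. J x < I + 1 / real (Suc n)" for n
    using cInf_lessD[of "range J" "I + 1 / real (Suc n)"] unfolding I_def by auto
  then obtain X where X: "\<And>n. J (X n) < I + 1 / real (Suc n)" by metis
  have par: "(norm (a - b))\<^sup>2 / 4 = J a + J b - 2 * J ((1/2) *\<^sub>R (a + b))" for a b
    unfolding J_def power2_norm_eq_inner
    by (simp add: inner_simps f.add f.scaleR inner_commute field_simps)
  have dist_X: "(norm (X m - X n))\<^sup>2 / 4 \<le> 1 / real (Suc m) + 1 / real (Suc n)" for m n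
    using par[of "X m" "X n"] X[of m] X[of n] I_le[of "(1/2) *\<^sub>R (X m + X n)"] by linarith
  have "Cauchy X"
  proof (rule CauchyI)
    fix e :: real assume e: "0 < e"
    obtain M where M: "8 / e\<^sup>2 < real M" using reals_Archimedean2 by blast
    have Mpos: "0 < real M" using M e by (meson divide_pos_pos less_trans zero_less_numeral zero_less_power)
    have "norm (X m - X n) < e" if "m \<ge> M" "n \<ge> M" for m n
    proof -
      have "1 / real (Suc m) \<le> 1 / real M" "1 / real (Suc n) \<le> 1 / real M"
        using that Mpos by (auto intro!: divide_left_mono)
      then have "(norm (X m - X n))\<^sup>2 \<le> 8 / real M" using dist_X[of m n] by linarith
      also have "\<dots> < e\<^sup>2" using M e Mpos by (simp add: field_simps)
      finally show ?thesis using e by (simp add: power_less_imp_less_base)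
    qed
    then show "\<exists>M. \<forall>m\<ge>M. \<forall>n\<ge>M. norm (X m - X n) < e" by blast
  qed
  then obtain z where z: "X \<longlonglongrightarrow> z" using Cauchy_convergent convergent_def by blast
  have "(\<lambda>n. J (X n)) \<longlonglongrightarrow> J z"
    unfolding J_def by (intro tendsto_intros f.tendsto z) simp
  moreover have "(\<lambda>n. I + 1 / real (Suc n)) \<longlonglongrightarrow> I + 0"
    by (intro tendsto_intros LIMSEQ_Suc[OF lim_1_over_n])
  ultimately have "J z \<le> I + 0" by (rule LIMSEQ_le) (use X less_imp_le in blast)
  then have min: "J z \<le> J x" for x using I_le[of x] by simp
  have "f h = h \<bullet> z" for h
  proof -
    define c where "c = h \<bullet> z - f h"
    have q: "0 \<le> t * c + t\<^sup>2 * (h \<bullet> h) / 2" for t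
      using min[of "z + t *\<^sub>R h"] unfolding J_def c_def
      by (simp add: f.add f.scaleR inner_simps inner_commute power2_eq_square field_simps)
    have "c = 0"
    proof (rule ccontr)
      assume "c \<noteq> 0"
      have "0 \<le> c\<^sup>2 * (- s + s\<^sup>2 * (h \<bullet> h) / 2)" for s
        using q[of "- s * c"] by (simp add: power2_eq_square algebra_simps)
      then have "0 \<le> - s + s\<^sup>2 * (h \<bullet> h) / 2" for s
        using \<open>c \<noteq> 0\<close> by (simp add: zero_le_mult_iff)
      \<comment> \<open>Every small positive \<open>s\<close> gives a contradiction; this one makes
        the linear term dominate without a case distinction for \<open>h = 0\<close>.\<close>
      from this[of "1 / (1 + h \<bullet> h)"] have "2 + (h \<bullet> h * (h \<bullet> h) + h \<bullet> h * 3) \<le> 0"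
        by (simp add: field_simps power2_eq_square add_pos_nonneg split: if_splits)
      then show False
        using inner_ge_zero[of h] mult_nonneg_nonneg[OF inner_ge_zero[of h] inner_ge_zero[of h]]
        by linarith
    qed
    then show ?thesis by (simp add: c_def)
  qed
  then show ?thesis by blast
qed

text \<open>\<open>adjoint\<close> is a choice among the functions that satisfy the adjoint
  identity, so one such function has to be exhibited. Representing
  \<open>x \<mapsto> B x \<bullet> y\<close> gives its value at each \<open>y\<close>.\<close>

lemma adjoint_blinfun_eq:
  fixes B :: "'a::{real_inner,complete_space} \<Rightarrow>\<^sub>L 'b::real_inner"
  shows "x \<bullet> adjoint (blinfun_apply B) y = B x \<bullet> y"
proof -
  have "\<exists>z. \<forall>x. B x \<bullet> y = x \<bullet> z" for y
    by (intro riesz_representation bounded_linear_intros)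
  then obtain g where "\<forall>x y. B x \<bullet> y = x \<bullet> g y" by metis
  then have "adjoint (blinfun_apply B) = g" by (rule adjoint_unique)
  with \<open>\<forall>x y. B x \<bullet> y = x \<bullet> g y\<close> show ?thesis by simp
qed

lemma adjoint_blinfun_eq':
  fixes B :: "'a::{real_inner,complete_space} \<Rightarrow>\<^sub>L 'b::real_inner"
  shows "adjoint (blinfun_apply B) y \<bullet> x = B x \<bullet> y"
  by (metis adjoint_blinfun_eq inner_commute)

lemma adjoint_blinfun_sum:
  fixes B :: "'a::{real_inner,complete_space} \<Rightarrow>\<^sub>L 'b::real_inner"
  shows "adjoint (blinfun_apply B) (\<Sum>l\<in>A. v l) = (\<Sum>l\<in>A. adjoint (blinfun_apply B) (v l))"
  by (rule vector_eq_rdot[THEN iffD1])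
     (simp add: adjoint_blinfun_eq' inner_sum_left inner_sum_right)


section \<open>Orthogonal decompositions\<close>

lemma orth_decompositionD:
  assumes "orth_decomposition P"
  shows "P j (P j x) = P j x"
    and "j \<noteq> k \<Longrightarrow> P j (P k x) = 0"
    and "P j x \<bullet> y = x \<bullet> P j y"
    and "(\<Sum>j\<in>UNIV. P j x) = x"
proof -
  have 1: "P j o\<^sub>L P j = P j" and 3: "P j x \<bullet> y = x \<bullet> P j y"
    using assms by (auto simp: orth_decomposition_def orth_projection_def)
  show "P j (P j x) = P j x" by (metis 1 blinfun_apply_blinfun_compose)
  show "P j x \<bullet> y = x \<bullet> P j y" by (rule 3)
  show "P j (P k x) = 0" if "j \<noteq> k"
    using assms that unfolding orth_decomposition_def
    by (metis blinfun_apply_blinfun_compose zero_blinfun.rep_eq)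
  have "blinfun_apply (\<Sum>j\<in>UNIV. P j) x = x"
    using assms by (simp add: orth_decomposition_def)
  then show "(\<Sum>j\<in>UNIV. P j x) = x" by (simp add: blinfun.sum_left)
qed

lemma orth_decomposition_inner_block:
  assumes "orth_decomposition P"
  shows "P j x \<bullet> P j y = P j x \<bullet> y" and "j \<noteq> k \<Longrightarrow> P j x \<bullet> P k y = 0"
  by (metis assms orth_decompositionD(1,3)) (metis assms orth_decompositionD(2,3) inner_zero_right)

lemma orth_decomposition_inner:
  assumes "orth_decomposition P"
  shows "(\<Sum>j\<in>UNIV. P j x \<bullet> P j y) = x \<bullet> y"
  using orth_decompositionD(4)[OF assms, of x]
  by (simp add: orth_decomposition_inner_block(1)[OF assms] inner_sum_left[symmetric])

lemma orth_decomposition_norm: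
  assumes "orth_decomposition P"
  shows "(\<Sum>j\<in>UNIV. (norm (P j x))\<^sup>2) = (norm x)\<^sup>2"
  using orth_decomposition_inner[OF assms, of x x] by (simp add: power2_norm_eq_inner)

lemma orth_decomposition_proj_sum:
  assumes "orth_decomposition P"
  shows "P k (\<Sum>j\<in>A. c j *\<^sub>R P j (z j)) = (if k \<in> A then c k *\<^sub>R P k (z k) else 0)"
proof -
  have "P k (c j *\<^sub>R P j (z j)) = (if j = k then c k *\<^sub>R P k (z k) else 0)" for j
    using orth_decompositionD(1,2)[OF assms] by (simp add: blinfun.scaleR_right)
  then show ?thesis by (simp add: blinfun.sum_right)
qed

lemma block_op_apply: "block_op P a z = (\<Sum>j\<in>UNIV. a j *\<^sub>R P j z)"
  by (simp add: block_op_def blinfun.sum_left scaleR_blinfun.rep_eq)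

lemma proj_block_op:
  assumes "orth_decomposition P"
  shows "P k (block_op P a z) = a k *\<^sub>R P k z"
  by (simp add: block_op_apply orth_decomposition_proj_sum[OF assms])

lemma inner_block_op:
  assumes "orth_decomposition P"
  shows "block_op P a z \<bullet> z' = (\<Sum>j\<in>UNIV. a j * (P j z \<bullet> P j z'))"
  by (simp add: block_op_apply inner_sum_left orth_decomposition_inner_block(1)[OF assms])

lemma block_op_self_adjoint:
  assumes "orth_decomposition P"
  shows "block_op P a z \<bullet> z' = z \<bullet> block_op P a z'"
  using inner_block_op[OF assms, of a z z'] inner_block_op[OF assms, of a z' z]
  by (simp add: inner_commute)


section \<open>The nonlinear part of the dual space\<close>

text \<open>Along the line through \<open>x\<close> with direction \<open>h\<close> the function
  \<open>y \<bullet> K\<close> is affine. The chain rule and the slope give two values for its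
  derivative, and the slope does not depend on \<open>x\<close>.\<close>

lemma Y_lin_derivative:
  assumes K: "C1_with_derivative K D" and y: "y \<in> Y_lin K"
  shows "y \<bullet> D x h = y \<bullet> K h"
proof -
  have lin: "linear (\<lambda>x. y \<bullet> K x)" using y by (simp add: Y_lin_def)
  have "((\<lambda>t. y \<bullet> K (x + t *\<^sub>R h)) has_real_derivative y \<bullet> D x h) (at 0)"
  proof -
    have "(K has_derivative D x) (at (x + 0 *\<^sub>R h))"
      using K by (simp add: C1_with_derivative_def)
    then have "((\<lambda>t. K (x + t *\<^sub>R h)) has_derivative (\<lambda>t. D x (t *\<^sub>R h))) (at 0)"
      by (rule has_derivative_compose[rotated]) (auto intro!: derivative_eq_intros)
    then show ?thesis
      unfolding has_field_derivative_def
      by (auto intro!: derivative_eq_intros simp: blinfun.scaleR_right)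
  qed
  moreover have "((\<lambda>t. y \<bullet> K (x + t *\<^sub>R h)) has_real_derivative y \<bullet> K h) (at 0)"
    unfolding linear_add[OF lin] linear_scale[OF lin] by (auto intro!: derivative_eq_intros)
  ultimately show ?thesis by (rule DERIV_unique)
qed

text \<open>A component \<open>y \<bullet> K\<close> with \<open>y\<close> in \<open>Y_lin K\<close>
  has no linearisation error. Hence these errors meet only the \<open>P_NL\<close> part of the dual
  error, which is the part that the constants \<open>\<rho>\<close> bound.\<close>

lemma remainder_in_Y_nonlin:
  assumes K: "C1_with_derivative K D"
  shows "K z - K x - D x (z - x) \<in> Y_nonlin K"
proof -
  have "y \<bullet> (K z - K x - D x (z - x)) = 0" if y: "y \<in> Y_lin K" for y
  proof -
    have lin: "linear (\<lambda>x. y \<bullet> K x)" using y by (simp add: Y_lin_def)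
    show ?thesis
      using linear_diff[OF lin, of z x] by (simp add: inner_diff_right Y_lin_derivative[OF K y])
  qed
  then show ?thesis by (simp add: Y_nonlin_def orthogonal_comp_def orthogonal_def)
qed

lemma derivative_diff_in_Y_nonlin:
  assumes K: "C1_with_derivative K D"
  shows "D x' z - D x z \<in> Y_nonlin K"
  by (simp add: Y_nonlin_def orthogonal_comp_def orthogonal_def inner_diff_right
      Y_lin_derivative[OF K])

text \<open>A scalar comparison along the segment takes the place of a vector-valued integral: the
  remainder is tested against itself, and one factor of its norm is cancelled at the end.\<close>

lemma lipschitz_remainder:
  assumes K: "C1_with_derivative K D" and lip: "lipschitz_property D L X"
    and seg: "closed_segment x z \<subseteq> X"
  shows "norm (K z - K x - D x (z - x)) \<le> L / 2 * (norm (z - x))\<^sup>2"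
proof (cases "K z - K x - D x (z - x) = 0")
  case True
  have "0 \<le> L \<or> z = x"
  proof -
    have "x \<in> X" "z \<in> X" using seg by auto
    then have "0 \<le> L * norm (z - x)"
      using lip order_trans[OF norm_ge_zero] unfolding lipschitz_property_def by blast
    then show ?thesis by (auto simp: zero_le_mult_iff)
  qed
  with True show ?thesis by auto
next
  case False
  define h where "h = z - x"
  define e where "e = K z - K x - D x h"
  define g where "g t = e \<bullet> (K (x + t *\<^sub>R h) - K x - t *\<^sub>R D x h) - norm e * L * t\<^sup>2 / 2 * (norm h)\<^sup>2" for t
  have e: "0 < norm e" using False by (simp add: e_def h_def)
  have "g 1 \<le> g 0"
  proof (rule DERIV_nonpos_imp_nonincreasing[of 0 1 g])
    fix t :: real assume t: "0 \<le> t" "t \<le> 1"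
    have "(K has_derivative D (x + t *\<^sub>R h)) (at (x + t *\<^sub>R h))"
      using K by (simp add: C1_with_derivative_def)
    then have "((\<lambda>t. K (x + t *\<^sub>R h)) has_derivative (\<lambda>s. D (x + t *\<^sub>R h) (s *\<^sub>R h))) (at t)"
      by (rule has_derivative_compose[rotated]) (auto intro!: derivative_eq_intros)
    then have "((\<lambda>t. e \<bullet> K (x + t *\<^sub>R h)) has_real_derivative e \<bullet> D (x + t *\<^sub>R h) h) (at t)"
      unfolding has_field_derivative_def
      by (auto intro!: derivative_eq_intros simp: blinfun.scaleR_right)
    then have g': "(g has_real_derivative
        e \<bullet> D (x + t *\<^sub>R h) h - e \<bullet> D x h - norm e * L * t * (norm h)\<^sup>2) (at t)"
      unfolding g_def inner_diff_right inner_scaleR_right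
      by (auto intro!: derivative_eq_intros)
    have "x + t *\<^sub>R h \<in> closed_segment x z" "x \<in> closed_segment x z"
      using t by (auto simp: in_segment h_def algebra_simps intro!: exI[of _ t])
    then have "norm (D (x + t *\<^sub>R h) - D x) \<le> L * norm (t *\<^sub>R h)"
      using lip seg unfolding lipschitz_property_def by (metis add_diff_cancel_left' subsetD)
    then have D: "norm (D (x + t *\<^sub>R h) - D x) \<le> L * t * norm h" using t by simp
    have "e \<bullet> D (x + t *\<^sub>R h) h - e \<bullet> D x h = e \<bullet> (D (x + t *\<^sub>R h) - D x) h"
      by (simp add: blinfun.diff_left inner_diff_right)
    also have "\<dots> \<le> norm e * norm ((D (x + t *\<^sub>R h) - D x) h)" by (rule norm_cauchy_schwarz)
    also have "\<dots> \<le> norm e * (norm (D (x + t *\<^sub>R h) - D x) * norm h)"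
      by (intro mult_left_mono norm_blinfun) auto
    also have "\<dots> \<le> norm e * (L * t * norm h * norm h)"
      by (intro mult_left_mono mult_right_mono D) auto
    finally show "\<exists>y. (g has_real_derivative y) (at t) \<and> y \<le> 0"
      using g' by (auto simp: power2_eq_square algebra_simps)
  qed simp
  moreover have "g 1 = norm e * norm e - norm e * (L / 2 * (norm h)\<^sup>2)"
    by (simp add: g_def h_def e_def power2_norm_eq_inner[symmetric] power2_eq_square)
  moreover have "g 0 = 0" by (simp add: g_def)
  ultimately have "norm e * norm e \<le> norm e * (L / 2 * (norm h)\<^sup>2)" by simp
  then show ?thesis using e by (simp add: e_def h_def)
qed


section \<open>Proximal points and subdifferentials\<close>

lemma convex_funD:
  assumes f: "convex_fun f" and fa: "f a = ereal r" and fb: "f b = ereal r'"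
    and s: "0 \<le> s" "s \<le> 1"
  shows "f ((1 - s) *\<^sub>R a + s *\<^sub>R b) \<le> ereal ((1 - s) * r + s * r')"
proof -
  have c: "convex {(x, r::real). f x \<le> ereal r}"
    using f by (simp add: convex_fun_def)
  have "(1 - s) *\<^sub>R (a, r) + s *\<^sub>R (b, r') \<in> {(x, r::real). f x \<le> ereal r}"
    by (rule convexD[OF c]) (use fa fb s in auto)
  then show ?thesis by simp
qed

text \<open>The epigraph is an intersection of half-spaces, one for each \<open>z\<close> at which
  \<open>f\<close> is finite.\<close>

lemma convex_fun_fenchel_conj:
  assumes "proper_fun f"
  shows "convex_fun (fenchel_conj f)"
proof -
  have "{(y, r::real). fenchel_conj f y \<le> ereal r} =
      (\<Inter>z\<in>{z. f z \<noteq> \<infinity>}. {(y, r). y \<bullet> z - real_of_ereal (f z) \<le> r})"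
  proof -
    have "ereal (y \<bullet> z) - f z \<le> ereal r \<longleftrightarrow> (f z \<noteq> \<infinity> \<longrightarrow> y \<bullet> z - real_of_ereal (f z) \<le> r)" for y z r
      using assms by (cases "f z") (auto simp: proper_fun_def)
    then have "fenchel_conj f y \<le> ereal r \<longleftrightarrow>
        (\<forall>z. f z \<noteq> \<infinity> \<longrightarrow> y \<bullet> z - real_of_ereal (f z) \<le> r)" for y r
      unfolding fenchel_conj_def SUP_le_iff by simp
    then show ?thesis by auto
  qed
  moreover have "convex {(y, r::real). y \<bullet> z - c \<le> r}" for z :: 'a and c
  proof -
    have "{(y, r::real). y \<bullet> z - c \<le> r} = {x. (z, - 1 :: real) \<bullet> x \<le> c}"
      by (auto simp: inner_commute)
    then show ?thesis by (simp add: convex_halfspace_le)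
  qed
  ultimately show ?thesis unfolding convex_fun_def by (auto intro!: convex_INT)
qed

lemma fenchel_conj_not_MInf:
  assumes "proper_fun f"
  shows "fenchel_conj f y \<noteq> -\<infinity>"
proof -
  obtain z where z: "f z \<noteq> \<infinity>" "f z \<noteq> -\<infinity>" using assms by (auto simp: proper_fun_def)
  have "ereal (y \<bullet> z) - f z \<le> fenchel_conj f y" unfolding fenchel_conj_def by (intro SUP_upper) simp
  moreover have "ereal (y \<bullet> z) - f z \<noteq> -\<infinity>" using z by (cases "f z") auto
  ultimately show ?thesis by auto
qed

text \<open>Optimality is tested along the segment from \<open>z\<close> to \<open>P z'\<close>.
  Convexity makes the change of \<open>f\<close> at most linear in the parameter \<open>s\<close>,
  the quadratic term changes by a multiple of \<open>s\<close> plus a multiple of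
  \<open>s\<^sup>2\<close>, and division by \<open>s\<close> followed by
  \<open>s \<longlongrightarrow> 0\<close> gives the subgradient inequality within the range of
  \<open>P\<close>.\<close>

lemma is_prox_subgradient:
  fixes P :: "'a::real_inner \<Rightarrow>\<^sub>L 'a"
  assumes f: "convex_fun f" "\<And>z. f z \<noteq> -\<infinity>" and t: "0 < t"
    and fin: "f (P z0) \<noteq> \<infinity>" and prox: "is_prox P t f v z"
  shows "\<bar>f z\<bar> \<noteq> \<infinity>" and "f (P z') \<ge> f z + ereal ((v - z) \<bullet> (P z' - z) / t)"
proof -
  define N where "N z = (norm (z - v))\<^sup>2 / (2 * t)" for z
  have zr: "z \<in> range P" and min: "f z + ereal (N z) \<le> f (P z') + ereal (N (P z'))" for z'
    using prox unfolding is_prox_def is_arg_min_def N_def by (auto simp: not_less)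
  show fz: "\<bar>f z\<bar> \<noteq> \<infinity>"
    using min[of z0] fin f(2)[of z] f(2)[of "P z0"] by (cases "f (P z0)"; cases "f z") auto
  then obtain r where r: "f z = ereal r" by auto
  show "f (P z') \<ge> f z + ereal ((v - z) \<bullet> (P z' - z) / t)"
  proof (cases "f (P z')")
    case (real r')
    obtain w where w: "z = P w" using zr by auto
    define d where "d = P z' - z"
    have "r - r' \<le> ((z - v) \<bullet> d + s * (d \<bullet> d) / 2) / t" if s: "0 < s" "s \<le> 1" for s
    proof -
      have e: "(1 - s) *\<^sub>R z + s *\<^sub>R P z' = P ((1 - s) *\<^sub>R w + s *\<^sub>R z')"
        by (simp add: w blinfun.add_right blinfun.scaleR_right)
      have "f z + ereal (N z) \<le> ereal ((1 - s) * r + s * r') + ereal (N ((1 - s) *\<^sub>R z + s *\<^sub>R P z'))"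
        using min[of "(1 - s) *\<^sub>R w + s *\<^sub>R z'"] convex_funD[OF f(1) r real, of s] s
        unfolding e[symmetric] by (meson add_right_mono order_trans less_imp_le)
      then have "s * (r - r') \<le> N ((1 - s) *\<^sub>R z + s *\<^sub>R P z') - N z"
        by (simp add: r algebra_simps)
      also have "(1 - s) *\<^sub>R z + s *\<^sub>R P z' = z + s *\<^sub>R d" by (simp add: d_def algebra_simps)
      also have "N (z + s *\<^sub>R d) - N z = s * (((z - v) \<bullet> d + s * (d \<bullet> d) / 2) / t)"
        using t unfolding N_def power2_norm_eq_inner
        by (simp add: inner_simps inner_commute field_simps)
      finally show ?thesis using s by (simp only: mult_le_cancel_left_pos)
    qed
    moreover have "((\<lambda>s. ((z - v) \<bullet> d + s * (d \<bullet> d) / 2) / t) \<longlongrightarrow>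
        ((z - v) \<bullet> d + 0 * (d \<bullet> d) / 2) / t) (at_right 0)"
      using t by (intro tendsto_intros) auto
    moreover have "eventually (\<lambda>s::real. 0 < s \<and> s \<le> 1) (at_right 0)"
      using eventually_at_right_real[of 0 1] by (auto elim: eventually_mono)
    ultimately have "r - r' \<le> ((z - v) \<bullet> d + 0 * (d \<bullet> d) / 2) / t"
      by (intro tendsto_lowerbound[of _ _ "at_right 0"]) (auto elim: eventually_mono)
    moreover have "(z - v) \<bullet> d = - ((v - z) \<bullet> d)" by (simp add: inner_simps)
    ultimately show ?thesis by (simp add: r real d_def)
  qed (use f(2)[of "P z'"] in auto)
qed

text \<open>Each minimiser is tested in the subgradient inequality of the other; the sum of the two
  bounds the squared distance by 0.\<close>

lemma is_prox_unique:
  fixes P :: "'a::real_inner \<Rightarrow>\<^sub>L 'a"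
  assumes f: "convex_fun f" "\<And>z. f z \<noteq> -\<infinity>" and t: "0 < t"
    and fin: "f (P z0) \<noteq> \<infinity>" and prox: "is_prox P t f v z" "is_prox P t f v z'"
  shows "z = z'"
proof -
  obtain w w' where w: "z = P w" "z' = P w'"
    using prox unfolding is_prox_def is_arg_min_def by auto
  obtain r r' where r: "f z = ereal r" "f z' = ereal r'"
    using is_prox_subgradient(1)[OF f t fin prox(1)] is_prox_subgradient(1)[OF f t fin prox(2)] by auto
  have "r + (v - z) \<bullet> (z' - z) / t \<le> r'" "r' + (v - z') \<bullet> (z - z') / t \<le> r"
    using is_prox_subgradient(2)[OF f t fin prox(1), of w'] is_prox_subgradient(2)[OF f t fin prox(2), of w]
    by (simp_all add: r w[symmetric])
  then have "(v - z) \<bullet> (z' - z) / t + (v - z') \<bullet> (z - z') / t \<le> 0" by linarith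
  moreover have "(v - z) \<bullet> (z' - z) / t + (v - z') \<bullet> (z - z') / t = (norm (z - z'))\<^sup>2 / t"
    unfolding power2_norm_eq_inner by (simp add: inner_simps inner_commute add_divide_distrib[symmetric])
  ultimately have "(norm (z - z'))\<^sup>2 \<le> 0" using t by (simp add: divide_le_0_iff)
  then show ?thesis by simp
qed

lemma separable_sum_finite_iff:
  assumes "\<And>j z. f j z \<noteq> -\<infinity>"
  shows "\<bar>separable_sum P f x\<bar> \<noteq> \<infinity> \<longleftrightarrow> (\<forall>j. \<bar>f j (P j x)\<bar> \<noteq> \<infinity>)"
  unfolding separable_sum_def using assms by (simp add: sum_Inf)

lemma subdiff_separable_sumD:
  assumes P: "orth_decomposition P" and f: "\<And>j z. f j z \<noteq> -\<infinity>"
    and q: "q \<in> subdiff (separable_sum P f) x"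
  shows "\<bar>f j (P j x)\<bar> \<noteq> \<infinity>" and "f j (P j z) \<ge> f j (P j x) + ereal (q \<bullet> (P j z - P j x))"
proof -
  have fin: "\<bar>f j (P j x)\<bar> \<noteq> \<infinity>" for j
    using q separable_sum_finite_iff[OF f, where P=P] by (simp add: subdiff_def)
  then show "\<bar>f j (P j x)\<bar> \<noteq> \<infinity>" by simp
  \<comment> \<open>The test point differs from \<open>x\<close> in block \<open>j\<close> only, so
    the other summands, which are finite, cancel.\<close>
  define z' where "z' = x + P j (z - x)"
  have Pz': "P k z' = (if k = j then P j z else P k x)" for k
    using orth_decompositionD(1,2)[OF P] by (simp add: z'_def blinfun.add_right blinfun.diff_right)
  have "separable_sum P f x + ereal (q \<bullet> (z' - x)) \<le> separable_sum P f z'"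
    using q by (simp add: subdiff_def)
  moreover have "separable_sum P f x = (\<Sum>k\<in>UNIV - {j}. f k (P k x)) + f j (P j x)"
    "separable_sum P f z' = (\<Sum>k\<in>UNIV - {j}. f k (P k x)) + f j (P j z)"
    by (simp_all add: separable_sum_def sum.remove[of UNIV j] Pz' add.commute)
  moreover have "\<bar>\<Sum>k\<in>UNIV - {j}. f k (P k x)\<bar> \<noteq> \<infinity>" using fin by (simp add: sum_Inf)
  moreover have "z' - x = P j z - P j x" by (simp add: z'_def blinfun.diff_right)
  ultimately show "f j (P j z) \<ge> f j (P j x) + ereal (q \<bullet> (P j z - P j x))"
    using fin[of j] f[of j "P j z"]
    by (cases "\<Sum>k\<in>UNIV - {j}. f k (P k x)"; cases "f j (P j x)"; cases "f j (P j z)") auto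
qed

lemma subdiff_separable_sumI:
  assumes P: "orth_decomposition P"
    and fin: "\<And>j. \<bar>f j (P j x)\<bar> \<noteq> \<infinity>"
    and le: "\<And>j z. f j (P j z) \<ge> f j (P j x) + ereal (P j q \<bullet> (P j z - P j x))"
  shows "q \<in> subdiff (separable_sum P f) x"
proof -
  have "separable_sum P f x + ereal (q \<bullet> (z - x)) \<le> separable_sum P f z" for z
  proof -
    have "q \<bullet> (z - x) = (\<Sum>j\<in>UNIV. P j q \<bullet> (P j z - P j x))"
      using orth_decomposition_inner[OF P, of q "z - x"] by (simp add: blinfun.diff_right)
    then have "separable_sum P f x + ereal (q \<bullet> (z - x)) =
        (\<Sum>j\<in>UNIV. f j (P j x) + ereal (P j q \<bullet> (P j z - P j x)))"
      by (simp add: separable_sum_def sum.distrib)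
    also have "\<dots> \<le> (\<Sum>j\<in>UNIV. f j (P j z))" by (intro sum_mono le)
    finally show ?thesis by (simp add: separable_sum_def)
  qed
  moreover have "\<bar>separable_sum P f x\<bar> \<noteq> \<infinity>"
    unfolding separable_sum_def using fin by (simp add: sum_Inf)
  ultimately show ?thesis by (simp add: subdiff_def)
qed

text \<open>Monotonicity is a property of the whole separable sum, but the proximal inclusion holds
  only in the blocks of \<open>J\<close>. It is therefore applied at the hybrid point with the
  blocks of \<open>x'\<close> in \<open>J\<close> and those of \<open>xh\<close> elsewhere, with the
  proximal residuals \<open>r j\<close> in \<open>J\<close> and \<open>qh\<close> elsewhere as a
  subgradient. The primal estimate takes singletons \<open>J\<close>, so that each block can carry
  its own weight \<open>1 / \<pi> j\<close>; the dual estimate takes all blocks at once.\<close>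

lemma prox_monotone:
  fixes P :: "'k::finite \<Rightarrow> 'a::real_inner \<Rightarrow>\<^sub>L 'a"
  assumes P: "orth_decomposition P"
    and f: "\<And>j. convex_fun (f j)" "\<And>j z. f j z \<noteq> -\<infinity>"
    and mono: "monotonicity_property (separable_sum P f) P \<gamma> xh U"
    and qh: "qh \<in> subdiff (separable_sum P f) xh"
    and t: "\<And>j. 0 < t j"
    and prox: "\<And>j. j \<in> J \<Longrightarrow> is_prox (P j) (t j) (f j) (P j x - t j *\<^sub>R P j g) (P j x')"
    and U: "xh + (\<Sum>j\<in>J. P j (x' - xh)) \<in> U"
  shows "(\<Sum>j\<in>J. (P j (x - x') \<bullet> P j (x' - xh)) / t j) \<ge>
    (\<Sum>j\<in>J. (g + qh) \<bullet> P j (x' - xh) + \<gamma> j * (norm (P j (x' - xh)))\<^sup>2)"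
proof -
  define z where "z = xh + (\<Sum>j\<in>J. P j (x' - xh))"
  define r where "r j = (1 / t j) *\<^sub>R P j (x - x') - P j g" for j
  define q where "q = qh + (\<Sum>j\<in>J. r j - P j qh)"
  have Pr: "r j - P j qh = P j ((1 / t j) *\<^sub>R (x - x') - g - qh)" for j
    by (simp add: r_def blinfun.diff_right blinfun.scaleR_right)
  have proj_sum: "P k (\<Sum>j\<in>J. P j (v j)) = (if k \<in> J then P k (v k) else 0)" for k v
    using orth_decomposition_proj_sum[OF P, of k "\<lambda>_. 1" v J] by simp
  have Pz: "P j z = (if j \<in> J then P j x' else P j xh)" for j
    unfolding z_def blinfun.add_right proj_sum by (simp add: blinfun.diff_right)
  have Pq: "P j q = (if j \<in> J then r j else P j qh)" for j
    unfolding q_def blinfun.add_right Pr proj_sum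
    by (simp add: r_def blinfun.diff_right blinfun.scaleR_right)
  note qhD = subdiff_separable_sumD[OF P f(2) qh]
  have q: "q \<in> subdiff (separable_sum P f) z"
  proof (rule subdiff_separable_sumI[OF P])
    fix j v
    show "\<bar>f j (P j z)\<bar> \<noteq> \<infinity>"
    proof (cases "j \<in> J")
      case True
      have "f j (P j xh) \<noteq> \<infinity>" using qhD(1)[of j] by auto
      then show ?thesis
        using is_prox_subgradient(1)[OF f(1,2) t _ prox[OF True]] True by (simp add: Pz)
    qed (simp add: Pz qhD)
    show "f j (P j z) + ereal (P j q \<bullet> (P j v - P j z)) \<le> f j (P j v)"
    proof (cases "j \<in> J")
      case True
      have "f j (P j x') + ereal ((P j x - t j *\<^sub>R P j g - P j x') \<bullet> (P j v - P j x') / t j) \<le> f j (P j v)"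
        using is_prox_subgradient(2)[OF f(1,2) t _ prox[OF True], of xh] qhD(1)[of j] by auto
      moreover have "P j x - t j *\<^sub>R P j g - P j x' = t j *\<^sub>R r j"
        using t[of j] by (simp add: r_def blinfun.diff_right algebra_simps)
      ultimately show ?thesis using True t[of j] by (simp add: Pz Pq)
    next
      case False
      have "P j qh \<bullet> (P j v - P j xh) = qh \<bullet> (P j v - P j xh)"
        using orth_decomposition_inner_block(1)[OF P, of j "v - xh" qh]
        by (simp add: blinfun.diff_right inner_commute)
      then show ?thesis using qhD(2)[of j v] False by (simp add: Pz Pq)
    qed
  qed
  have "z \<in> U" using U by (simp add: z_def)
  then have le: "(\<Sum>j\<in>UNIV. \<gamma> j * (norm (P j (z - xh)))\<^sup>2) \<le> (q - qh) \<bullet> (z - xh)"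
    using mono qh q by (simp add: monotonicity_property_def)
  have Pzx: "P j (z - xh) = (if j \<in> J then P j (x' - xh) else 0)" for j
    by (simp add: blinfun.diff_right Pz)
  have Pqq: "P j (q - qh) = (if j \<in> J then r j - P j qh else 0)" for j
    by (simp add: blinfun.diff_right Pq)
  have "(\<Sum>j\<in>UNIV. \<gamma> j * (norm (P j (z - xh)))\<^sup>2) = (\<Sum>j\<in>J. \<gamma> j * (norm (P j (x' - xh)))\<^sup>2)"
    unfolding Pzx by (rule sum.mono_neutral_cong_right) auto
  moreover have "(q - qh) \<bullet> (z - xh) = (\<Sum>j\<in>J. (r j - P j qh) \<bullet> P j (x' - xh))"
    unfolding orth_decomposition_inner[OF P, of "q - qh" "z - xh", symmetric] Pzx Pqq
    by (rule sum.mono_neutral_cong_right) auto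
  moreover have "(r j - P j qh) \<bullet> P j (x' - xh) =
      (P j (x - x') \<bullet> P j (x' - xh)) / t j - (g + qh) \<bullet> P j (x' - xh)" for j
  proof -
    have "P j g \<bullet> P j (x' - xh) = g \<bullet> P j (x' - xh)" "P j qh \<bullet> P j (x' - xh) = qh \<bullet> P j (x' - xh)"
      by (metis P orth_decompositionD(1,3))+
    then show ?thesis by (simp add: r_def inner_diff_left inner_add_left)
  qed
  ultimately show ?thesis using le by (simp add: sum_subtractf sum.distrib)
qed


section \<open>The nonlinear dual terms\<close>

text \<open>For \<open>p > 1\<close>, division by \<open>m\<^sup>2\<close> turns this into a
  weighted inequality between arithmetic and geometric mean for the ratio \<open>R / m\<close>;
  afterwards \<open>m\<close> is replaced by its bound \<open>r\<close> in the power
  \<open>2 - p\<close>. For \<open>p = 1\<close> the convention \<open>0\<^sup>0 = 1\<close> lets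
  \<open>z\<close> be 0.\<close>

lemma weighted_young:
  assumes p: "1 \<le> p" "p \<le> 2" and z: "0 \<le> z" "1 < p \<Longrightarrow> 0 < z"
    and R: "0 \<le> R" and m: "0 \<le> m" "m \<le> r"
  shows "R * m \<le> p powr (- p) * (rpow z (1 - p) * rpow r (2 - p)) * R powr p + (p - 1) * z * m\<^sup>2"
proof (cases "m = 0 \<or> R = 0")
  case True
  then show ?thesis using p z by (auto simp: rpow_def)
next
  case False
  then have pos: "0 < m" "0 < R" "0 < r" using R m by auto
  show ?thesis
  proof (cases "p = 1")
    case True
    then show ?thesis using pos m by (simp add: rpow_def mult.commute mult_left_mono)
  next
    case False
    then have p1: "1 < p" using p by simp
    then have zp: "0 < z" using z by simp
    define s where "s = R / m"
    have s: "0 < s" using pos by (simp add: s_def)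
    \<comment> \<open>\<open>u\<close> is chosen so that its mean with \<open>p * z\<close>,
      geometric with exponents \<open>1/p\<close> and \<open>1 - 1/p\<close>, equals
      \<open>s\<close>. The arithmetic mean then produces both \<open>p powr (- p)\<close> and the
      coefficient \<open>(p - 1) * z\<close>.\<close>
    define u where "u = p powr (1 - p) * z powr (1 - p) * s powr p"
    have "u powr (1/p) * (p * z) powr (1 - 1/p) \<le> 1/p * u + (1 - 1/p) * (p * z)"
    proof -
      have "exp ((1/p) * ln u + (1 - 1/p) * ln (p*z)) \<le> (1/p) * exp (ln u) + (1 - 1/p) * exp (ln (p*z))"
        using convex_onD[OF exp_convex, of "1 - 1/p" "ln u" "ln (p*z)"] p1 by simp
      then show ?thesis using p1 zp s by (simp add: powr_def exp_add u_def)
    qed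
    moreover have "u powr (1/p) * (p * z) powr (1 - 1/p) = s"
    proof -
      have "ln u = (1 - p) * ln (p * z) + p * ln s"
        using p1 zp s by (simp add: u_def ln_mult ln_powr algebra_simps)
      then have "(1/p) * ln u + (1 - 1/p) * ln (p*z) = ln s" using p1 by (simp add: field_simps)
      then have "exp ((1/p) * ln u + (1 - 1/p) * ln (p*z)) = s" using s by simp
      then show ?thesis using p1 zp s by (simp add: powr_def exp_add u_def)
    qed
    moreover have "1/p * u = p powr (- p) * z powr (1 - p) * s powr p"
      using p1 by (simp add: u_def powr_diff powr_minus field_simps)
    moreover have "(1 - 1/p) * (p * z) = (p - 1) * z" using p1 by (simp add: field_simps)
    ultimately have s_le: "s \<le> p powr (- p) * z powr (1 - p) * s powr p + (p - 1) * z" by simp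
    have sm: "s powr p * m\<^sup>2 = m powr (2 - p) * R powr p"
      using pos by (simp add: s_def powr_divide powr_diff field_simps flip: powr_numeral)
    have "R * m = s * m\<^sup>2" using pos by (simp add: s_def power2_eq_square)
    also have "\<dots> \<le> (p powr (- p) * z powr (1 - p) * s powr p + (p - 1) * z) * m\<^sup>2"
      by (intro mult_right_mono s_le) simp
    also have "\<dots> = p powr (- p) * z powr (1 - p) * (m powr (2 - p) * R powr p) + (p - 1) * z * m\<^sup>2"
      unfolding sm[symmetric] by (simp add: algebra_simps)
    finally have "R * m \<le> p powr (- p) * z powr (1 - p) * (m powr (2 - p) * R powr p) + (p - 1) * z * m\<^sup>2" .
    also have "\<dots> \<le> p powr (- p) * z powr (1 - p) * (r powr (2 - p) * R powr p) + (p - 1) * z * m\<^sup>2"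
      using p m pos by (intro add_mono mult_left_mono mult_right_mono powr_mono2) auto
    finally have "R * m \<le> p powr (- p) * z powr (1 - p) * (r powr (2 - p) * R powr p) + (p - 1) * z * m\<^sup>2" .
    moreover have "z powr (1 - p) = rpow z (1 - p)" "r powr (2 - p) = rpow r (2 - p)"
      using p1 pos by (auto simp: rpow_def)
    ultimately show ?thesis by (simp only: mult.assoc)
  qed
qed

text \<open>A block with \<open>Q l o\<^sub>L PN = 0\<close> is orthogonal to all three error
  vectors. In any other block the strong monotonicity is spent twice:
  \<open>(p - 1) * \<zeta> l\<close> on \<open>R\<close> through \<open>weighted_young\<close>, and
  \<open>\<alpha>\<close> on \<open>E3\<close> through Young's inequality. The vector
  \<open>E\<close> uses only the bound \<open>\<rho> l\<close>. Since \<open>E3\<close> is charged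
  once per block, the number of blocks appears.\<close>

lemma dual_nonlinear_bound:
  fixes Q :: "'n::finite \<Rightarrow> 'y::real_inner \<Rightarrow>\<^sub>L 'y"
  assumes Q: "orth_decomposition Q" and PN: "orth_projection PN"
    and R: "R \<in> range PN" and E: "E \<in> range PN" and E3: "E3 \<in> range PN"
    and p: "1 \<le> p" "p \<le> 2" and \<zeta>: "\<And>l. 0 \<le> \<zeta> l" "\<And>l. 1 < p \<Longrightarrow> 0 < \<zeta> l"
    and \<alpha>: "0 < \<alpha>"
    and \<gamma>: "\<And>l. 0 \<le> (if Q l o\<^sub>L PN = 0 then \<gamma> l else \<gamma> l - (p - 1) * \<zeta> l - \<alpha>)"
    and \<rho>: "\<And>l. op_norm PN (Q l d) \<le> \<rho> l"
  shows "(\<Sum>l\<in>UNIV. \<gamma> l * (norm (Q l d))\<^sup>2) + (R - E + E3) \<bullet> d \<ge>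
    - (p powr (- p) * (\<Sum>l\<in>UNIV. rpow (\<zeta> l) (1 - p) * rpow (\<rho> l) (2 - p)) * norm R powr p)
    - norm E * (\<Sum>l\<in>UNIV. \<rho> l) - real CARD('n) * (norm E3)\<^sup>2 / (4 * \<alpha>)"
proof -
  have idem: "PN (PN z) = PN z" and sym: "PN z \<bullet> z' = z \<bullet> PN z'" for z z'
    using PN unfolding orth_projection_def by (metis blinfun_apply_blinfun_compose, auto)
  have opn: "op_norm PN z = norm (PN z)" for z
    unfolding op_norm_def op_inner_def norm_eq_sqrt_inner by (metis idem sym)
  have PN_le: "norm (PN z) \<le> norm z" for z
  proof -
    have "norm (PN z) * norm (PN z) = PN z \<bullet> z"
      by (metis idem sym power2_eq_square power2_norm_eq_inner)
    also have "\<dots> \<le> norm (PN z) * norm z" by (rule norm_cauchy_schwarz)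
    finally show ?thesis by (cases "norm (PN z) = 0") auto
  qed
  have in_range: "v \<bullet> z = v \<bullet> PN z" if "v \<in> range PN" for v z
    using that by (metis idem sym imageE)
  have "\<gamma> l * (norm (Q l d))\<^sup>2 + (R - E + E3) \<bullet> Q l d \<ge>
      - (p powr (- p) * (rpow (\<zeta> l) (1 - p) * rpow (\<rho> l) (2 - p)) * norm R powr p)
      - norm E * \<rho> l - (norm E3)\<^sup>2 / (4 * \<alpha>)" for l
  proof -
    define m where "m = norm (PN (Q l d))"
    have m: "0 \<le> m" "m \<le> \<rho> l" "m \<le> norm (Q l d)" using \<rho>[of l] PN_le by (auto simp: m_def opn)
    have rp: "0 \<le> p powr (- p) * (rpow (\<zeta> l) (1 - p) * rpow (\<rho> l) (2 - p)) * norm R powr p"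
      "0 \<le> norm E * \<rho> l" "0 \<le> (norm E3)\<^sup>2 / (4 * \<alpha>)"
      using m \<alpha> by (auto simp: rpow_def)
    show ?thesis
    proof (cases "Q l o\<^sub>L PN = 0")
      case True
      have "v \<bullet> Q l d = 0" if v: "v \<in> range PN" for v
      proof -
        obtain w where "v = PN w" using v by auto
        then have "v \<bullet> Q l d = Q l (PN w) \<bullet> d" by (simp add: orth_decompositionD(3)[OF Q])
        then show ?thesis
          using True by (metis blinfun_apply_blinfun_compose inner_zero_left zero_blinfun.rep_eq)
      qed
      then have "(R - E + E3) \<bullet> Q l d = 0" using R E E3 by (simp add: inner_simps)
      then show ?thesis using rp \<gamma>[of l] True
        by (smt (verit) mult_nonneg_nonneg zero_le_power2)
    next
      case False
      have "\<bar>v \<bullet> Q l d\<bar> \<le> norm v * m" if "v \<in> range PN" for v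
        using in_range[OF that, of "Q l d"] Cauchy_Schwarz_ineq2[of v "PN (Q l d)"] by (simp add: m_def)
      note b = this[OF R] this[OF E] this[OF E3]
      have b1: "norm R * m \<le> p powr (- p) * (rpow (\<zeta> l) (1 - p) * rpow (\<rho> l) (2 - p)) * norm R powr p
          + (p - 1) * \<zeta> l * m\<^sup>2"
        using p \<zeta> m by (intro weighted_young) auto
      have b2: "norm E * m \<le> norm E * \<rho> l" using m by (intro mult_left_mono) auto
      have b3: "norm E3 * m \<le> (norm E3)\<^sup>2 / (4 * \<alpha>) + \<alpha> * m\<^sup>2"
      proof -
        have "0 \<le> (norm E3 - 2 * \<alpha> * m)\<^sup>2 / (4 * \<alpha>)" using \<alpha> by simp
        also have "\<dots> = (norm E3)\<^sup>2 / (4 * \<alpha>) + \<alpha> * m\<^sup>2 - norm E3 * m"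
          using \<alpha> by (simp add: power2_eq_square field_simps)
        finally show ?thesis by simp
      qed
      have "((p - 1) * \<zeta> l + \<alpha>) * m\<^sup>2 \<le> ((p - 1) * \<zeta> l + \<alpha>) * (norm (Q l d))\<^sup>2"
        using p \<zeta>(1)[of l] \<alpha> m by (intro mult_left_mono power_mono) auto
      also have "\<dots> \<le> \<gamma> l * (norm (Q l d))\<^sup>2"
        using \<gamma>[of l] False by (intro mult_right_mono) auto
      finally have b4: "(p - 1) * \<zeta> l * m\<^sup>2 + \<alpha> * m\<^sup>2 \<le> \<gamma> l * (norm (Q l d))\<^sup>2"
        by (simp add: algebra_simps)
      have "(R - E + E3) \<bullet> Q l d = R \<bullet> Q l d - E \<bullet> Q l d + E3 \<bullet> Q l d" by (simp add: inner_simps)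
      then show ?thesis using b b1 b2 b3 b4 by linarith
    qed
  qed
  then have "(\<Sum>l\<in>UNIV. - (p powr (- p) * (rpow (\<zeta> l) (1 - p) * rpow (\<rho> l) (2 - p)) * norm R powr p)
      - norm E * \<rho> l - (norm E3)\<^sup>2 / (4 * \<alpha>)) \<le>
      (\<Sum>l\<in>UNIV. \<gamma> l * (norm (Q l d))\<^sup>2 + (R - E + E3) \<bullet> Q l d)"
    by (intro sum_mono)
  also have "\<dots> = (\<Sum>l\<in>UNIV. \<gamma> l * (norm (Q l d))\<^sup>2) + (R - E + E3) \<bullet> d"
    using orth_decompositionD(4)[OF Q, of d] by (simp add: sum.distrib inner_sum_right[symmetric])
  finally show ?thesis
    by (simp add: sum_subtractf sum_negf sum_distrib_left sum_distrib_right)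
qed


section \<open>The step length condition\<close>

lemma blinfun_adjoint_bound:
  fixes B :: "'a::{real_inner,complete_space} \<Rightarrow>\<^sub>L 'b::real_inner"
  shows "norm (adjoint (blinfun_apply B) y) \<le> norm B * norm y"
proof -
  let ?z = "adjoint (blinfun_apply B) y"
  have "norm ?z * norm ?z = B ?z \<bullet> y"
    using adjoint_blinfun_eq[of ?z B y] by (simp add: power2_norm_eq_inner[symmetric] power2_eq_square)
  also have "\<dots> \<le> norm (B ?z) * norm y" by (rule norm_cauchy_schwarz)
  also have "\<dots> \<le> norm B * norm ?z * norm y" by (intro mult_right_mono norm_blinfun) auto
  finally have "norm ?z * norm ?z \<le> norm ?z * (norm B * norm y)" by (simp add: mult.commute mult.left_commute)
  then show ?thesis by (cases "norm ?z = 0") auto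
qed

lemma block_weight_nonneg:
  assumes "\<And>j l k. 0 < w j l k"
  shows "0 \<le> block_weight P Q w B S j l"
  using assms by (auto simp: block_weight_def less_imp_le intro!: sum_nonneg)

text \<open>The square expands into inner products of the contributions of the dual blocks, and only
  interacting pairs survive. Young's inequality with the reciprocal weights \<open>w j l k\<close>
  and \<open>w j k l\<close> splits each product, and symmetry of the interaction relation collects
  the two halves into one row sum.\<close>

lemma block_weight_bound:
  fixes B :: "'x::{real_inner,complete_space} \<Rightarrow>\<^sub>L 'y::real_inner"
    and P :: "'m \<Rightarrow> 'x \<Rightarrow>\<^sub>L 'x" and Q :: "'n::finite \<Rightarrow> 'y \<Rightarrow>\<^sub>L 'y"
  assumes P: "orth_projection (P j)" and Q: "orth_decomposition Q"
    and w: "\<And>j l k. 0 < w j l k" "\<And>j l k. w j l k = 1 / w j k l" and j: "j \<in> S"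
  shows "(norm (P j (adjoint (blinfun_apply B) v)))\<^sup>2 \<le>
    (\<Sum>l\<in>UNIV. block_weight P Q w B S j l * (norm (P j (adjoint (blinfun_apply B) (Q l v))))\<^sup>2)"
proof -
  let ?Ba = "adjoint (blinfun_apply B)"
  define a where "a l = P j (?Ba (Q l v))" for l
  define V where "V l = V_bar P Q B S j l" for l
  have PP: "P j (P j z) = P j z" "P j z \<bullet> z' = z \<bullet> P j z'" for z z'
    using P unfolding orth_projection_def by (metis blinfun_apply_blinfun_compose, auto)
  have form: "Q l (B (P j (?Ba (Q k y)))) \<bullet> y' = P j (?Ba (Q l y')) \<bullet> P j (?Ba (Q k y))" for l k y y'
  proof -
    have "Q l (B (P j (?Ba (Q k y)))) \<bullet> y' = P j (?Ba (Q k y)) \<bullet> ?Ba (Q l y')"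
      by (simp add: orth_decompositionD(3)[OF Q] adjoint_blinfun_eq)
    also have "\<dots> = P j (P j (?Ba (Q k y))) \<bullet> ?Ba (Q l y')" by (simp only: PP(1))
    also have "\<dots> = P j (?Ba (Q k y)) \<bullet> P j (?Ba (Q l y'))" by (rule PP(2))
    finally show ?thesis by (simp only: inner_commute)
  qed
  \<comment> \<open>The operators of the pairs \<open>(l, k)\<close> and \<open>(k, l)\<close> are
    adjoint to each other, so they vanish together.\<close>
  have V_sym: "l \<in> V k" if "k \<in> V l" for k l
  proof (rule ccontr)
    assume "l \<notin> V k"
    then have "Q k (B (P j (?Ba (Q l y)))) = 0" for y
      using j by (auto simp: V_def V_bar_def fun_eq_iff)
    then have "Q l (B (P j (?Ba (Q k y)))) = 0" for y
      using form[of l k y "Q l (B (P j (?Ba (Q k y))))"] form[of k l _ y]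
      by (metis inner_commute inner_eq_zero_iff inner_zero_left)
    then show False using that by (simp add: V_def V_bar_def)
  qed
  have a_inner: "a l \<bullet> a k = Q l (B (P j (?Ba (Q k v)))) \<bullet> v" for l k
    by (simp only: a_def form)
  have a0: "a l \<bullet> a k = 0" if "k \<notin> V l" for l k
  proof -
    have "Q l (B (P j (?Ba (Q k v)))) = 0" using that j by (auto simp: V_def V_bar_def fun_eq_iff)
    then show ?thesis by (simp add: a_inner)
  qed
  have young: "a l \<bullet> a k \<le> (w j l k * (norm (a l))\<^sup>2 + w j k l * (norm (a k))\<^sup>2) / 2" for l k
  proof -
    have wp: "0 < w j l k" and wk: "w j k l = 1 / w j l k"
      using w(1)[of j l k] w(2)[of j k l] by auto
    have "0 \<le> (w j l k * norm (a l) - norm (a k))\<^sup>2 / w j l k" using wp by simp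
    also have "\<dots> = w j l k * (norm (a l))\<^sup>2 + w j k l * (norm (a k))\<^sup>2 - 2 * (norm (a l) * norm (a k))"
      using wp by (simp add: wk power2_eq_square field_simps)
    finally show ?thesis using norm_cauchy_schwarz[of "a l" "a k"] by simp
  qed
  have "P j (?Ba v) = (\<Sum>l\<in>UNIV. a l)"
    unfolding a_def by (simp add: blinfun.sum_right[symmetric] adjoint_blinfun_sum[symmetric] orth_decompositionD(4)[OF Q])
  then have "(norm (P j (?Ba v)))\<^sup>2 = (\<Sum>l\<in>UNIV. \<Sum>k\<in>UNIV. a l \<bullet> a k)"
    by (simp add: power2_norm_eq_inner inner_sum_left inner_sum_right inner_commute)
  also have "\<dots> \<le> (\<Sum>l\<in>UNIV. \<Sum>k\<in>UNIV. if k \<in> V l then (w j l k * (norm (a l))\<^sup>2 + w j k l * (norm (a k))\<^sup>2) / 2 else 0)"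
    using young a0 by (intro sum_mono) auto
  also have "\<dots> = (\<Sum>l\<in>UNIV. \<Sum>k\<in>UNIV. if k \<in> V l then w j l k * (norm (a l))\<^sup>2 / 2 else 0)
      + (\<Sum>l\<in>UNIV. \<Sum>k\<in>UNIV. if k \<in> V l then w j k l * (norm (a k))\<^sup>2 / 2 else 0)"
    unfolding sum.distrib[symmetric] by (intro sum.cong) (auto simp: add_divide_distrib)
  also have "(\<Sum>l\<in>UNIV. \<Sum>k\<in>UNIV. if k \<in> V l then w j k l * (norm (a k))\<^sup>2 / 2 else 0) =
      (\<Sum>l\<in>UNIV. \<Sum>k\<in>UNIV. if k \<in> V l then w j l k * (norm (a l))\<^sup>2 / 2 else 0)"
    by (subst sum.swap) (intro sum.cong; use V_sym in auto)
  also have "(\<Sum>l\<in>UNIV. \<Sum>k\<in>UNIV. if k \<in> V l then w j l k * (norm (a l))\<^sup>2 / 2 else 0) +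
      (\<Sum>l\<in>UNIV. \<Sum>k\<in>UNIV. if k \<in> V l then w j l k * (norm (a l))\<^sup>2 / 2 else 0) =
      (\<Sum>l\<in>UNIV. \<Sum>k\<in>UNIV. if k \<in> V l then w j l k * (norm (a l))\<^sup>2 else 0)"
    unfolding sum.distrib[symmetric] by (intro sum.cong) auto
  also have "\<dots> = (\<Sum>l\<in>UNIV. block_weight P Q w B S j l * (norm (a l))\<^sup>2)"
  proof (intro sum.cong refl)
    fix l
    show "(\<Sum>k\<in>UNIV. if k \<in> V l then w j l k * (norm (a l))\<^sup>2 else 0) =
        block_weight P Q w B S j l * (norm (a l))\<^sup>2"
    proof (cases "Q l o\<^sub>L B o\<^sub>L P j = 0")
      \<comment> \<open>\<open>block_weight\<close> takes its default value 0 here, which is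
        consistent because \<open>a l\<close> vanishes.\<close>
      case True
      have "Q l (B (P j z)) = 0" for z
        using arg_cong[OF True, of "\<lambda>T. blinfun_apply T z"] by simp
      then have "a l \<bullet> a l = 0" by (simp add: a_inner)
      then have "a l = 0" by simp
      then show ?thesis by (simp add: sum.neutral)
    next
      case False
      then show ?thesis
        by (simp add: block_weight_def V_def sum_distrib_right sum.If_cases)
    qed
  qed
  finally show ?thesis by (simp add: a_def)
qed

text \<open>Young's inequality in each sampled block moves the operator to the dual side, where
  \<open>block_weight_bound\<close> separates the dual blocks and the norm condition bounds each of
  them by \<open>c\<close>, which cancels the \<open>1 / c\<close> from Young. The condition is
  stated for initial step lengths and passes to later ones by \<open>le\<close>. The estimate is
  applied to increments in \<open>one_step\<close> and to errors in the final lower bound.\<close>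

lemma coupling_estimate:
  fixes B :: "'x::{real_inner,complete_space} \<Rightarrow>\<^sub>L 'y::real_inner"
    and P :: "'m::finite \<Rightarrow> 'x \<Rightarrow>\<^sub>L 'x" and Q :: "'n::finite \<Rightarrow> 'y \<Rightarrow>\<^sub>L 'y"
  assumes P: "orth_decomposition P" and Q: "orth_decomposition Q"
    and w: "\<And>j l k. 0 < w j l k" "\<And>j l k. w j l k = 1 / w j k l"
    and \<pi>: "\<And>j. 0 < \<pi> j" and t: "\<And>j. 0 < t j" and s: "\<And>l. 0 < s l"
    and c: "0 < c"
    and le: "\<And>j l. s l * t j \<le> s0 l * t0 j"
    and norm_le: "\<And>l. (norm (\<Sum>j\<in>S. sqrt (block_weight P Q w B S j l * s0 l * t0 j / \<pi> j)
               *\<^sub>R (Q l o\<^sub>L B o\<^sub>L P j)))\<^sup>2 \<le> c"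
  shows "2 * (B (\<Sum>j\<in>S. (1 / \<pi> j) *\<^sub>R P j u) \<bullet> v) \<le>
    c * (\<Sum>j\<in>S. (norm (P j u))\<^sup>2 / (\<pi> j * t j)) + (\<Sum>l\<in>UNIV. (norm (Q l v))\<^sup>2 / s l)"
proof -
  let ?Ba = "adjoint (blinfun_apply B)"
  define W where "W j l = block_weight P Q w B S j l" for j l
  have W: "0 \<le> W j l" for j l unfolding W_def by (rule block_weight_nonneg[OF w(1)])
  have proj: "orth_projection (P j)" for j using P by (simp add: orth_decomposition_def)
  have dual: "(\<Sum>j\<in>S. W j l * (s l * t j) / \<pi> j * (norm (P j (?Ba (Q l v))))\<^sup>2) \<le> c * (norm (Q l v))\<^sup>2" for l
  proof -
    define q where "q j = sqrt (W j l * s0 l * t0 j / \<pi> j)" for j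
    define T where "T = (\<Sum>j\<in>S. q j *\<^sub>R (Q l o\<^sub>L B o\<^sub>L P j))"
    have nn: "0 \<le> W j l * s0 l * t0 j / \<pi> j" for j
    proof -
      have "0 \<le> s0 l * t0 j" using le[of l j] s[of l] t[of j] by (meson mult_pos_pos less_imp_le order_trans)
      then show ?thesis using W[of j l] \<pi>[of j] by (simp add: mult.assoc)
    qed
    have T: "T z = (\<Sum>j\<in>S. q j *\<^sub>R Q l (B (P j z)))" for z
      by (simp add: T_def blinfun.sum_left scaleR_blinfun.rep_eq)
    \<comment> \<open>The adjoint of \<open>T\<close> maps into mutually orthogonal primal blocks.
      Its squared norm is therefore the weighted sum over \<open>S\<close>, while the bound on
      \<open>T\<close> carries over to it.\<close>
    have "adjoint (blinfun_apply T) (Q l v) = (\<Sum>j\<in>S. q j *\<^sub>R P j (?Ba (Q l v)))"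
    proof (rule vector_eq_ldot[THEN iffD1], intro allI)
      fix z
      have "Q l (B (P j z)) \<bullet> Q l v = z \<bullet> P j (?Ba (Q l v))" for j
        by (simp only: orth_decompositionD(1,3)[OF Q] orth_decompositionD(3)[OF P, symmetric]
            adjoint_blinfun_eq)
      then show "z \<bullet> adjoint (blinfun_apply T) (Q l v) = z \<bullet> (\<Sum>j\<in>S. q j *\<^sub>R P j (?Ba (Q l v)))"
        by (simp add: adjoint_blinfun_eq T inner_sum_left inner_sum_right)
    qed
    moreover have "(norm (\<Sum>j\<in>S. q j *\<^sub>R P j (?Ba (Q l v))))\<^sup>2 = (\<Sum>j\<in>S. (q j)\<^sup>2 * (norm (P j (?Ba (Q l v))))\<^sup>2)"
      (is "(norm ?X)\<^sup>2 = _")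
    proof -
      have "(norm ?X)\<^sup>2 = (\<Sum>k\<in>UNIV. (norm (P k ?X))\<^sup>2)"
        by (rule orth_decomposition_norm[OF P, symmetric])
      also have "\<dots> = (\<Sum>k\<in>UNIV. if k \<in> S then (q k)\<^sup>2 * (norm (P k (?Ba (Q l v))))\<^sup>2 else 0)"
        by (intro sum.cong) (auto simp: orth_decomposition_proj_sum[OF P] power_mult_distrib)
      finally show ?thesis by (simp add: sum.If_cases)
    qed
    ultimately have "(\<Sum>j\<in>S. (q j)\<^sup>2 * (norm (P j (?Ba (Q l v))))\<^sup>2) \<le> (norm T * norm (Q l v))\<^sup>2"
      using blinfun_adjoint_bound[of T "Q l v"] by (metis norm_ge_zero power_mono)
    also have "\<dots> \<le> c * (norm (Q l v))\<^sup>2"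
      unfolding power_mult_distrib using norm_le[of l]
      by (intro mult_right_mono) (simp_all add: T_def q_def W_def)
    finally have "(\<Sum>j\<in>S. (q j)\<^sup>2 * (norm (P j (?Ba (Q l v))))\<^sup>2) \<le> c * (norm (Q l v))\<^sup>2" .
    moreover have "W j l * (s l * t j) / \<pi> j \<le> (q j)\<^sup>2" for j
    proof -
      have "W j l * (s l * t j) / \<pi> j \<le> W j l * (s0 l * t0 j) / \<pi> j"
        using le[of l j] W[of j l] \<pi>[of j] by (intro divide_right_mono mult_left_mono) auto
      then show ?thesis using nn[of j] by (simp add: q_def mult.assoc)
    qed
    then have "(\<Sum>j\<in>S. W j l * (s l * t j) / \<pi> j * (norm (P j (?Ba (Q l v))))\<^sup>2) \<le>
        (\<Sum>j\<in>S. (q j)\<^sup>2 * (norm (P j (?Ba (Q l v))))\<^sup>2)"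
      by (intro sum_mono mult_right_mono) auto
    ultimately show ?thesis by linarith
  qed
  have young: "2 * (P j u \<bullet> P j (?Ba v)) / \<pi> j \<le>
      c * (norm (P j u))\<^sup>2 / (\<pi> j * t j) + t j / (c * \<pi> j) * (norm (P j (?Ba v)))\<^sup>2" for j
  proof -
    have "0 \<le> (c * norm (P j u) - t j * norm (P j (?Ba v)))\<^sup>2 / (c * \<pi> j * t j)"
      using c \<pi>[of j] t[of j] by simp
    also have "\<dots> = c * (norm (P j u))\<^sup>2 / (\<pi> j * t j) + t j / (c * \<pi> j) * (norm (P j (?Ba v)))\<^sup>2
        - 2 * (norm (P j u) * norm (P j (?Ba v))) / \<pi> j"
      using c \<pi>[of j] t[of j] by (simp add: power2_eq_square field_simps)
    finally show ?thesis
      using \<pi>[of j] norm_cauchy_schwarz[of "P j u" "P j (?Ba v)"]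
        divide_right_mono[of "2 * (P j u \<bullet> P j (?Ba v))" "2 * (norm (P j u) * norm (P j (?Ba v)))" "\<pi> j"]
      by linarith
  qed
  have "(\<Sum>j\<in>S. t j / \<pi> j * (norm (P j (?Ba v)))\<^sup>2) \<le>
      (\<Sum>j\<in>S. t j / \<pi> j * (\<Sum>l\<in>UNIV. W j l * (norm (P j (?Ba (Q l v))))\<^sup>2))"
    using block_weight_bound[where P=P and w=w, OF proj Q w] \<pi> t unfolding W_def
    by (intro sum_mono mult_left_mono) (auto intro: less_imp_le)
  also have "\<dots> = (\<Sum>l\<in>UNIV. (1 / s l) * (\<Sum>j\<in>S. W j l * (s l * t j) / \<pi> j * (norm (P j (?Ba (Q l v))))\<^sup>2))"
    unfolding sum_distrib_left
    by (subst sum.swap) (intro sum.cong refl; use s in \<open>simp add: field_simps less_imp_neq[symmetric]\<close>)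
  also have "\<dots> \<le> (\<Sum>l\<in>UNIV. (1 / s l) * (c * (norm (Q l v))\<^sup>2))"
    using s by (intro sum_mono mult_left_mono dual) (auto intro: less_imp_le)
  also have "\<dots> = c * (\<Sum>l\<in>UNIV. (norm (Q l v))\<^sup>2 / s l)"
    by (simp add: sum_distrib_left)
  finally have d: "(\<Sum>j\<in>S. t j / \<pi> j * (norm (P j (?Ba v)))\<^sup>2) \<le> c * (\<Sum>l\<in>UNIV. (norm (Q l v))\<^sup>2 / s l)" .
  have "2 * (B (\<Sum>j\<in>S. (1 / \<pi> j) *\<^sub>R P j u) \<bullet> v) = (\<Sum>j\<in>S. 2 * (P j u \<bullet> P j (?Ba v)) / \<pi> j)"
    by (simp add: orth_decomposition_inner_block(1)[OF P] adjoint_blinfun_eq[of _ B v, symmetric]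
        inner_sum_left sum_distrib_left)
  also have "\<dots> \<le> (\<Sum>j\<in>S. c * (norm (P j u))\<^sup>2 / (\<pi> j * t j) + t j / (c * \<pi> j) * (norm (P j (?Ba v)))\<^sup>2)"
    by (intro sum_mono young)
  also have "\<dots> = c * (\<Sum>j\<in>S. (norm (P j u))\<^sup>2 / (\<pi> j * t j)) + (1 / c) * (\<Sum>j\<in>S. t j / \<pi> j * (norm (P j (?Ba v)))\<^sup>2)"
    by (simp add: sum.distrib sum_distrib_left mult.commute)
  also have "\<dots> \<le> c * (\<Sum>j\<in>S. (norm (P j u))\<^sup>2 / (\<pi> j * t j)) + (1 / c) * (c * (\<Sum>l\<in>UNIV. (norm (Q l v))\<^sup>2 / s l))"
    using c by (intro add_left_mono mult_left_mono d) auto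
  finally show ?thesis using c by simp
qed


section \<open>Accelerated step lengths\<close>

locale accelerated_steps =
  fixes \<tau> :: "nat \<Rightarrow> 'm::finite \<Rightarrow> real" and \<sigma> :: "nat \<Rightarrow> 'n \<Rightarrow> real" and \<omega>b :: "nat \<Rightarrow> real"
    and \<gamma> :: "'m \<Rightarrow> real"
  assumes tau0: "\<And>j. 0 < \<tau> 0 j" and sigma0: "\<And>l. 0 < \<sigma> 0 l" and gamma: "\<And>j. 0 < \<gamma> j"
    and omega_rule: "\<And>i. \<omega>b i = (MAX j\<in>UNIV. 1 / sqrt (1 + 2 * \<tau> i j * \<gamma> j))"
    and sigma_rule: "\<And>i l. \<sigma> (Suc i) l = \<sigma> i l / \<omega>b i"
    and tau_rule: "\<And>i j. \<tau> (Suc i) j = 1 / (1 + 2 * \<tau> i j * \<gamma> j) * (\<tau> i j / \<omega>b i)"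
begin

definition \<eta> :: "nat \<Rightarrow> real" where "\<eta> i = (\<Prod>k<i. 1 / \<omega>b k)"

lemma eta_0 [simp]: "\<eta> 0 = 1" and eta_Suc: "\<eta> (Suc i) = \<eta> i / \<omega>b i"
  by (simp_all add: \<eta>_def)

lemma omega_ge: "1 / sqrt (1 + 2 * \<tau> i j * \<gamma> j) \<le> \<omega>b i"
  unfolding omega_rule by (intro Max_ge) auto

lemma tau_pos: "0 < \<tau> i j" and omega_pos: "0 < \<omega>b i"
proof -
  have omega: "0 < \<omega>b i" if "\<And>j. 0 < \<tau> i j" for i
  proof -
    \<comment> \<open>\<open>undefined\<close> serves as an arbitrary element of the nonempty index
      type.\<close>
    have "0 < 1 / sqrt (1 + 2 * \<tau> i undefined * \<gamma> undefined)"
      using that[of undefined] gamma[of undefined] by (simp add: add_pos_nonneg)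
    then show ?thesis using omega_ge[of i undefined] by linarith
  qed
  have tau: "\<forall>j. 0 < \<tau> i j" for i
  proof (induction i)
    case 0
    then show ?case using tau0 by simp
  next
    case (Suc i)
    then show ?case
      using omega[of i] gamma by (simp add: tau_rule add_pos_pos zero_less_mult_iff)
  qed
  then show "0 < \<tau> i j" "0 < \<omega>b i" using omega by auto
qed

lemma gain_gt_1: "1 < 1 + 2 * \<tau> i j * \<gamma> j"
  using tau_pos[of i j] gamma[of j] by simp

lemma gain_pos: "0 < 1 + 2 * \<tau> i j * \<gamma> j"
  by (rule less_trans[OF zero_less_one gain_gt_1])

lemma omega_le_1: "\<omega>b i \<le> 1"
proof -
  have "1 / sqrt (1 + 2 * \<tau> i j * \<gamma> j) \<le> 1" for j
  proof -
    have "1 \<le> sqrt (1 + 2 * \<tau> i j * \<gamma> j)"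
      unfolding real_sqrt_ge_1_iff by (rule less_imp_le[OF gain_gt_1])
    then show ?thesis using gain_pos[of i j] by (simp only: divide_le_eq_1_pos real_sqrt_gt_0_iff)
  qed
  then show ?thesis unfolding omega_rule by (subst Max_le_iff) auto
qed

text \<open>The reason for the maximum in \<open>\<omega>b\<close>: in every block the gain factor
  dominates \<open>1 / (\<omega>b i)\<^sup>2\<close>, so neither the primal step lengths nor the
  products of primal and dual step lengths grow.\<close>

lemma inv_omega_sq_le: "1 / (\<omega>b i)\<^sup>2 \<le> 1 + 2 * \<tau> i j * \<gamma> j"
proof -
  let ?g = "1 + 2 * \<tau> i j * \<gamma> j"
  have g: "0 < ?g" by (rule gain_pos)
  have "(1 / sqrt ?g)\<^sup>2 \<le> (\<omega>b i)\<^sup>2" using omega_ge[of i j] g by (intro power_mono) auto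
  then have "1 / ?g \<le> (\<omega>b i)\<^sup>2" using g by (simp add: power_divide)
  then have "1 \<le> (\<omega>b i)\<^sup>2 * ?g" using g by (simp only: pos_divide_le_eq)
  then show ?thesis using omega_pos[of i] by (simp only: pos_divide_le_eq zero_less_power mult.commute)
qed

lemma tau_antimono: "\<tau> (Suc i) j \<le> \<tau> i j"
proof -
  let ?g = "1 + 2 * \<tau> i j * \<gamma> j"
  have "1 / \<omega>b i \<le> 1 / (\<omega>b i)\<^sup>2"
    using omega_pos[of i] omega_le_1[of i] by (simp add: power2_eq_square field_simps)
  also have "\<dots> \<le> ?g" by (rule inv_omega_sq_le)
  finally have "1 / \<omega>b i / ?g \<le> 1" using gain_pos[of i j] by (simp only: divide_le_eq_1_pos)
  then have "\<tau> i j * (1 / \<omega>b i / ?g) \<le> \<tau> i j * 1"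
    using tau_pos[of i j] by (intro mult_left_mono) auto
  then show ?thesis by (simp add: tau_rule mult.commute)
qed

lemma tau_le: "\<tau> i j \<le> \<tau> 0 j"
  by (induction i) (auto intro: order_trans[OF tau_antimono])

text \<open>The primal step lengths decrease, hence so do the gains. This lets the constants with
  \<open>\<omega>b 0\<close> serve in every iteration.\<close>

lemma omega_0_le: "\<omega>b 0 \<le> \<omega>b i"
proof -
  have "1 / sqrt (1 + 2 * \<tau> 0 j * \<gamma> j) \<le> \<omega>b i" for j
  proof -
    have "sqrt (1 + 2 * \<tau> i j * \<gamma> j) \<le> sqrt (1 + 2 * \<tau> 0 j * \<gamma> j)"
      using tau_le[of i j] gamma[of j] by simp
    then have "1 / sqrt (1 + 2 * \<tau> 0 j * \<gamma> j) \<le> 1 / sqrt (1 + 2 * \<tau> i j * \<gamma> j)"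
      by (rule divide_left_mono) (simp_all add: gain_pos del: real_sqrt_le_iff)
    then show ?thesis using omega_ge[of i j] by linarith
  qed
  then show ?thesis unfolding omega_rule[of 0] by (subst Max_le_iff) auto
qed

lemma eta_ge_1: "1 \<le> \<eta> i"
proof (induction i)
  case (Suc i)
  then show ?case using omega_pos[of i] omega_le_1[of i] by (simp add: eta_Suc field_simps)
qed simp

lemma sigma_eq: "\<sigma> i l = \<eta> i * \<sigma> 0 l"
  by (induction i) (simp_all add: sigma_rule eta_Suc)

text \<open>Carries the step length condition from the initial values to all iterations.\<close>

lemma sigma_tau_le: "\<sigma> i l * \<tau> i j \<le> \<sigma> 0 l * \<tau> 0 j"
proof (induction i)
  case (Suc i)
  let ?g = "1 + 2 * \<tau> i j * \<gamma> j"
  have g: "0 < ?g" by (rule gain_pos)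
  have pos: "0 < \<sigma> i l" using sigma0[of l] eta_ge_1[of i] by (simp add: sigma_eq[of i])
  have "\<sigma> (Suc i) l * \<tau> (Suc i) j = \<sigma> i l * \<tau> i j * (1 / (\<omega>b i)\<^sup>2 / ?g)"
    by (simp add: sigma_rule tau_rule power2_eq_square)
  also have "\<dots> \<le> \<sigma> i l * \<tau> i j * 1"
  proof (rule mult_left_mono)
    show "1 / (\<omega>b i)\<^sup>2 / ?g \<le> 1"
      using inv_omega_sq_le[of i j] g by (simp only: divide_le_eq_1_pos)
  qed (use pos tau_pos[of i j] in auto)
  finally show ?case using Suc by simp
qed simp

text \<open>The recursion for \<open>\<tau>\<close> is designed for this identity: the factor
  \<open>\<omega>b i\<close> cancels, so the increment is exact in every block, including those that
  do not attain the maximum.\<close>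

lemma phi_Suc: "\<eta> (Suc i) / \<tau> (Suc i) j = \<eta> i / \<tau> i j + 2 * \<eta> i * \<gamma> j"
  using omega_pos[of i] tau_pos[of i j] gain_gt_1[of i j]
  by (simp add: eta_Suc tau_rule field_simps)

text \<open>The block \<open>k\<close> minimising \<open>\<tau> 0 j * \<gamma> j\<close> attains the maximum in the definition of
  \<open>\<omega>b i\<close> for every \<open>i\<close>, and \<open>\<eta> i * (\<tau> i k * \<gamma> k)\<close> does not depend on \<open>i\<close>; hence
  \<open>\<eta> (Suc i)\<^sup>2 = \<eta> i\<^sup>2 + 2 u \<eta> i\<close> with \<open>u = \<tau> 0 k * \<gamma> k\<close>.\<close>

lemma eta_linear_growth: "\<exists>d>0. d \<le> 1 \<and> (\<forall>i. 1 + d * real i \<le> \<eta> i)"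
proof -
  obtain k where k: "\<And>j. \<tau> 0 k * \<gamma> k \<le> \<tau> 0 j * \<gamma> j"
    using ex_is_arg_min_if_finite[of UNIV "\<lambda>j. \<tau> 0 j * \<gamma> j"] by (auto simp: is_arg_min_linorder)
  define u where "u i = \<tau> i k * \<gamma> k" for i
  have u_pos: "0 < u i" for i using tau_pos[of i k] gamma[of k] by (simp add: u_def)
  have u_min: "u i \<le> \<tau> i j * \<gamma> j" for i j
  proof (induction i)
    case 0
    then show ?case using k by (simp add: u_def)
  next
    case (Suc i)
    let ?v = "\<tau> i j * \<gamma> j"
    have v: "0 < ?v" using tau_pos[of i j] gamma[of j] by simp
    \<comment> \<open>Monotonicity of this map keeps the initial minimiser minimal under the
      recursion.\<close>
    have "a / (1 + 2 * a) \<le> b / (1 + 2 * b)" if "0 < a" "a \<le> b" for a b :: real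
      using that by (simp add: field_simps)
    then have "u i / (1 + 2 * u i) \<le> ?v / (1 + 2 * ?v)" using Suc u_pos[of i] by blast
    then have "u i / (1 + 2 * u i) / \<omega>b i \<le> ?v / (1 + 2 * ?v) / \<omega>b i"
      using omega_pos[of i] by (intro divide_right_mono) auto
    then show ?case by (simp add: u_def tau_rule mult.assoc)
  qed
  have omega: "\<omega>b i = 1 / sqrt (1 + 2 * u i)" for i
    unfolding omega_rule
  proof (rule Max_eqI)
    fix z assume "z \<in> range (\<lambda>j. 1 / sqrt (1 + 2 * \<tau> i j * \<gamma> j))"
    then obtain j where z: "z = 1 / sqrt (1 + 2 * \<tau> i j * \<gamma> j)" by auto
    have "sqrt (1 + 2 * u i) \<le> sqrt (1 + 2 * \<tau> i j * \<gamma> j)"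
      using u_min[of i j] by simp
    then show "z \<le> 1 / sqrt (1 + 2 * u i)"
      unfolding z using u_pos[of i] gain_gt_1[of i j] by (intro divide_left_mono) auto
  qed (auto simp: u_def mult.assoc)
  have u_Suc: "u (Suc i) = u i * \<omega>b i" for i
  proof -
    have s: "sqrt (1 + 2 * u i) * sqrt (1 + 2 * u i) = 1 + 2 * u i" using u_pos[of i] by simp
    have "u (Suc i) = u i / (1 + 2 * u i) / \<omega>b i" by (simp add: u_def tau_rule mult.assoc)
    also have "\<dots> = u i * \<omega>b i"
      unfolding omega using u_pos[of i] s[symmetric] by (simp add: field_simps)
    finally show ?thesis .
  qed
  have eta_u: "\<eta> i * u i = u 0" for i
    by (induction i) (use omega_pos in \<open>auto simp: eta_Suc u_Suc field_simps less_imp_neq[symmetric]\<close>)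
  \<comment> \<open>Since \<open>d \<le> 1 \<le> \<eta> i\<close>, adding \<open>d\<close> to
    \<open>\<eta> i\<close> raises its square by at most \<open>3 * d * \<eta> i\<close>; the second
    bound on \<open>d\<close> makes this at most the available
    \<open>2 * u 0 * \<eta> i\<close>.\<close>
  define d where "d = min 1 (2 * u 0 / 3)"
  have d: "0 < d" "d \<le> 1" "3 * d \<le> 2 * u 0" using u_pos[of 0] by (auto simp: d_def)
  have "1 + d * real i \<le> \<eta> i" for i
  proof (induction i)
    case (Suc i)
    have "(\<eta> i + d)\<^sup>2 \<le> (\<eta> i)\<^sup>2 + 3 * d * \<eta> i"
      using d eta_ge_1[of i] mult_mono[of d 1 1 "\<eta> i"] mult_left_mono[of d "\<eta> i" d]
      by (simp add: power2_eq_square algebra_simps)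
    also have "\<dots> \<le> (\<eta> i)\<^sup>2 + 2 * u 0 * \<eta> i"
      using d eta_ge_1[of i] by (intro add_left_mono mult_right_mono) auto
    also have "\<dots> = (\<eta> i)\<^sup>2 * (1 + 2 * u i)"
      by (simp add: eta_u[of i, symmetric] power2_eq_square algebra_simps)
    also have "\<dots> = (\<eta> (Suc i))\<^sup>2"
      using u_pos[of i] by (simp add: eta_Suc omega power_mult_distrib)
    finally have "\<eta> i + d \<le> \<eta> (Suc i)"
      using eta_ge_1[of "Suc i"] by (intro power2_le_imp_le[of "\<eta> i + d"]) auto
    then show ?case using Suc by (simp add: algebra_simps)
  qed simp
  with d show ?thesis by blast
qed

text \<open>The increments in \<open>phi_Suc\<close> grow at least linearly, so their sums grow
  quadratically.\<close>

lemma phi_quadratic_growth: "\<exists>c>0. \<forall>N. c * (real N)\<^sup>2 \<le> \<eta> N / \<tau> N j"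
proof -
  obtain d where d: "0 < d" "d \<le> 1" "\<And>i. 1 + d * real i \<le> \<eta> i"
    using eta_linear_growth by blast
  have "\<gamma> j * d * (real N)\<^sup>2 \<le> \<eta> N / \<tau> N j" for N
  proof (induction N)
    case 0
    then show ?case using tau_pos[of 0 j] by simp
  next
    case (Suc N)
    have "\<gamma> j * d * (real (Suc N))\<^sup>2 = \<gamma> j * d * (real N)\<^sup>2 + \<gamma> j * (2 * (d * real N) + d)"
      by (simp add: power2_eq_square algebra_simps)
    also have "\<gamma> j * (2 * (d * real N) + d) \<le> \<gamma> j * (2 * \<eta> N)"
      using d(2) d(3)[of N] gamma[of j] by (intro mult_left_mono) auto
    finally show ?case using Suc phi_Suc[of N j] by (simp add: algebra_simps del: of_nat_Suc)
  qed
  moreover have "0 < \<gamma> j * d" using d gamma by simp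
  ultimately show ?thesis by blast
qed

end


section \<open>Pathwise estimate for one iteration\<close>

text \<open>Converts strong monotonicity at the new point, which is available only for sampled blocks,
  into the decrease that in expectation compensates the metric update of the blocks that were not
  sampled.\<close>

lemma sampling_trade_off:
  fixes e e' :: "'a::real_inner"
  assumes \<pi>: "0 < \<pi>" "\<pi> \<le> 1" and g: "0 < \<gamma>t" "\<gamma>t < \<pi> * \<gamma>"
  shows "2 * \<gamma>t * (norm e')\<^sup>2 + 2 * (1 - \<pi>) * (\<gamma>t / \<pi>) * (norm e)\<^sup>2 \<le>
    2 * \<gamma> * (norm e')\<^sup>2 + 2 * (1 - \<pi>) * \<gamma> * ((\<gamma> - \<gamma>t) / (\<pi> * \<gamma> - \<gamma>t)) * (norm (e' - e))\<^sup>2"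
proof -
  have \<gamma>: "0 < \<gamma>" using g \<pi> by (metis less_trans zero_less_mult_pos)
  have "\<pi> * \<gamma> \<le> \<gamma>" using \<pi> \<gamma> by simp
  then have g2: "\<gamma>t < \<gamma>" using g by simp
  \<comment> \<open>\<open>t\<close> is the solution of \<open>t1\<close>, which matches the
    coefficient of the old error; it is positive exactly because the target rate
    \<open>\<gamma>t\<close> lies below \<open>\<pi> * \<gamma>\<close>.\<close>
  define t where "t = (\<pi> * \<gamma> - \<gamma>t) / (\<pi> * (\<gamma> - \<gamma>t))"
  have t: "0 < t" using g g2 \<pi> by (simp add: t_def)
  have t1: "(\<gamma> - \<gamma>t) * (1 - t) = (1 - \<pi>) * (\<gamma>t / \<pi>)"
    using g g2 \<pi> by (simp add: t_def field_simps)
  have inv_t: "1 / t = \<pi> * (\<gamma> - \<gamma>t) / (\<pi> * \<gamma> - \<gamma>t)" by (simp add: t_def)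
  define d where "d = e' - e"
  have "(norm e')\<^sup>2 + (1 - t) / t * (norm d)\<^sup>2 - (1 - t) * (norm e)\<^sup>2 = (norm (t *\<^sub>R e' + (1 - t) *\<^sub>R d))\<^sup>2 / t"
  proof -
    have e: "e = e' - d" by (simp add: d_def)
    show ?thesis unfolding e power2_norm_eq_inner using t
      by (simp add: inner_simps inner_commute field_simps power2_eq_square)
  qed
  then have "(1 - t) * (norm e)\<^sup>2 \<le> (norm e')\<^sup>2 + (1 - t) / t * (norm d)\<^sup>2"
    using t by (smt (verit) divide_nonneg_pos zero_le_power2)
  then have "(\<gamma> - \<gamma>t) * ((1 - t) * (norm e)\<^sup>2) \<le> (\<gamma> - \<gamma>t) * ((norm e')\<^sup>2 + (1 - t) / t * (norm d)\<^sup>2)"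
    using g2 by (intro mult_left_mono) auto
  then have main: "(1 - \<pi>) * (\<gamma>t / \<pi>) * (norm e)\<^sup>2 \<le> (\<gamma> - \<gamma>t) * (norm e')\<^sup>2 + (1 - \<pi>) * (\<gamma>t / \<pi>) / t * (norm d)\<^sup>2"
    unfolding t1[symmetric] by (simp add: algebra_simps)
  have "(1 - \<pi>) * (\<gamma>t / \<pi>) / t = (1 - \<pi>) * \<gamma>t * ((\<gamma> - \<gamma>t) / (\<pi> * \<gamma> - \<gamma>t))"
    using inv_t \<pi> by (simp add: divide_inverse)
  also have "\<dots> \<le> (1 - \<pi>) * \<gamma> * ((\<gamma> - \<gamma>t) / (\<pi> * \<gamma> - \<gamma>t))"
    using \<pi> g g2 by (intro mult_right_mono mult_left_mono) auto
  finally have "(1 - \<pi>) * (\<gamma>t / \<pi>) / t * (norm d)\<^sup>2 \<le>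
      (1 - \<pi>) * \<gamma> * ((\<gamma> - \<gamma>t) / (\<pi> * \<gamma> - \<gamma>t)) * (norm d)\<^sup>2"
    by (intro mult_right_mono) auto
  with main have "(1 - \<pi>) * (\<gamma>t / \<pi>) * (norm e)\<^sup>2 \<le> \<gamma> * (norm e')\<^sup>2 - \<gamma>t * (norm e')\<^sup>2
      + (1 - \<pi>) * \<gamma> * ((\<gamma> - \<gamma>t) / (\<pi> * \<gamma> - \<gamma>t)) * (norm d)\<^sup>2"
    by (simp only: left_diff_distrib)
  then show ?thesis unfolding d_def mult.assoc by linarith
qed

lemma inner_three_points:
  fixes a b c :: "'a::real_inner"
  shows "2 * ((a - b) \<bullet> (b - c)) = (norm (a - c))\<^sup>2 - (norm (b - c))\<^sup>2 - (norm (b - a))\<^sup>2"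
  unfolding power2_norm_eq_inner by (simp add: inner_simps inner_commute)

lemma sum_block_weights:
  fixes a :: "'m::finite \<Rightarrow> real"
  shows "(\<Sum>j\<in>UNIV. (if j \<in> S then a j else 0) * f j) = (\<Sum>j\<in>S. a j * f j)"
  by (rule sum.mono_neutral_cong_right) auto

text \<open>The monotonicity inequalities of the sampled blocks are summed with weights
  \<open>1 / \<pi> j\<close>. The gradient difference \<open>v\<close> is split at the adjoint of
  \<open>D x\<close> applied to \<open>yh\<close>: one part is what the three-point property
  controls, the other is the coupling with the dual error.\<close>

lemma primal_estimate:
  fixes K :: "'x::{real_inner,complete_space} \<Rightarrow> 'y::{real_inner,complete_space}"
    and P :: "'m::finite \<Rightarrow> 'x \<Rightarrow>\<^sub>L 'x"
  assumes P: "orth_decomposition P"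
    and G: "\<And>j. convex_fun (G j)" "\<And>j z. G j z \<noteq> -\<infinity>"
    and crit: "- adjoint (blinfun_apply (D xh)) yh \<in> subdiff (separable_sum P G) xh"
    and mono: "monotonicity_property (separable_sum P G) P \<gamma>G xh XG"
    and three_point: "three_point_property K D P \<gamma>K L3 p \<theta> xh yh XK"
    and \<pi>: "\<And>j. 0 < \<pi> j" and t: "\<And>j. 0 < t j" and \<eta>: "0 < \<eta>"
    and prox: "\<And>j. j \<in> S \<Longrightarrow>
      is_prox (P j) (t j) (G j) (P j x - t j *\<^sub>R P j (adjoint (blinfun_apply (D x)) y)) (P j x')"
    and XK: "x \<in> XK" "x' \<in> XK" and XG: "\<And>j. j \<in> S \<Longrightarrow> xh + P j (x' - xh) \<in> XG"
    and A: "A = block_op P (\<lambda>j. if j \<in> S then 1 / \<pi> j else 0)"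
  shows "(\<Sum>j\<in>S. \<eta> / (\<pi> j * t j) * ((norm (P j (x - xh)))\<^sup>2 - (norm (P j (x' - xh)))\<^sup>2 - (norm (P j (x' - x)))\<^sup>2))
    \<ge> 2 * \<eta> * ((\<Sum>j\<in>S. (\<gamma>G j + \<gamma>K j) / \<pi> j * (norm (P j (x' - xh)))\<^sup>2)
        + \<theta> A * norm (K xh - K x - D x (xh - x)) powr p
        - L3 / 2 * (\<Sum>j\<in>S. (norm (P j (x' - x)))\<^sup>2 / \<pi> j)
        + (y - yh) \<bullet> D x (A (x' - xh)))"
proof -
  let ?a = "\<lambda>j. if j \<in> S then 1 / \<pi> j else 0"
  define v where "v = adjoint (blinfun_apply (D x)) y + - adjoint (blinfun_apply (D xh)) yh"
  have a: "0 \<le> ?a j" for j using \<pi>[of j] by simp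
  have block: "v \<bullet> P j (x' - xh) + \<gamma>G j * (norm (P j (x' - xh)))\<^sup>2 \<le>
      (P j (x - x') \<bullet> P j (x' - xh)) / t j" if "j \<in> S" for j
    using prox_monotone[where P=P and f=G and J="{j}" and t=t and x=x and x'=x',
        OF P G mono crit t prox] that XG[OF that] by (simp add: v_def)
  have "2 * \<eta> * (\<Sum>j\<in>S. 1 / \<pi> j * (v \<bullet> P j (x' - xh) + \<gamma>G j * (norm (P j (x' - xh)))\<^sup>2)) \<le>
      2 * \<eta> * (\<Sum>j\<in>S. 1 / \<pi> j * ((P j (x - x') \<bullet> P j (x' - xh)) / t j))"
    using \<pi> \<eta> block by (intro mult_left_mono sum_mono) (auto intro: less_imp_le)
  also have "\<dots> = (\<Sum>j\<in>S. \<eta> / (\<pi> j * t j) * (2 * ((P j x - P j x') \<bullet> (P j x' - P j xh))))"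
    by (simp add: sum_distrib_left blinfun.diff_right mult.assoc mult.left_commute)
  also have "\<dots> = (\<Sum>j\<in>S. \<eta> / (\<pi> j * t j) * ((norm (P j (x - xh)))\<^sup>2 - (norm (P j (x' - xh)))\<^sup>2 - (norm (P j (x' - x)))\<^sup>2))"
    unfolding inner_three_points by (simp add: blinfun.diff_right)
  finally have 1: "2 * \<eta> * (\<Sum>j\<in>S. 1 / \<pi> j * (v \<bullet> P j (x' - xh) + \<gamma>G j * (norm (P j (x' - xh)))\<^sup>2)) \<le> \<dots>" .
  have Az: "A z = (\<Sum>j\<in>S. (1 / \<pi> j) *\<^sub>R P j z)" for z
    unfolding A block_op_apply by (rule sum.mono_neutral_cong_right) auto
  have "(\<Sum>j\<in>S. 1 / \<pi> j * (v \<bullet> P j (x' - xh))) = v \<bullet> A (x' - xh)"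
    by (simp add: Az inner_sum_right)
  also have "\<dots> = op_inner A (adjoint (blinfun_apply (D x - D xh)) yh) (x' - xh) + (y - yh) \<bullet> D x (A (x' - xh))"
    unfolding op_inner_def A block_op_self_adjoint[OF P] v_def
    by (simp add: inner_add_left adjoint_blinfun_eq' blinfun.diff_left inner_diff_left inner_diff_right inner_commute)
  finally have 2: "(\<Sum>j\<in>S. 1 / \<pi> j * (v \<bullet> P j (x' - xh))) = \<dots>" .
  have "op_inner (A o\<^sub>L block_op P \<gamma>K) (x' - xh) (x' - xh) =
      (\<Sum>j\<in>UNIV. ?a j * (\<gamma>K j * (norm (P j (x' - xh)))\<^sup>2))"
    unfolding op_inner_def A blinfun_apply_blinfun_compose inner_block_op[OF P] proj_block_op[OF P]
    by (simp add: power2_norm_eq_inner)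
  then have 3: "op_inner (A o\<^sub>L block_op P \<gamma>K) (x' - xh) (x' - xh) =
      (\<Sum>j\<in>S. 1 / \<pi> j * (\<gamma>K j * (norm (P j (x' - xh)))\<^sup>2))"
    unfolding sum_block_weights .
  have "op_inner A (x' - x) (x' - x) = (\<Sum>j\<in>UNIV. ?a j * (norm (P j (x' - x)))\<^sup>2)"
    unfolding op_inner_def A inner_block_op[OF P] by (simp add: power2_norm_eq_inner)
  then have 4: "op_inner A (x' - x) (x' - x) = (\<Sum>j\<in>S. 1 / \<pi> j * (norm (P j (x' - x)))\<^sup>2)"
    unfolding sum_block_weights .
  have "op_inner A (adjoint (blinfun_apply (D x - D xh)) yh) (x' - xh) \<ge>
      op_inner (A o\<^sub>L block_op P \<gamma>K) (x' - xh) (x' - xh)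
      + \<theta> A * norm (K xh - K x - D x (xh - x)) powr p - L3 / 2 * op_inner A (x' - x) (x' - x)"
    using three_point[unfolded three_point_property_def Let_def, THEN spec[of _ ?a], THEN mp,
        OF allI[OF a], folded A, THEN conjunct2, THEN bspec, OF XK(1), THEN bspec, OF XK(2)] .
  with 2 3 4 have "(\<Sum>j\<in>S. (\<gamma>G j + \<gamma>K j) / \<pi> j * (norm (P j (x' - xh)))\<^sup>2)
        + \<theta> A * norm (K xh - K x - D x (xh - x)) powr p
        - L3 / 2 * (\<Sum>j\<in>S. (norm (P j (x' - x)))\<^sup>2 / \<pi> j)
        + (y - yh) \<bullet> D x (A (x' - xh)) \<le>
      (\<Sum>j\<in>S. 1 / \<pi> j * (v \<bullet> P j (x' - xh) + \<gamma>G j * (norm (P j (x' - xh)))\<^sup>2))"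
    by (simp add: distrib_left sum.distrib add_divide_distrib distrib_right)
  then have "2 * \<eta> * ((\<Sum>j\<in>S. (\<gamma>G j + \<gamma>K j) / \<pi> j * (norm (P j (x' - xh)))\<^sup>2)
        + \<theta> A * norm (K xh - K x - D x (xh - x)) powr p
        - L3 / 2 * (\<Sum>j\<in>S. (norm (P j (x' - x)))\<^sup>2 / \<pi> j)
        + (y - yh) \<bullet> D x (A (x' - xh))) \<le>
      2 * \<eta> * (\<Sum>j\<in>S. 1 / \<pi> j * (v \<bullet> P j (x' - xh) + \<gamma>G j * (norm (P j (x' - xh)))\<^sup>2))"
    using \<eta> by (intro mult_left_mono) auto
  with 1 show ?thesis by linarith
qed

text \<open>The proximal step pairs \<open>K xh - K xb\<close> with the dual error. Subtracting the
  two linear terms of the conclusion leaves three vectors in \<open>Y_nonlin K\<close>: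
  \<open>R\<close>, later paid for by the three-point property; \<open>E\<close>, quadratic in the
  over-relaxed step; and \<open>E3\<close>, linear in the primal step with a factor at most
  \<open>\<rho>x\<close>. The last two make up the constant multiplying \<open>L\<close>.\<close>

lemma dual_estimate:
  fixes K :: "'x::{real_inner,complete_space} \<Rightarrow> 'y::{real_inner,complete_space}"
    and P :: "'m::finite \<Rightarrow> 'x \<Rightarrow>\<^sub>L 'x" and Q :: "'n::finite \<Rightarrow> 'y \<Rightarrow>\<^sub>L 'y"
  assumes K: "C1_with_derivative K D" and P: "orth_decomposition P" and Q: "orth_decomposition Q"
    and PN: "orth_projection P_NL" "range (blinfun_apply P_NL) = Y_nonlin K"
    and F: "\<And>l. convex_fun (F l)" "\<And>l z. F l z \<noteq> -\<infinity>"
    and crit: "K xh \<in> subdiff (separable_sum Q F) yh"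
    and mono: "monotonicity_property (separable_sum Q F) Q \<gamma>F yh YF"
    and L: "0 \<le> L" "lipschitz_property D L XK"
    and p: "1 \<le> p" "p \<le> 2" and \<zeta>: "\<And>l. 0 \<le> \<zeta> l" "\<And>l. 1 < p \<Longrightarrow> 0 < \<zeta> l"
    and \<alpha>: "0 < \<alpha>"
    and \<gamma>Fbar: "\<And>l. 0 \<le> (if Q l o\<^sub>L P_NL = 0 then \<gamma>F l else \<gamma>F l - (p - 1) * \<zeta> l - \<alpha>)"
    and \<pi>: "\<And>j. 0 < \<pi> j" "\<And>j. \<pi> j \<le> 1" and s: "\<And>l. 0 < s l"
    and \<omega>b: "0 < \<omega>b" "\<omega>b \<le> 1" and \<rho>: "0 \<le> \<rho>x" "\<And>l. 0 \<le> \<rho> l"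
    and A: "A = block_op P (\<lambda>j. if j \<in> S then 1 / \<pi> j else 0)"
    and stay: "\<And>j. j \<notin> S \<Longrightarrow> P j x' = P j x"
    and xb: "\<And>j. P j xb = (if j \<in> S then P j x' + (\<omega>b / \<pi> j) *\<^sub>R (P j x' - P j x) else P j x)"
    and prox: "\<And>l. is_prox (Q l) (s l) (F l) (Q l y + s l *\<^sub>R Q l (K xb)) (Q l y')"
    and XK: "closed_segment x xb \<subseteq> XK" "x' \<in> XK" and YF: "y' \<in> YF"
    and bounds: "norm (x' - xh) \<le> \<rho>x" "\<And>l. op_norm P_NL (Q l (y' - yh)) \<le> \<rho> l"
  shows "(\<Sum>l\<in>UNIV. ((norm (Q l (y - yh)))\<^sup>2 - (norm (Q l (y' - yh)))\<^sup>2 - (norm (Q l (y' - y)))\<^sup>2) / s l)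
    \<ge> - 2 * (p powr (- p) * (\<Sum>l\<in>UNIV. rpow (\<zeta> l) (1 - p) * rpow (\<rho> l) (2 - p)))
          * norm (K xh - K x - D x (xh - x)) powr p
      - L * ((MAX j\<in>UNIV. (1 / \<pi> j + 1)\<^sup>2) * (\<Sum>l\<in>UNIV. \<rho> l) + real CARD('n) * L / (2 * \<alpha>) * \<rho>x\<^sup>2)
          * (\<Sum>j\<in>S. (norm (P j (x' - x)))\<^sup>2 / \<pi> j)
      - 2 * ((y' - yh) \<bullet> D x' (x' - xh)) - 2 * \<omega>b * ((y' - yh) \<bullet> D x (A (x' - x)))"
proof -
  define R where "R = K xh - K x - D x (xh - x)"
  define E where "E = K xb - K x - D x (xb - x)"
  define E3 where "E3 = D x' (x' - xh) - D x (x' - xh)"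
  define d where "d = y' - yh"
  define mx where "mx = (MAX j\<in>UNIV. (1 / \<pi> j + 1)\<^sup>2)"
  define dS where "dS = (\<Sum>j\<in>S. (norm (P j (x' - x)))\<^sup>2 / \<pi> j)"
  have Pd: "P j (x' - x) = 0" if "j \<notin> S" for j using stay[OF that] by (simp add: blinfun.diff_right)
  have xb_A: "xb = x' + \<omega>b *\<^sub>R A (x' - x)"
  proof -
    have "P j xb = P j (x' + \<omega>b *\<^sub>R A (x' - x))" for j
      using stay[of j] unfolding blinfun.add_right blinfun.scaleR_right A proj_block_op[OF P] xb
      by (simp add: blinfun.diff_right)
    then have "(\<Sum>j\<in>UNIV. P j xb) = (\<Sum>j\<in>UNIV. P j (x' + \<omega>b *\<^sub>R A (x' - x)))" by simp
    then show ?thesis unfolding orth_decompositionD(4)[OF P] .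
  qed
  have dS_eq: "dS = (\<Sum>j\<in>UNIV. (norm (P j (x' - x)))\<^sup>2 / \<pi> j)"
    unfolding dS_def by (rule sum.mono_neutral_left) (auto simp: Pd)
  have dS: "(norm (x' - x))\<^sup>2 \<le> dS"
    unfolding dS_eq orth_decomposition_norm[OF P, of "x' - x", symmetric]
    using \<pi> by (intro sum_mono) (simp add: le_divide_eq mult_left_le)
  have xb_x: "(norm (xb - x))\<^sup>2 \<le> mx * dS"
  proof -
    have "(norm (P j (xb - x)))\<^sup>2 \<le> mx * (norm (P j (x' - x)))\<^sup>2" for j
    proof (cases "j \<in> S")
      case True
      \<comment> \<open>Over-relaxation multiplies the step in a sampled block by this factor; with
        \<open>\<omega>b \<le> 1\<close> it is the origin of the factor
        \<open>(1 / \<pi> j + 1)\<^sup>2\<close>.\<close>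
      have "P j (xb - x) = (1 + \<omega>b / \<pi> j) *\<^sub>R P j (x' - x)"
        using True by (simp add: blinfun.diff_right xb algebra_simps)
      then have "(norm (P j (xb - x)))\<^sup>2 = (1 + \<omega>b / \<pi> j)\<^sup>2 * (norm (P j (x' - x)))\<^sup>2"
        by (simp add: power_mult_distrib)
      also have "(1 + \<omega>b / \<pi> j)\<^sup>2 \<le> (1 / \<pi> j + 1)\<^sup>2"
        using \<omega>b \<pi>(1)[of j] by (intro power_mono) (auto simp: divide_right_mono)
      also have "(1 / \<pi> j + 1)\<^sup>2 \<le> mx" unfolding mx_def by (intro Max_ge) auto
      finally show ?thesis by (simp add: mult_right_mono)
    qed (simp add: blinfun.diff_right xb stay)
    then have "(\<Sum>j\<in>UNIV. (norm (P j (xb - x)))\<^sup>2) \<le> (\<Sum>j\<in>UNIV. mx * (norm (P j (x' - x)))\<^sup>2)"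
      by (rule sum_mono)
    then have "(norm (xb - x))\<^sup>2 \<le> mx * (norm (x' - x))\<^sup>2"
      unfolding orth_decomposition_norm[OF P] sum_distrib_left[symmetric] .
    also have "\<dots> \<le> mx * dS"
    proof (rule mult_left_mono[OF dS])
      have "(1 / \<pi> undefined + 1)\<^sup>2 \<le> mx" unfolding mx_def by (intro Max_ge) auto
      then show "0 \<le> mx" by (rule order_trans[rotated]) simp
    qed
    finally show ?thesis .
  qed
  have x: "x \<in> XK" using XK(1) by auto
  have "norm E \<le> L / 2 * (norm (xb - x))\<^sup>2"
    unfolding E_def by (rule lipschitz_remainder[OF K L(2) XK(1)])
  also have "\<dots> \<le> L / 2 * (mx * dS)" using L(1) by (intro mult_left_mono xb_x) auto
  finally have E_le: "norm E * (\<Sum>l\<in>UNIV. \<rho> l) \<le> L / 2 * (mx * dS) * (\<Sum>l\<in>UNIV. \<rho> l)"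
    using \<rho> by (intro mult_right_mono sum_nonneg) auto
  have "E3 = (D x' - D x) (x' - xh)" by (simp add: E3_def blinfun.diff_left)
  then have "norm E3 \<le> norm (D x' - D x) * norm (x' - xh)" by (simp add: norm_blinfun)
  also have "\<dots> \<le> L * norm (x' - x) * \<rho>x"
    using L x XK(2) bounds(1) unfolding lipschitz_property_def by (intro mult_mono) auto
  finally have "(norm E3)\<^sup>2 \<le> (L * norm (x' - x) * \<rho>x)\<^sup>2" by (intro power_mono) auto
  also have "\<dots> = L\<^sup>2 * \<rho>x\<^sup>2 * (norm (x' - x))\<^sup>2" by (simp add: power_mult_distrib)
  also have "\<dots> \<le> L\<^sup>2 * \<rho>x\<^sup>2 * dS" by (intro mult_left_mono dS) auto
  finally have E3_le: "real CARD('n) * (norm E3)\<^sup>2 / (4 * \<alpha>) \<le> real CARD('n) * (L\<^sup>2 * \<rho>x\<^sup>2 * dS) / (4 * \<alpha>)"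
    using \<alpha> by (intro divide_right_mono mult_left_mono) auto
  have in_NL: "R \<in> range P_NL" "E \<in> range P_NL" "E3 \<in> range P_NL"
    unfolding PN(2) R_def E_def E3_def
    by (simp_all only: remainder_in_Y_nonlin[OF K] derivative_diff_in_Y_nonlin[OF K])
  have nl: "(\<Sum>l\<in>UNIV. \<gamma>F l * (norm (Q l d))\<^sup>2) + (R - E + E3) \<bullet> d \<ge>
    - (p powr (- p) * (\<Sum>l\<in>UNIV. rpow (\<zeta> l) (1 - p) * rpow (\<rho> l) (2 - p)) * norm R powr p)
    - norm E * (\<Sum>l\<in>UNIV. \<rho> l) - real CARD('n) * (norm E3)\<^sup>2 / (4 * \<alpha>)"
    by (rule dual_nonlinear_bound[OF Q PN(1) in_NL p \<zeta> \<alpha> \<gamma>Fbar]) (use bounds in \<open>auto simp: d_def\<close>)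
  have prox': "is_prox (Q l) (s l) (F l) (Q l y - s l *\<^sub>R Q l (- K xb)) (Q l y')" for l
    using prox[of l] by (simp add: blinfun.minus_right)
  have "(\<Sum>l\<in>UNIV. (- K xb + K xh) \<bullet> Q l d + \<gamma>F l * (norm (Q l d))\<^sup>2) \<le>
      (\<Sum>l\<in>UNIV. (Q l (y - y') \<bullet> Q l d) / s l)"
    unfolding d_def
    by (rule prox_monotone[OF Q F mono crit s prox']) (simp add: orth_decompositionD(4)[OF Q] YF)
  moreover have "(\<Sum>l\<in>UNIV. (- K xb + K xh) \<bullet> Q l d) = (K xh - K xb) \<bullet> d"
    unfolding inner_sum_right[symmetric] orth_decompositionD(4)[OF Q] by simp
  moreover have "K xh - K xb = R - E + E3 - D x' (x' - xh) - \<omega>b *\<^sub>R D x (A (x' - x))"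
  proof -
    have "D x (xb - x) = D x (x' - x) + \<omega>b *\<^sub>R D x (A (x' - x))"
      unfolding xb_A by (simp add: blinfun.diff_right blinfun.add_right blinfun.scaleR_right)
    then show ?thesis unfolding R_def E_def E3_def by (simp add: blinfun.diff_right)
  qed
  ultimately have pm: "(R - E + E3) \<bullet> d - d \<bullet> D x' (x' - xh) - \<omega>b * (d \<bullet> D x (A (x' - x)))
      + (\<Sum>l\<in>UNIV. \<gamma>F l * (norm (Q l d))\<^sup>2) \<le> (\<Sum>l\<in>UNIV. (Q l (y - y') \<bullet> Q l d) / s l)"
    by (simp add: sum.distrib inner_simps inner_commute)
  have "2 * (\<Sum>l\<in>UNIV. (Q l (y - y') \<bullet> Q l d) / s l) =
      (\<Sum>l\<in>UNIV. (2 * ((Q l y - Q l y') \<bullet> (Q l y' - Q l yh))) / s l)"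
    by (simp add: sum_distrib_left d_def blinfun.diff_right)
  also have "\<dots> = (\<Sum>l\<in>UNIV. ((norm (Q l (y - yh)))\<^sup>2 - (norm (Q l (y' - yh)))\<^sup>2 - (norm (Q l (y' - y)))\<^sup>2) / s l)"
    unfolding inner_three_points by (simp add: blinfun.diff_right)
  finally have tel: "2 * (\<Sum>l\<in>UNIV. (Q l (y - y') \<bullet> Q l d) / s l) = \<dots>" .
  have const: "L * (mx * (\<Sum>l\<in>UNIV. \<rho> l) + real CARD('n) * L / (2 * \<alpha>) * \<rho>x\<^sup>2) * dS =
      2 * (L / 2 * (mx * dS) * (\<Sum>l\<in>UNIV. \<rho> l)) + 2 * (real CARD('n) * (L\<^sup>2 * \<rho>x\<^sup>2 * dS) / (4 * \<alpha>))"
    using \<alpha> by (simp add: power2_eq_square field_simps)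
  show ?thesis
    unfolding tel[symmetric] unfolding R_def[symmetric] d_def[symmetric] mx_def[symmetric] dS_def[symmetric] const
    using nl pm E_le E3_le by linarith
qed

text \<open>The primal estimate is added to \<open>\<eta> / \<omega>b\<close> times the dual one.
  The product of the increments is absorbed by the dual increments and a share
  \<open>1 - \<kappa>\<close> of the primal ones; the share \<open>\<kappa>\<close> left over pays
  for \<open>Lbar\<close> and for \<open>sampling_trade_off\<close>. On the right, the sum with the
  factor \<open>1 - (if j \<in> S then 1 / \<pi> j else 0)\<close> has mean zero over the sample and
  accounts for raising the weights of unsampled blocks.\<close>

lemma one_step:
  fixes K :: "'x::{real_inner,complete_space} \<Rightarrow> 'y::{real_inner,complete_space}"
    and P :: "'m::finite \<Rightarrow> 'x \<Rightarrow>\<^sub>L 'x" and Q :: "'n::finite \<Rightarrow> 'y \<Rightarrow>\<^sub>L 'y"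
  assumes K: "C1_with_derivative K D" and P: "orth_decomposition P" and Q: "orth_decomposition Q"
    and PN: "orth_projection P_NL" "range (blinfun_apply P_NL) = Y_nonlin K"
    and G: "\<And>j. convex_fun (G j)" "\<And>j z. G j z \<noteq> -\<infinity>"
    and F: "\<And>l. convex_fun (F l)" "\<And>l z. F l z \<noteq> -\<infinity>"
    and crit_x: "- adjoint (blinfun_apply (D xh)) yh \<in> subdiff (separable_sum P G) xh"
    and crit_y: "K xh \<in> subdiff (separable_sum Q F) yh"
    and mono_G: "monotonicity_property (separable_sum P G) P \<gamma>G xh XG"
    and mono_F: "monotonicity_property (separable_sum Q F) Q \<gamma>F yh YF"
    and three_point: "three_point_property K D P \<gamma>K L3 p \<theta> xh yh XK"
    and L: "0 \<le> L" "lipschitz_property D L XK"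
    and p: "1 \<le> p" "p \<le> 2" and \<zeta>: "\<And>l. 0 \<le> \<zeta> l" "\<And>l. 1 < p \<Longrightarrow> 0 < \<zeta> l"
    and \<alpha>: "0 < \<alpha>"
    and \<gamma>Fbar: "\<And>l. 0 \<le> (if Q l o\<^sub>L P_NL = 0 then \<gamma>F l else \<gamma>F l - (p - 1) * \<zeta> l - \<alpha>)"
    and \<gamma>t: "\<And>j. 0 < \<gamma>t j" "\<And>j. \<gamma>t j < \<pi> j * (\<gamma>G j + \<gamma>K j)"
    and w: "\<And>j l k. 0 < w j l k" "\<And>j l k. w j l k = 1 / w j k l"
    and \<pi>: "\<And>j. 0 < \<pi> j" "\<And>j. \<pi> j \<le> 1" and t: "\<And>j. 0 < t j" "\<And>j. t j \<le> t0 j"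
    and s0: "\<And>l. 0 < s0 l" and st: "\<And>l j. \<eta> * s0 l * t j \<le> s0 l * t0 j"
    and \<omega>b: "0 < \<omega>b0" "\<omega>b0 \<le> \<omega>b" "\<omega>b \<le> 1" and \<eta>: "0 < \<eta>"
    and \<rho>: "0 \<le> \<rho>x" "\<And>l. 0 \<le> \<rho> l"
    and dk: "0 < \<delta>" "\<delta> \<le> \<kappa>" "\<kappa> < 1"
    and kappa: "\<And>l. (norm (\<Sum>j\<in>S. sqrt (block_weight P Q w (D x) S j l * s0 l * t0 j / \<pi> j)
               *\<^sub>R (Q l o\<^sub>L D x o\<^sub>L P j)))\<^sup>2 \<le> 1 - \<kappa>"
    and Lbar: "Lbar = L3 + L / \<omega>b0 * ((MAX j\<in>UNIV. (1 / \<pi> j + 1)\<^sup>2) * (\<Sum>l\<in>UNIV. \<rho> l)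
           + real CARD('n) * L / (2 * \<alpha>) * \<rho>x\<^sup>2)"
    and delta: "\<And>j. \<delta> \<ge> t0 j * (Lbar + 2 * (1 - \<pi> j) * (\<gamma>G j + \<gamma>K j) *
          ((\<gamma>G j + \<gamma>K j - \<gamma>t j) / (\<pi> j * (\<gamma>G j + \<gamma>K j) - \<gamma>t j)))"
    and A: "A = block_op P (\<lambda>j. if j \<in> S then 1 / \<pi> j else 0)"
    and step: "pd_step G F K D P Q \<pi> t (\<lambda>l. \<eta> / \<omega>b * s0 l) \<omega>b S x y xb x' y'"
    and XK: "closed_segment x xb \<subseteq> XK" "x' \<in> XK" and XG: "\<And>j. j \<in> S \<Longrightarrow> xh + P j (x' - xh) \<in> XG"
    and YF: "y' \<in> YF"
    and bounds: "norm (x' - xh) \<le> \<rho>x" "\<And>l. op_norm P_NL (Q l (y' - yh)) \<le> \<rho> l"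
  shows "(\<Sum>j\<in>UNIV. (\<eta> / t j + 2 * \<eta> * \<gamma>t j) / \<pi> j * (norm (P j (x' - xh)))\<^sup>2)
      + (\<Sum>l\<in>UNIV. (norm (Q l (y' - yh)))\<^sup>2 / s0 l) - 2 * (\<eta> / \<omega>b) * ((y' - yh) \<bullet> D x' (x' - xh)) \<le>
    (\<Sum>j\<in>UNIV. \<eta> / t j / \<pi> j * (norm (P j (x - xh)))\<^sup>2)
      + (\<Sum>l\<in>UNIV. (norm (Q l (y - yh)))\<^sup>2 / s0 l)
      + (\<Sum>j\<in>UNIV. 2 * \<eta> * \<gamma>t j / \<pi> j * (norm (P j (x - xh)))\<^sup>2 * (1 - (if j \<in> S then 1 / \<pi> j else 0)))
      - 2 * \<eta> * ((y - yh) \<bullet> D x (A (x - xh)))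
      - 2 * \<eta> * (\<theta> A - p powr (- p) * (\<Sum>l\<in>UNIV. rpow (\<zeta> l) (1 - p) * rpow (\<rho> l) (2 - p)) / \<omega>b0)
          * norm (K xh - K x - D x (xh - x)) powr p"
proof -
  define R where "R = norm (K xh - K x - D x (xh - x)) powr p"
  define c\<theta> where "c\<theta> = p powr (- p) * (\<Sum>l\<in>UNIV. rpow (\<zeta> l) (1 - p) * rpow (\<rho> l) (2 - p))"
  define Lc where "Lc = L * ((MAX j\<in>UNIV. (1 / \<pi> j + 1)\<^sup>2) * (\<Sum>l\<in>UNIV. \<rho> l)
           + real CARD('n) * L / (2 * \<alpha>) * \<rho>x\<^sup>2)"
  define e where "e j = (norm (P j (x - xh)))\<^sup>2" for j
  define f where "f j = (norm (P j (x' - xh)))\<^sup>2" for j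
  define d where "d j = (norm (P j (x' - x)))\<^sup>2" for j
  define dS where "dS = (\<Sum>j\<in>S. d j / \<pi> j)"
  define \<gamma> where "\<gamma> j = \<gamma>G j + \<gamma>K j" for j
  have \<omega>b_pos: "0 < \<omega>b" using \<omega>b by simp
  have R0: "0 \<le> R" by (simp add: R_def)
  have c\<theta>0: "0 \<le> c\<theta>" by (auto simp: c\<theta>_def rpow_def intro!: mult_nonneg_nonneg sum_nonneg)
  have dS0: "0 \<le> dS" using \<pi> by (auto simp: dS_def d_def less_imp_le intro!: sum_nonneg)
  have Lc0: "0 \<le> Lc"
  proof -
    have "(1 / \<pi> undefined + 1)\<^sup>2 \<le> (MAX j\<in>UNIV. (1 / \<pi> j + 1)\<^sup>2)" by (intro Max_ge) auto
    then have "0 \<le> (MAX j\<in>UNIV. (1 / \<pi> j + 1)\<^sup>2)" by (rule order_trans[rotated]) simp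
    then show ?thesis using L \<rho> \<alpha> by (auto simp: Lc_def intro!: mult_nonneg_nonneg add_nonneg_nonneg sum_nonneg)
  qed
  have primal_step: "j \<in> S \<Longrightarrow> is_prox (P j) (t j) (G j) (P j x - t j *\<^sub>R P j (adjoint (blinfun_apply (D x)) y)) (P j x')"
    and stay: "j \<notin> S \<Longrightarrow> P j x' = P j x"
    and xb: "P j xb = (if j \<in> S then P j x' + (\<omega>b / \<pi> j) *\<^sub>R (P j x' - P j x) else P j x)" for j
    using step unfolding pd_step_def by (auto split: if_splits)
  have dual_step: "is_prox (Q l) (\<eta> / \<omega>b * s0 l) (F l) (Q l y + (\<eta> / \<omega>b * s0 l) *\<^sub>R Q l (K xb)) (Q l y')" for l
    using step unfolding pd_step_def by blast
  have x: "x \<in> XK" using XK(1) by auto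

  have primal: "(\<Sum>j\<in>S. \<eta> / (\<pi> j * t j) * (e j - f j - d j)) \<ge>
      2 * \<eta> * ((\<Sum>j\<in>S. \<gamma> j / \<pi> j * f j) + \<theta> A * R - L3 / 2 * dS + (y - yh) \<bullet> D x (A (x' - xh)))"
    unfolding e_def f_def d_def dS_def R_def \<gamma>_def
    by (rule primal_estimate[OF P G crit_x mono_G three_point \<pi>(1) t(1) \<eta> primal_step x XK(2) XG A])
  have "- 2 * c\<theta> * R - Lc * dS - 2 * ((y' - yh) \<bullet> D x' (x' - xh)) - 2 * \<omega>b * ((y' - yh) \<bullet> D x (A (x' - x)))
     \<le> (\<Sum>l\<in>UNIV. ((norm (Q l (y - yh)))\<^sup>2 - (norm (Q l (y' - yh)))\<^sup>2 - (norm (Q l (y' - y)))\<^sup>2) / (\<eta> / \<omega>b * s0 l))"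
    unfolding d_def dS_def R_def c\<theta>_def Lc_def
    by (rule dual_estimate[OF K P Q PN F crit_y mono_F L p \<zeta> \<alpha> \<gamma>Fbar \<pi> _ \<omega>b_pos \<omega>b(3) \<rho> A stay xb dual_step XK YF bounds])
       (use \<eta> \<omega>b_pos s0 in auto)
  then have "\<eta> / \<omega>b * (- 2 * c\<theta> * R - Lc * dS - 2 * ((y' - yh) \<bullet> D x' (x' - xh)) - 2 * \<omega>b * ((y' - yh) \<bullet> D x (A (x' - x))))
     \<le> \<eta> / \<omega>b * (\<Sum>l\<in>UNIV. ((norm (Q l (y - yh)))\<^sup>2 - (norm (Q l (y' - yh)))\<^sup>2 - (norm (Q l (y' - y)))\<^sup>2) / (\<eta> / \<omega>b * s0 l))"
    using \<eta> \<omega>b_pos by (intro mult_left_mono) auto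
  moreover have "\<eta> / \<omega>b * (\<Sum>l\<in>UNIV. ((norm (Q l (y - yh)))\<^sup>2 - (norm (Q l (y' - yh)))\<^sup>2 - (norm (Q l (y' - y)))\<^sup>2) / (\<eta> / \<omega>b * s0 l))
      = (\<Sum>l\<in>UNIV. (norm (Q l (y - yh)))\<^sup>2 / s0 l) - (\<Sum>l\<in>UNIV. (norm (Q l (y' - yh)))\<^sup>2 / s0 l)
        - (\<Sum>l\<in>UNIV. (norm (Q l (y' - y)))\<^sup>2 / s0 l)"
    using \<eta> \<omega>b_pos by (simp add: sum_distrib_left diff_divide_distrib sum_subtractf)
  moreover have "\<eta> / \<omega>b * (- 2 * c\<theta> * R - Lc * dS - 2 * ((y' - yh) \<bullet> D x' (x' - xh)) - 2 * \<omega>b * ((y' - yh) \<bullet> D x (A (x' - x))))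
      = - (\<eta> / \<omega>b * (2 * c\<theta> * R + Lc * dS)) - 2 * (\<eta> / \<omega>b) * ((y' - yh) \<bullet> D x' (x' - xh)) - 2 * \<eta> * ((y' - yh) \<bullet> D x (A (x' - x)))"
    using \<omega>b_pos by (simp add: field_simps)
  \<comment> \<open>The error is nonnegative, so it may be enlarged to the fixed factor
    \<open>1 / \<omega>b0\<close> that appears in \<open>Lbar\<close> and in the term with
    \<open>\<theta> A\<close>.\<close>
  moreover have "\<eta> / \<omega>b * (2 * c\<theta> * R + Lc * dS) \<le> \<eta> / \<omega>b0 * (2 * c\<theta> * R + Lc * dS)"
    using \<eta> \<omega>b \<omega>b_pos R0 c\<theta>0 dS0 Lc0 by (intro mult_right_mono divide_left_mono add_nonneg_nonneg) auto
  moreover have "\<eta> / \<omega>b0 * (2 * c\<theta> * R + Lc * dS) = 2 * \<eta> * (c\<theta> / \<omega>b0) * R + \<eta> * (Lbar - L3) * dS"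
  proof -
    have "Lbar - L3 = Lc / \<omega>b0" by (simp add: Lbar Lc_def)
    then show ?thesis by (simp add: distrib_left mult.assoc)
  qed
  ultimately have dual: "- (2 * \<eta> * (c\<theta> / \<omega>b0) * R) - \<eta> * (Lbar - L3) * dS
      - 2 * (\<eta> / \<omega>b) * ((y' - yh) \<bullet> D x' (x' - xh)) - 2 * \<eta> * ((y' - yh) \<bullet> D x (A (x' - x)))
      \<le> (\<Sum>l\<in>UNIV. (norm (Q l (y - yh)))\<^sup>2 / s0 l) - (\<Sum>l\<in>UNIV. (norm (Q l (y' - yh)))\<^sup>2 / s0 l)
        - (\<Sum>l\<in>UNIV. (norm (Q l (y' - y)))\<^sup>2 / s0 l)"
    by linarith

  have Az: "A z = (\<Sum>j\<in>S. (1 / \<pi> j) *\<^sub>R P j z)" for z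
    unfolding A block_op_apply by (rule sum.mono_neutral_cong_right) auto
  have "2 * (D x (\<Sum>j\<in>S. (1 / \<pi> j) *\<^sub>R P j (x' - x)) \<bullet> (y' - y)) \<le>
      (1 - \<kappa>) * (\<Sum>j\<in>S. (norm (P j (x' - x)))\<^sup>2 / (\<pi> j * t j)) + (\<Sum>l\<in>UNIV. (norm (Q l (y' - y)))\<^sup>2 / (\<eta> * s0 l))"
    by (rule coupling_estimate[OF P Q w \<pi>(1) t(1) _ _ st kappa]) (use \<eta> s0 dk in auto)
  then have "\<eta> * (2 * ((y' - y) \<bullet> D x (A (x' - x)))) \<le>
      \<eta> * ((1 - \<kappa>) * (\<Sum>j\<in>S. d j / (\<pi> j * t j)) + (\<Sum>l\<in>UNIV. (norm (Q l (y' - y)))\<^sup>2 / (\<eta> * s0 l)))"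
    using \<eta> by (simp only: Az d_def inner_commute mult_left_mono less_imp_le)
  then have coupling: "2 * \<eta> * ((y' - y) \<bullet> D x (A (x' - x))) \<le>
      (1 - \<kappa>) * (\<Sum>j\<in>S. \<eta> * d j / (\<pi> j * t j)) + (\<Sum>l\<in>UNIV. (norm (Q l (y' - y)))\<^sup>2 / s0 l)"
    using \<eta> by (simp add: distrib_left sum_distrib_left mult.assoc mult.left_commute)

  \<comment> \<open>The second term on the right cancels the extrapolation term of the dual
    estimate.\<close>
  have split: "(y - yh) \<bullet> D x (A (x' - xh)) =
      (y - yh) \<bullet> D x (A (x - xh)) + (y' - yh) \<bullet> D x (A (x' - x)) - (y' - y) \<bullet> D x (A (x' - x))"
    by (simp add: blinfun.diff_right inner_diff_left inner_diff_right)

  have block: "\<eta> / \<pi> j * (2 * \<gamma>t j * f j + 2 * (1 - \<pi> j) * (\<gamma>t j / \<pi> j) * e j)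
      \<le> 2 * \<eta> * (\<gamma> j / \<pi> j * f j) - \<eta> * Lbar * (d j / \<pi> j) + \<kappa> * (\<eta> * d j / (\<pi> j * t j))" for j
  proof -
    define X where "X = Lbar + 2 * (1 - \<pi> j) * \<gamma> j * ((\<gamma> j - \<gamma>t j) / (\<pi> j * \<gamma> j - \<gamma>t j))"
    have "t j * X \<le> \<kappa>"
    proof (cases "0 \<le> X")
      case True
      then have "t j * X \<le> t0 j * X" using t by (intro mult_right_mono) auto
      then show ?thesis using delta[of j] dk unfolding X_def \<gamma>_def by linarith
    next
      case False
      then have "t j * X \<le> 0" using t(1)[of j] by (simp add: mult_nonneg_nonpos less_imp_le)
      then show ?thesis using dk by linarith
    qed
    then have "X \<le> \<kappa> / t j" using t(1)[of j] by (simp add: le_divide_eq mult.commute)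
    then have "X * d j \<le> \<kappa> / t j * d j" by (intro mult_right_mono) (auto simp: d_def)
    moreover have "2 * \<gamma>t j * f j + 2 * (1 - \<pi> j) * (\<gamma>t j / \<pi> j) * e j \<le>
        2 * \<gamma> j * f j + 2 * (1 - \<pi> j) * \<gamma> j * ((\<gamma> j - \<gamma>t j) / (\<pi> j * \<gamma> j - \<gamma>t j)) * d j"
      using sampling_trade_off[OF \<pi> \<gamma>t, of j "P j (x' - xh)" "P j (x - xh)"]
      unfolding f_def e_def d_def \<gamma>_def by (simp add: blinfun.diff_right)
    ultimately have "2 * \<gamma>t j * f j + 2 * (1 - \<pi> j) * (\<gamma>t j / \<pi> j) * e j \<le>
        2 * \<gamma> j * f j - Lbar * d j + \<kappa> / t j * d j"
      unfolding X_def by (simp add: algebra_simps)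
    then have "\<eta> / \<pi> j * (2 * \<gamma>t j * f j + 2 * (1 - \<pi> j) * (\<gamma>t j / \<pi> j) * e j) \<le>
        \<eta> / \<pi> j * (2 * \<gamma> j * f j - Lbar * d j + \<kappa> / t j * d j)"
      using \<eta> \<pi>(1)[of j] by (intro mult_left_mono) auto
    also have "\<dots> = 2 * \<eta> * (\<gamma> j / \<pi> j * f j) - \<eta> * Lbar * (d j / \<pi> j) + \<kappa> * (\<eta> * d j / (\<pi> j * t j))"
      by (simp add: distrib_left right_diff_distrib mult.assoc mult.left_commute)
    finally show ?thesis .
  qed
  have "(\<Sum>j\<in>S. \<eta> / \<pi> j * (2 * \<gamma>t j * f j + 2 * (1 - \<pi> j) * (\<gamma>t j / \<pi> j) * e j)) \<le>
      (\<Sum>j\<in>S. 2 * \<eta> * (\<gamma> j / \<pi> j * f j) - \<eta> * Lbar * (d j / \<pi> j) + \<kappa> * (\<eta> * d j / (\<pi> j * t j)))"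
    by (intro sum_mono block)
  also have "\<dots> = 2 * \<eta> * (\<Sum>j\<in>S. \<gamma> j / \<pi> j * f j) - \<eta> * Lbar * dS + \<kappa> * (\<Sum>j\<in>S. \<eta> * d j / (\<pi> j * t j))"
    by (simp only: sum.distrib sum_subtractf sum_distrib_left dS_def)
  finally have blocks: "(\<Sum>j\<in>S. \<eta> / \<pi> j * (2 * \<gamma>t j * f j + 2 * (1 - \<pi> j) * (\<gamma>t j / \<pi> j) * e j)) \<le> \<dots>" .

  have primal_split: "(\<Sum>j\<in>S. \<eta> / (\<pi> j * t j) * (e j - f j - d j)) =
      (\<Sum>j\<in>S. \<eta> / (\<pi> j * t j) * (e j - f j)) - (\<Sum>j\<in>S. \<eta> * d j / (\<pi> j * t j))"
    unfolding sum_subtractf[symmetric] by (intro sum.cong) (auto simp: right_diff_distrib)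
  \<comment> \<open>In an unsampled block old and new error coincide, and the mean-zero term cancels
    the growth of the weight. In a sampled block the same term leaves
    \<open>(1 - \<pi> j) * (\<gamma>t j / \<pi> j)\<close> times the old error.\<close>
  have "(\<Sum>j\<in>UNIV. (\<eta> / t j + 2 * \<eta> * \<gamma>t j) / \<pi> j * f j - \<eta> / t j / \<pi> j * e j
        - 2 * \<eta> * \<gamma>t j / \<pi> j * e j * (1 - (if j \<in> S then 1 / \<pi> j else 0)))
    = (\<Sum>j\<in>S. \<eta> / \<pi> j * (2 * \<gamma>t j * f j + 2 * (1 - \<pi> j) * (\<gamma>t j / \<pi> j) * e j) - \<eta> / (\<pi> j * t j) * (e j - f j))"
  proof (rule sum.mono_neutral_cong_right)
    fix j :: 'm
    have pos: "0 < \<pi> j" "0 < t j" using \<pi> t by auto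
    show "(\<eta> / t j + 2 * \<eta> * \<gamma>t j) / \<pi> j * f j - \<eta> / t j / \<pi> j * e j
        - 2 * \<eta> * \<gamma>t j / \<pi> j * e j * (1 - (if j \<in> S then 1 / \<pi> j else 0)) =
        \<eta> / \<pi> j * (2 * \<gamma>t j * f j + 2 * (1 - \<pi> j) * (\<gamma>t j / \<pi> j) * e j) - \<eta> / (\<pi> j * t j) * (e j - f j)"
      if "j \<in> S"
      using that pos by (simp add: field_simps)
  next
    have "(\<eta> / t j + 2 * \<eta> * \<gamma>t j) / \<pi> j * f j - \<eta> / t j / \<pi> j * e j - 2 * \<eta> * \<gamma>t j / \<pi> j * e j = 0"
      if "j \<notin> S" for j
    proof -
      have "f j = e j" using stay[OF that] by (simp add: f_def e_def blinfun.diff_right)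
      then show ?thesis by (simp add: add_divide_distrib distrib_right)
    qed
    then show "\<forall>i\<in>UNIV - S. (\<eta> / t i + 2 * \<eta> * \<gamma>t i) / \<pi> i * f i - \<eta> / t i / \<pi> i * e i
        - 2 * \<eta> * \<gamma>t i / \<pi> i * e i * (1 - (if i \<in> S then 1 / \<pi> i else 0)) = 0"
      by simp
  qed auto
  then have collect: "(\<Sum>j\<in>UNIV. (\<eta> / t j + 2 * \<eta> * \<gamma>t j) / \<pi> j * f j) - (\<Sum>j\<in>UNIV. \<eta> / t j / \<pi> j * e j)
        - (\<Sum>j\<in>UNIV. 2 * \<eta> * \<gamma>t j / \<pi> j * e j * (1 - (if j \<in> S then 1 / \<pi> j else 0)))
    = (\<Sum>j\<in>S. \<eta> / \<pi> j * (2 * \<gamma>t j * f j + 2 * (1 - \<pi> j) * (\<gamma>t j / \<pi> j) * e j))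
      - (\<Sum>j\<in>S. \<eta> / (\<pi> j * t j) * (e j - f j))"
    by (simp only: sum_subtractf)
  define E where "E = (\<Sum>j\<in>S. \<eta> * d j / (\<pi> j * t j))"
  define b where "b = (y - yh) \<bullet> D x (A (x - xh))"
  have primal': "2 * \<eta> * (\<Sum>j\<in>S. \<gamma> j / \<pi> j * f j) + 2 * \<eta> * \<theta> A * R - \<eta> * L3 * dS
      + 2 * \<eta> * b + 2 * \<eta> * ((y' - yh) \<bullet> D x (A (x' - x))) - 2 * \<eta> * ((y' - y) \<bullet> D x (A (x' - x)))
      \<le> (\<Sum>j\<in>S. \<eta> / (\<pi> j * t j) * (e j - f j)) - E"
    using primal unfolding primal_split split b_def[symmetric] E_def by (simp add: algebra_simps)
  have goal: "(\<Sum>j\<in>UNIV. (\<eta> / t j + 2 * \<eta> * \<gamma>t j) / \<pi> j * f j)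
      + (\<Sum>l\<in>UNIV. (norm (Q l (y' - yh)))\<^sup>2 / s0 l) - 2 * (\<eta> / \<omega>b) * ((y' - yh) \<bullet> D x' (x' - xh)) \<le>
    (\<Sum>j\<in>UNIV. \<eta> / t j / \<pi> j * e j)
      + (\<Sum>l\<in>UNIV. (norm (Q l (y - yh)))\<^sup>2 / s0 l)
      + (\<Sum>j\<in>UNIV. 2 * \<eta> * \<gamma>t j / \<pi> j * e j * (1 - (if j \<in> S then 1 / \<pi> j else 0)))
      - 2 * \<eta> * b - (2 * \<eta> * \<theta> A * R - 2 * \<eta> * (c\<theta> / \<omega>b0) * R)"
    using primal' dual coupling[folded E_def] blocks[folded E_def] collect
    by (simp add: left_diff_distrib right_diff_distrib)
  show ?thesis
    using goal unfolding e_def f_def b_def R_def c\<theta>_def by (simp add: algebra_simps)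
qed


text \<open>The iteration is given as a relation; its being a function of the current iterate and
  the sample makes the iterates functions of the history. The primal blocks fix the over-relaxed
  point, which has to be known before the dual proximal points can be compared.\<close>

lemma pd_step_unique:
  assumes P: "orth_decomposition P" and Q: "orth_decomposition Q"
    and G: "\<And>j. convex_fun (G j)" "\<And>j z. G j z \<noteq> -\<infinity>" "\<And>j. G j (P j xh) \<noteq> \<infinity>"
    and F: "\<And>l. convex_fun (F l)" "\<And>l z. F l z \<noteq> -\<infinity>" "\<And>l. F l (Q l yh) \<noteq> \<infinity>"
    and t: "\<And>j. 0 < t j" and s: "\<And>l. 0 < s l"
    and 1: "pd_step G F K D P Q \<pi> t s \<omega>b S x y xb1 x1 y1"
    and 2: "pd_step G F K D P Q \<pi> t s \<omega>b S x y xb2 x2 y2"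
  shows "x1 = x2 \<and> y1 = y2"
proof -
  have eqI: "u = v" if "orth_decomposition R" "\<And>j. R j u = R j v" for R :: "'k::finite \<Rightarrow> 'z::real_inner \<Rightarrow>\<^sub>L 'z" and u v
  proof -
    have "(\<Sum>j\<in>UNIV. R j u) = (\<Sum>j\<in>UNIV. R j v)" by (simp only: that(2))
    then show ?thesis unfolding orth_decompositionD(4)[OF that(1)] .
  qed
  have prim: "if j \<in> S
      then is_prox (P j) (t j) (G j) (P j x - t j *\<^sub>R P j (adjoint (blinfun_apply (D x)) y)) (P j x')
        \<and> P j xb = P j x' + (\<omega>b / \<pi> j) *\<^sub>R (P j x' - P j x)
      else P j x' = P j x \<and> P j xb = P j x"
    and dual: "is_prox (Q l) (s l) (F l) (Q l y + s l *\<^sub>R Q l (K xb)) (Q l y')"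
    if "pd_step G F K D P Q \<pi> t s \<omega>b S x y xb x' y'" for j l xb x' y'
    by (rule that[unfolded pd_step_def, THEN conjunct1, THEN spec],
        rule that[unfolded pd_step_def, THEN conjunct2, THEN spec])
  have Px: "P j x1 = P j x2" for j
  proof (cases "j \<in> S")
    case True
    have "is_prox (P j) (t j) (G j) (P j x - t j *\<^sub>R P j (adjoint (blinfun_apply (D x)) y)) (P j x1)"
      "is_prox (P j) (t j) (G j) (P j x - t j *\<^sub>R P j (adjoint (blinfun_apply (D x)) y)) (P j x2)"
      using prim[OF 1, of j] prim[OF 2, of j] True by simp_all
    then show ?thesis by (rule is_prox_unique[OF G(1,2) t G(3)])
  next
    case False
    then show ?thesis using prim[OF 1, of j] prim[OF 2, of j] by simp
  qed
  have "P j xb1 = P j xb2" for j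
    using prim[OF 1, of j] prim[OF 2, of j] Px[of j] by (simp split: if_splits)
  then have xb: "xb1 = xb2" by (rule eqI[OF P])
  have "Q l y1 = Q l y2" for l
    by (rule is_prox_unique[OF F(1,2) s F(3) dual[OF 1, of l] dual[OF 2, of l, folded xb]])
  then show ?thesis using eqI[OF P Px] eqI[OF Q] by blast
qed


section \<open>Functions of finitely many samples\<close>

text \<open>\<open>Fil i\<close> is the information available before \<open>S i\<close> is drawn,
  and \<open>Fil (Suc i)\<close> that after it.\<close>

locale finitely_sampled = prob_space M for M :: "'w measure" +
  fixes Fil :: "nat \<Rightarrow> 'w measure" and S :: "nat \<Rightarrow> 'w \<Rightarrow> 's::finite"
  assumes Fil_sub: "\<And>i. subalgebra M (Fil i)"
    and Fil_mono: "\<And>i. sets (Fil i) \<subseteq> sets (Fil (Suc i))"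
    and S_meas: "\<And>i. S i \<in> measurable (Fil (Suc i)) (count_space UNIV)"
begin

text \<open>Invariance under equal histories puts no structure on the value type, so that pairs of
  vectors, predicates and real functions are treated alike.\<close>

definition determined :: "nat \<Rightarrow> ('w \<Rightarrow> 'b) \<Rightarrow> bool" where
  "determined i g \<longleftrightarrow>
    (\<forall>\<omega>\<in>space M. \<forall>\<omega>'\<in>space M. (\<forall>k<i. S k \<omega> = S k \<omega>') \<longrightarrow> g \<omega> = g \<omega>')"

lemma determinedI:
  assumes "\<And>\<omega> \<omega>'. \<omega> \<in> space M \<Longrightarrow> \<omega>' \<in> space M \<Longrightarrow> (\<And>k. k < i \<Longrightarrow> S k \<omega> = S k \<omega>') \<Longrightarrow> g \<omega> = g \<omega>'"
  shows "determined i g"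
  using assms unfolding determined_def by blast

lemma determinedD:
  assumes "determined i g" "\<omega> \<in> space M" "\<omega>' \<in> space M" "\<And>k. k < i \<Longrightarrow> S k \<omega> = S k \<omega>'"
  shows "g \<omega> = g \<omega>'"
  using assms unfolding determined_def by blast

lemma determined_factor:
  assumes "determined i g"
  shows "\<exists>g'. \<forall>\<omega>\<in>space M. g \<omega> = g' (map (\<lambda>k. S k \<omega>) [0..<i])"
proof -
  define h where "h \<omega> = map (\<lambda>k. S k \<omega>) [0..<i]" for \<omega>
  define g' where "g' l = g (SOME \<omega>. \<omega> \<in> space M \<and> h \<omega> = l)" for l
  have "g \<omega> = g' (h \<omega>)" if "\<omega> \<in> space M" for \<omega>
  proof -
    define \<omega>' where "\<omega>' = (SOME \<omega>'. \<omega>' \<in> space M \<and> h \<omega>' = h \<omega>)"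
    have \<omega>': "\<omega>' \<in> space M \<and> h \<omega>' = h \<omega>"
      unfolding \<omega>'_def by (rule someI[of _ \<omega>]) (use that in simp)
    then have "\<forall>k<i. S k \<omega>' = S k \<omega>" by (simp add: h_def)
    then have "g \<omega>' = g \<omega>" using assms that \<omega>' unfolding determined_def by blast
    then show ?thesis unfolding g'_def \<omega>'_def[symmetric] by simp
  qed
  then show ?thesis unfolding h_def by blast
qed

lemma Fil_mono_le: "i \<le> j \<Longrightarrow> sets (Fil i) \<subseteq> sets (Fil j)"
  by (rule lift_Suc_mono_le[of "\<lambda>i. sets (Fil i)"]) (rule Fil_mono)

lemma space_Fil: "space (Fil i) = space M"
  using Fil_sub[of i] by (simp add: subalgebra_def)

text \<open>The history is a measurable map into a countable discrete space, on which every real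
  function is measurable.\<close>

lemma determined_measurable:
  fixes g :: "'w \<Rightarrow> real"
  assumes g: "determined i g"
  shows "g \<in> borel_measurable (Fil i)"
proof -
  define h where "h \<omega> = map (\<lambda>k. S k \<omega>) [0..<i]" for \<omega>
  obtain g' where g': "\<And>\<omega>. \<omega> \<in> space M \<Longrightarrow> g \<omega> = g' (h \<omega>)"
    using determined_factor[OF g] unfolding h_def by blast
  have "h \<in> measurable (Fil i) (count_space UNIV)"
    unfolding measurable_count_space_eq2_countable
  proof (intro conjI ballI)
    fix l :: "'s list"
    have "{\<omega> \<in> space (Fil i). \<forall>k\<in>{..<i}. S k \<omega> = l ! k} \<in> sets (Fil i)"
    proof (rule sets.sets_Collect_finite_All)
      fix k assume "k \<in> {..<i}"
      then have "sets (Fil (Suc k)) \<subseteq> sets (Fil i)" by (intro Fil_mono_le) auto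
      moreover have "S k -` {l ! k} \<inter> space (Fil (Suc k)) \<in> sets (Fil (Suc k))"
        by (rule measurable_sets[OF S_meas]) simp
      moreover have "{\<omega> \<in> space (Fil i). S k \<omega> = l ! k} = S k -` {l ! k} \<inter> space (Fil (Suc k))"
        by (auto simp: space_Fil)
      ultimately show "{\<omega> \<in> space (Fil i). S k \<omega> = l ! k} \<in> sets (Fil i)" by auto
    qed simp
    moreover have "h \<omega> = l \<longleftrightarrow> length l = i \<and> (\<forall>k\<in>{..<i}. S k \<omega> = l ! k)" for \<omega>
    proof
      assume "h \<omega> = l"
      then show "length l = i \<and> (\<forall>k\<in>{..<i}. S k \<omega> = l ! k)"
        by (intro conjI ballI) (simp_all add: h_def flip: \<open>h \<omega> = l\<close>)
    next
      assume l: "length l = i \<and> (\<forall>k\<in>{..<i}. S k \<omega> = l ! k)"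
      show "h \<omega> = l"
        by (rule nth_equalityI) (use l in \<open>auto simp: h_def\<close>)
    qed
    then have "h -` {l} \<inter> space (Fil i) =
        (if length l = i then {\<omega> \<in> space (Fil i). \<forall>k\<in>{..<i}. S k \<omega> = l ! k} else {})"
      by (intro set_eqI) (simp add: conj_commute)
    ultimately show "h -` {l} \<inter> space (Fil i) \<in> sets (Fil i)" by simp
  qed auto
  then have "(\<lambda>\<omega>. g' (h \<omega>)) \<in> borel_measurable (Fil i)"
    by (rule measurable_compose) simp
  then show ?thesis
    using g' by (subst measurable_cong[where g="\<lambda>\<omega>. g' (h \<omega>)"]) (auto simp: space_Fil)
qed

lemma determined_measurable_M:
  fixes g :: "'w \<Rightarrow> real"
  assumes "determined i g"
  shows "g \<in> borel_measurable M"
  by (rule measurable_from_subalg[OF Fil_sub determined_measurable[OF assms]])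

text \<open>Only finitely many histories of length \<open>i\<close> exist, so \<open>g\<close> is
  bounded.\<close>

lemma determined_integrable:
  fixes g :: "'w \<Rightarrow> real"
  assumes g: "determined i g"
  shows "integrable M g"
proof -
  obtain g' where g': "\<And>\<omega>. \<omega> \<in> space M \<Longrightarrow> g \<omega> = g' (map (\<lambda>k. S k \<omega>) [0..<i])"
    using determined_factor[OF g] by blast
  have "finite {l :: 's list. length l = i}"
    using finite_lists_length_eq[of "UNIV :: 's set" i] by simp
  then have fin: "finite ((\<lambda>l. \<bar>g' l\<bar>) ` {l. length l = i})" by simp
  define B where "B = Max ((\<lambda>l. \<bar>g' l\<bar>) ` {l. length l = i})"
  have "\<bar>g' l\<bar> \<le> B" if "length l = i" for l
    unfolding B_def using that fin by (intro Max_ge) auto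
  then show ?thesis
    by (intro integrable_const_bound[where B=B, OF AE_I2 determined_measurable_M[OF g]]) (simp add: g')
qed

lemma determined_mono: "determined i g \<Longrightarrow> i \<le> j \<Longrightarrow> determined j g"
  by (rule determinedI) (erule determinedD; simp)

lemma determined_mult:
  fixes g h :: "'w \<Rightarrow> real"
  assumes "determined i g" "determined i h"
  shows "determined i (\<lambda>\<omega>. g \<omega> * h \<omega>)"
  by (intro determinedI arg_cong2[where f="(*)"]) (rule assms[THEN determinedD]; assumption)+

lemma cond_exp_integral:
  fixes g h :: "'w \<Rightarrow> real"
  assumes g: "determined i g" and h: "determined j h"
  shows "integrable M (\<lambda>\<omega>. g \<omega> * real_cond_exp M (Fil i) h \<omega>)"
    and "(\<integral>\<omega>. g \<omega> * real_cond_exp M (Fil i) h \<omega> \<partial>M) = (\<integral>\<omega>. g \<omega> * h \<omega> \<partial>M)"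
proof -
  interpret finite_measure_subalgebra M "Fil i" by unfold_locales (rule Fil_sub)
  have "determined (max i j) (\<lambda>\<omega>. g \<omega> * h \<omega>)"
    by (rule determined_mult[OF determined_mono[OF g] determined_mono[OF h]]) auto
  then have int: "integrable M (\<lambda>\<omega>. g \<omega> * h \<omega>)" by (rule determined_integrable)
  note * = int determined_measurable[OF g] determined_measurable_M[OF h]
  show "integrable M (\<lambda>\<omega>. g \<omega> * real_cond_exp M (Fil i) h \<omega>)"
    and "(\<integral>\<omega>. g \<omega> * real_cond_exp M (Fil i) h \<omega> \<partial>M) = (\<integral>\<omega>. g \<omega> * h \<omega> \<partial>M)"
    using real_cond_exp_intg[OF *] by auto
qed

lemma cond_exp_const:
  fixes g h :: "'w \<Rightarrow> real"
  assumes g: "determined i g" and h: "determined j h"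
    and c: "AE \<omega> in M. real_cond_exp M (Fil i) h \<omega> = c"
  shows "(\<integral>\<omega>. g \<omega> * h \<omega> \<partial>M) = c * (\<integral>\<omega>. g \<omega> \<partial>M)"
proof -
  have "(\<integral>\<omega>. g \<omega> * h \<omega> \<partial>M) = (\<integral>\<omega>. g \<omega> * real_cond_exp M (Fil i) h \<omega> \<partial>M)"
    using cond_exp_integral(2)[OF g h] by simp
  also have "\<dots> = (\<integral>\<omega>. c * g \<omega> \<partial>M)"
    by (rule integral_cong_AE)
       (use c cond_exp_integral(1)[OF g h] determined_measurable_M[OF g] in auto)
  finally show ?thesis by simp
qed

lemma cond_exp_ge:
  fixes g h :: "'w \<Rightarrow> real"
  assumes g: "determined i g" "\<And>\<omega>. 0 \<le> g \<omega>" and h: "determined j h"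
    and c: "AE \<omega> in M. real_cond_exp M (Fil i) h \<omega> \<ge> c"
  shows "c * (\<integral>\<omega>. g \<omega> \<partial>M) \<le> (\<integral>\<omega>. g \<omega> * h \<omega> \<partial>M)"
proof -
  have "(\<integral>\<omega>. c * g \<omega> \<partial>M) \<le> (\<integral>\<omega>. g \<omega> * real_cond_exp M (Fil i) h \<omega> \<partial>M)"
  proof (rule integral_mono_AE)
    show "AE \<omega> in M. c * g \<omega> \<le> g \<omega> * real_cond_exp M (Fil i) h \<omega>"
      using c by eventually_elim (metis g(2) mult.commute mult_left_mono)
  qed (use cond_exp_integral(1)[OF g(1) h] determined_integrable[OF g(1)] in auto)
  then show ?thesis using cond_exp_integral(2)[OF g(1) h] by simp
qed

text \<open>Integrating the conditional probability gives an event of probability one; dependence on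
  a finite history makes it measurable.\<close>

lemma cond_prob_one_AE:
  assumes Pr: "determined j Pr"
    and one: "AE \<omega> in M. real_cond_exp M (Fil i) (indicat_real {\<omega> \<in> space M. Pr \<omega>}) \<omega> = 1"
  shows "AE \<omega> in M. Pr \<omega>"
proof -
  let ?A = "{\<omega> \<in> space M. Pr \<omega>}"
  have det: "determined j (indicat_real ?A)" 
  proof (rule determinedI)
    fix \<omega> \<omega>'
    assume *: "\<omega> \<in> space M" "\<omega>' \<in> space M" "\<And>k. k < j \<Longrightarrow> S k \<omega> = S k \<omega>'"
    have "Pr \<omega> = Pr \<omega>'" by (rule determinedD[OF Pr *])
    then show "indicat_real ?A \<omega> = indicat_real ?A \<omega>'" using *(1,2) by (simp add: indicator_def)
  qed
  have "?A = indicat_real ?A -` {1} \<inter> space M" by (auto simp: indicator_def)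
  then have A: "?A \<in> sets M"
    using measurable_sets[OF determined_measurable_M[OF det], of "{1}"] by simp
  have "(\<integral>\<omega>. 1 * indicat_real ?A \<omega> \<partial>M) = 1 * (\<integral>\<omega>. 1 \<partial>M)"
    by (rule cond_exp_const[OF _ det one]) (simp add: determined_def)
  then have "prob ?A = 1" using A by (simp add: prob_space)
  then have "AE \<omega> in M. \<omega> \<in> ?A" using A by (subst prob_eq_1[symmetric])
  then show ?thesis by eventually_elim simp
qed

end


section \<open>Averaging over the samples and the convergence rate\<close>

theorem theorem4p5:
  fixes K :: "'x::{real_inner,complete_space} \<Rightarrow> 'y::{real_inner,complete_space}"
    and D :: "'x \<Rightarrow> 'x \<Rightarrow>\<^sub>L 'y"
    and P :: "'m::finite \<Rightarrow> 'x \<Rightarrow>\<^sub>L 'x"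
    and Q :: "'n::finite \<Rightarrow> 'y \<Rightarrow>\<^sub>L 'y"
    and P_NL :: "'y \<Rightarrow>\<^sub>L 'y"
    and G :: "'m \<Rightarrow> 'x \<Rightarrow> ereal"
    and F :: "'n \<Rightarrow> 'y \<Rightarrow> ereal"
    and xh :: 'x and yh :: 'y
    and XK XG :: "'x set" and YF :: "'y set"
    and L L3 p \<alpha>y \<delta> \<kappa> \<rho>x Lbar :: real
    and \<theta> :: "('x \<Rightarrow>\<^sub>L 'x) \<Rightarrow> real"
    and \<gamma>K \<gamma>G \<gamma>Gt \<pi> :: "'m \<Rightarrow> real"
    and \<gamma>F \<gamma>Fbar \<zeta> \<rho> :: "'n \<Rightarrow> real"
    and w :: "'m \<Rightarrow> 'n \<Rightarrow> 'n \<Rightarrow> real"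
    and \<tau> :: "nat \<Rightarrow> 'm \<Rightarrow> real" and \<sigma> :: "nat \<Rightarrow> 'n \<Rightarrow> real" and \<omega>b :: "nat \<Rightarrow> real"
    and M :: "'w measure"
    and Fil :: "nat \<Rightarrow> 'w measure"   (* Fil i is the sigma-algebra with index i - 1 in the paper *)
    and S :: "nat \<Rightarrow> 'w \<Rightarrow> 'm set"
    and x0 :: 'x and y0 :: 'y
    and x xbar :: "nat \<Rightarrow> 'w \<Rightarrow> 'x" and y :: "nat \<Rightarrow> 'w \<Rightarrow> 'y"
  (* setting *)
  assumes K_C1: "C1_with_derivative K D"
    and P_dec: "orth_decomposition P"
    and Q_dec: "orth_decomposition Q"
    and P_NL: "orth_projection P_NL" "range (blinfun_apply P_NL) = Y_nonlin K"
    and G_conv: "\<And>j. convex_fun (G j)" "\<And>j. proper_fun (G j)" "\<And>j. lsc_fun (G j)"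
    and F_conv: "\<And>l. convex_fun (F l)" "\<And>l. proper_fun (F l)" "\<And>l. lsc_fun (F l)"
    and crit_x: "- adjoint (blinfun_apply (D xh)) yh \<in> subdiff (separable_sum P G) xh"
    and crit_y: "K xh \<in> subdiff (separable_sum Q (\<lambda>l. fenchel_conj (F l))) yh"
  (* probability *)
    and M_prob: "prob_space M"
    and Fil_sub: "\<And>i. subalgebra M (Fil i)"
    and Fil_mono: "\<And>i. sets (Fil i) \<subseteq> sets (Fil (Suc i))"
    and S_meas: "\<And>i. S i \<in> measurable (Fil (Suc i)) (count_space UNIV)"
    and pi_pos: "\<And>j. 0 < \<pi> j"
    and S_prob: "\<And>i j. AE \<omega> in M.
          real_cond_exp M (Fil i) (indicat_real {\<omega> \<in> space M. j \<in> S i \<omega>}) \<omega> = \<pi> j"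
  (* Lipschitz, three-point and monotonicity properties *)
    and XK_nbh: "xh \<in> interior XK" and XG_nbh: "xh \<in> interior XG" and YF_nbh: "yh \<in> interior YF"
    and L_nonneg: "0 \<le> L" and K_lip: "lipschitz_property D L XK"
    and L3_nonneg: "0 \<le> L3" and p_range: "1 \<le> p" "p \<le> 2"
    and K_three_point: "three_point_property K D P \<gamma>K L3 p \<theta> xh yh XK"
    and gammaG_nonneg: "\<And>j. 0 \<le> \<gamma>G j" and gammaF_nonneg: "\<And>l. 0 \<le> \<gamma>F l"
    and G_mono: "monotonicity_property (separable_sum P G) P \<gamma>G xh XG"
    and F_mono: "monotonicity_property (separable_sum Q (\<lambda>l. fenchel_conj (F l))) Q \<gamma>F yh YF"
    and gamma_pos: "\<And>j. 0 < \<gamma>G j + \<gamma>K j"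
  (* dual factors *)
    and alpha_pos: "0 < \<alpha>y"
    and zeta: "\<And>l. 0 \<le> \<zeta> l" "\<And>l. 1 < p \<Longrightarrow> 0 < \<zeta> l"
    and gammaFbar_def: "\<And>l. \<gamma>Fbar l =
          (if Q l o\<^sub>L P_NL = 0 then \<gamma>F l else \<gamma>F l - (p - 1) * \<zeta> l - \<alpha>y)"
    and gammaFbar_nonneg: "\<And>l. 0 \<le> \<gamma>Fbar l"
    and gammaGt: "\<And>j. 0 < \<gamma>Gt j" "\<And>j. \<gamma>Gt j < \<pi> j * (\<gamma>G j + \<gamma>K j)"
  (* step lengths *)
    and tau0: "\<And>j. 0 < \<tau> 0 j" and sigma0: "\<And>l. 0 < \<sigma> 0 l"
    and omega_rule: "\<And>i. \<omega>b i = (MAX j\<in>UNIV. 1 / sqrt (1 + 2 * \<tau> i j * \<gamma>Gt j))"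
    and sigma_rule: "\<And>i l. \<sigma> (Suc i) l = \<sigma> i l / \<omega>b i"
    and tau_rule: "\<And>i j. \<tau> (Suc i) j = 1 / (1 + 2 * \<tau> i j * \<gamma>Gt j) * (\<tau> i j / \<omega>b i)"
  (* algorithm *)
    and x_init: "\<And>\<omega>. \<omega> \<in> space M \<Longrightarrow> x 0 \<omega> = x0"
    and y_init: "\<And>\<omega>. \<omega> \<in> space M \<Longrightarrow> y 0 \<omega> = y0"
    and step: "\<And>i \<omega>. \<omega> \<in> space M \<Longrightarrow>
          pd_step G (\<lambda>l. fenchel_conj (F l)) K D P Q \<pi> (\<tau> i) (\<sigma> (Suc i)) (\<omega>b i) (S i \<omega>)
            (x i \<omega>) (y i \<omega>) (xbar (Suc i) \<omega>) (x (Suc i) \<omega>) (y (Suc i) \<omega>)"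
  (* weights and step length conditions *)
    and w_pos: "\<And>j l k. 0 < w j l k" and w_recip: "\<And>j l k. w j l k = 1 / w j k l"
    and delta_kappa: "0 < \<delta>" "\<delta> \<le> \<kappa>" "\<kappa> < 1"
    and rho_nonneg: "0 \<le> \<rho>x" "\<And>l. 0 \<le> \<rho> l"
    and kappa_cond: "AE \<omega> in M. \<forall>i l. 1 - \<kappa> \<ge>
          (norm (\<Sum>j\<in>S i \<omega>.
             sqrt (block_weight P Q w (D (x i \<omega>)) (S i \<omega>) j l * \<sigma> 0 l * \<tau> 0 j / \<pi> j)
               *\<^sub>R (Q l o\<^sub>L D (x i \<omega>) o\<^sub>L P j)))\<^sup>2"
    and Lbar_def: "Lbar = L3 + L / \<omega>b 0 *
          ((MAX j\<in>UNIV. (1 / \<pi> j + 1)\<^sup>2) * (\<Sum>l\<in>UNIV. \<rho> l)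
           + real CARD('n) * L / (2 * \<alpha>y) * \<rho>x\<^sup>2)"
    and delta_cond: "\<And>j. \<delta> \<ge> \<tau> 0 j * (Lbar + 2 * (1 - \<pi> j) * (\<gamma>G j + \<gamma>K j) *
          ((\<gamma>G j + \<gamma>K j - \<gamma>Gt j) / (\<pi> j * (\<gamma>G j + \<gamma>K j) - \<gamma>Gt j)))"
    and theta_cond: "\<And>i. AE \<omega> in M.
          real_cond_exp M (Fil i)
            (\<lambda>\<omega>. \<theta> (block_op P (\<lambda>j. if j \<in> S i \<omega> then 1 / \<pi> j else 0))) \<omega>
          \<ge> p powr (- p) * (\<Sum>l\<in>UNIV. rpow (\<zeta> l) (1 - p) * rpow (\<rho> l) (2 - p)) / \<omega>b 0"
    and bound_cond: "\<And>i. AE \<omega> in M.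
          real_cond_exp M (Fil i)
            (indicat_real {\<omega> \<in> space M. norm (x (Suc i) \<omega> - xh) \<le> \<rho>x \<and>
               (\<forall>l. op_norm P_NL (Q l (y (Suc i) \<omega> - yh)) \<le> \<rho> l)}) \<omega> = 1"
  (* the iterates stay where the local properties hold *)
    and local_XK: "AE \<omega> in M. \<forall>i. closed_segment (x (Suc i) \<omega>) (xbar (Suc (Suc i)) \<omega>) \<subseteq> XK"
    and local_XG: "AE \<omega> in M. \<forall>i. \<forall>j\<in>S i \<omega>. xh + P j (x (Suc i) \<omega> - xh) \<in> XG"
    and local_YF: "AE \<omega> in M. \<forall>i. y (Suc i) \<omega> \<in> YF"
  shows "\<forall>j. (\<forall>N. integrable M (\<lambda>\<omega>. (norm (P j (x N \<omega> - xh)))\<^sup>2)) \<and>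
           (\<lambda>N. \<integral>\<omega>. (norm (P j (x N \<omega> - xh)))\<^sup>2 \<partial>M) \<longlonglongrightarrow> 0 \<and>
           (\<lambda>N. \<integral>\<omega>. (norm (P j (x N \<omega> - xh)))\<^sup>2 \<partial>M) \<in> O(\<lambda>N. 1 / (real N)\<^sup>2)"
proof -
  let ?F = "\<lambda>l. fenchel_conj (F l)"
  interpret acc: accelerated_steps \<tau> \<sigma> \<omega>b \<gamma>Gt
    by unfold_locales (fact tau0 sigma0 gammaGt(1) omega_rule sigma_rule tau_rule)+
  interpret prob_space M by (rule M_prob)
  interpret fs: finitely_sampled M Fil S
    by unfold_locales (fact Fil_sub Fil_mono S_meas)+
  define \<eta> where "\<eta> = acc.\<eta>"
  have \<eta>_pos: "0 < \<eta> i" for i using acc.eta_ge_1[of i] by (simp add: \<eta>_def)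
  have G_ninf: "G j z \<noteq> -\<infinity>" for j z using G_conv(2)[of j] by (simp add: proper_fun_def)
  have F_cvx: "convex_fun (?F l)" for l by (rule convex_fun_fenchel_conj[OF F_conv(2)])
  have F_ninf: "?F l z \<noteq> -\<infinity>" for l z by (rule fenchel_conj_not_MInf[OF F_conv(2)])
  have G_fin: "G j (P j xh) \<noteq> \<infinity>" for j
    using subdiff_separable_sumD(1)[OF P_dec G_ninf crit_x, of j] by auto
  have F_fin: "?F l (Q l yh) \<noteq> \<infinity>" for l
    using subdiff_separable_sumD(1)[OF Q_dec F_ninf crit_y, of l] by auto
  have \<sigma>_pos: "0 < \<sigma> i l" for i l
    using \<eta>_pos[of i] sigma0[of l] by (simp add: acc.sigma_eq[of i] \<eta>_def)

  \<comment> \<open>The iterates as functions of the sampling history\<close>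
  have iter_det: "fs.determined i (\<lambda>\<omega>. (x i \<omega>, y i \<omega>))" for i
  proof (induction i)
    case 0
    then show ?case by (intro fs.determinedI) (simp add: x_init y_init)
  next
    case (Suc i)
    show ?case
    proof (rule fs.determinedI)
      fix \<omega> \<omega>'
      assume sp: "\<omega> \<in> space M" "\<omega>' \<in> space M" and eq: "\<And>k. k < Suc i \<Longrightarrow> S k \<omega> = S k \<omega>'"
      have "(x i \<omega>, y i \<omega>) = (x i \<omega>', y i \<omega>')"
        by (rule fs.determinedD[OF Suc sp]) (rule eq, simp)
      then have xy: "x i \<omega>' = x i \<omega>" "y i \<omega>' = y i \<omega>" by auto
      have "S i \<omega>' = S i \<omega>" using eq[of i] by simp
      note step2 = step[OF sp(2), of i, unfolded this xy]
      have "x (Suc i) \<omega> = x (Suc i) \<omega>' \<and> y (Suc i) \<omega> = y (Suc i) \<omega>'"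
        by (rule pd_step_unique[OF P_dec Q_dec G_conv(1) G_ninf G_fin F_cvx F_ninf F_fin
              acc.tau_pos \<sigma>_pos step[OF sp(1)] step2])
      then show "(x (Suc i) \<omega>, y (Suc i) \<omega>) = (x (Suc i) \<omega>', y (Suc i) \<omega>')" by simp
    qed
  qed
  have det_iter: "fs.determined i (\<lambda>\<omega>. g (x i \<omega>) (y i \<omega>))" for i and g :: "'x \<Rightarrow> 'y \<Rightarrow> 'c"
  proof (rule fs.determinedI)
    fix \<omega> \<omega>'
    assume *: "\<omega> \<in> space M" "\<omega>' \<in> space M" "\<And>k. k < i \<Longrightarrow> S k \<omega> = S k \<omega>'"
    have "(x i \<omega>, y i \<omega>) = (x i \<omega>', y i \<omega>')" by (rule fs.determinedD[OF iter_det *])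
    then show "g (x i \<omega>) (y i \<omega>) = g (x i \<omega>') (y i \<omega>')" by simp
  qed
  have det_S: "fs.determined (Suc i) (\<lambda>\<omega>. g (S i \<omega>))" for i and g :: "'m set \<Rightarrow> real"
    by (rule fs.determinedI, rule arg_cong[of _ _ g]) simp
  have int_iter: "integrable M (\<lambda>\<omega>. g (x i \<omega>) (y i \<omega>))" for i and g :: "'x \<Rightarrow> 'y \<Rightarrow> real"
    by (rule fs.determined_integrable[OF det_iter])
  have int_iter_S: "integrable M (\<lambda>\<omega>. g (x i \<omega>) (y i \<omega>) * h (S i \<omega>))"
    for i and g :: "'x \<Rightarrow> 'y \<Rightarrow> real" and h :: "'m set \<Rightarrow> real"
    by (rule fs.determined_integrable[OF fs.determined_mult[OF
          fs.determined_mono[OF det_iter[of i g] le_SucI[OF order_refl]] det_S[of i h]]])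

  \<comment> \<open>Averages of the sampling weights\<close>
  define a where "a T j = (if j \<in> T then 1 / \<pi> j else 0)" for T :: "'m set" and j
  \<comment> \<open>The weight \<open>a (S i \<omega>) j\<close> has conditional mean one, and the
    other factor is fixed by the history before \<open>S i\<close>.\<close>
  have mean_a: "(\<integral>\<omega>. g (x i \<omega>) (y i \<omega>) * a (S i \<omega>) j \<partial>M) = (\<integral>\<omega>. g (x i \<omega>) (y i \<omega>) \<partial>M)"
    for i j and g :: "'x \<Rightarrow> 'y \<Rightarrow> real"
  proof -
    define h where "h = indicat_real {\<omega> \<in> space M. j \<in> S i \<omega>}"
    have "fs.determined (Suc i) h"
      by (rule fs.determinedI) (simp add: h_def indicator_def)
    then have "(\<integral>\<omega>. g (x i \<omega>) (y i \<omega>) * h \<omega> \<partial>M) = \<pi> j * (\<integral>\<omega>. g (x i \<omega>) (y i \<omega>) \<partial>M)"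
      by (rule fs.cond_exp_const[OF det_iter]) (use S_prob in \<open>simp add: h_def\<close>)
    moreover have "(\<integral>\<omega>. g (x i \<omega>) (y i \<omega>) * a (S i \<omega>) j \<partial>M) =
        (\<integral>\<omega>. (g (x i \<omega>) (y i \<omega>) * h \<omega>) / \<pi> j \<partial>M)"
      by (rule Bochner_Integration.integral_cong) (auto simp: h_def a_def)
    ultimately show ?thesis using pi_pos[of j] by simp
  qed
  have pi_le: "\<pi> j \<le> 1" for j
  proof -
    define h where "h = indicat_real {\<omega> \<in> space M. j \<in> S 0 \<omega>}"
    have det: "fs.determined (Suc 0) h"
      by (rule fs.determinedI) (simp add: h_def indicator_def)
    have "(\<integral>\<omega>. 1 * h \<omega> \<partial>M) = \<pi> j * (\<integral>\<omega>. 1 \<partial>M)"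
      by (rule fs.cond_exp_const[of 0, OF _ det])
         (use S_prob in \<open>simp_all add: h_def fs.determined_def\<close>)
    moreover have "(\<integral>\<omega>. h \<omega> \<partial>M) \<le> (\<integral>\<omega>. 1 \<partial>M)"
      by (rule integral_mono[OF fs.determined_integrable[OF det]]) (auto simp: h_def)
    ultimately show ?thesis by (simp add: prob_space)
  qed

  \<comment> \<open>Decrease of the expected Lyapunov function\<close>
  define R where "R u = norm (K xh - K u - D u (xh - u)) powr p" for u
  define c\<theta> where "c\<theta> = p powr (- p) * (\<Sum>l\<in>UNIV. rpow (\<zeta> l) (1 - p) * rpow (\<rho> l) (2 - p)) / \<omega>b 0"
  define W where "W i u v = (\<Sum>j\<in>UNIV. \<eta> i / \<tau> i j / \<pi> j * (norm (P j (u - xh)))\<^sup>2)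
      + (\<Sum>l\<in>UNIV. (norm (Q l (v - yh)))\<^sup>2 / \<sigma> 0 l)" for i u v
  \<comment> \<open>The weights \<open>a\<close> differ from block to block, so the cross term is
    averaged blockwise and reassembled by \<open>B_C\<close>.\<close>
  define B where "B u v j = (v - yh) \<bullet> D u (P j (u - xh))" for u v j
  define C where "C u v = (v - yh) \<bullet> D u (u - xh)" for u v
  have B_C: "(\<Sum>j\<in>UNIV. B u v j) = C u v" for u v
    unfolding B_def C_def inner_sum_right[symmetric] blinfun.sum_right[symmetric]
      orth_decompositionD(4)[OF P_dec] ..
  have B_block: "(\<Sum>j\<in>UNIV. B u v j * a T j) = (v - yh) \<bullet> D u (block_op P (a T) (u - xh))" for u v T
    by (simp add: B_def block_op_apply blinfun.sum_right blinfun.scaleR_right inner_sum_right mult.commute)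
  define V where "V i = (\<integral>\<omega>. W i (x i \<omega>) (y i \<omega>) - 2 * \<eta> i * C (x i \<omega>) (y i \<omega>) \<partial>M)" for i

  have bound: "AE \<omega> in M. \<forall>i. norm (x (Suc i) \<omega> - xh) \<le> \<rho>x \<and>
      (\<forall>l. op_norm P_NL (Q l (y (Suc i) \<omega> - yh)) \<le> \<rho> l)"
    unfolding AE_all_countable
    by (intro allI fs.cond_prob_one_AE[OF det_iter[of _ "\<lambda>u v. norm (u - xh) \<le> \<rho>x \<and>
          (\<forall>l. op_norm P_NL (Q l (v - yh)) \<le> \<rho> l)"] bound_cond])

  have V_Suc: "V (Suc (Suc k)) \<le> V (Suc k)" for k
  proof -
    \<comment> \<open>\<open>i\<close> is at least 1, since the bounds and local properties speak of
      iterates with positive index.\<close>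
    define i where "i = Suc k"
    define U where "U u j = 2 * \<eta> i * \<gamma>Gt j / \<pi> j * (norm (P j (u - xh)))\<^sup>2" for u j
    define \<theta>S where "\<theta>S T = \<theta> (block_op P (a T))" for T
    have AE_step: "AE \<omega> in M. W (Suc i) (x (Suc i) \<omega>) (y (Suc i) \<omega>) - 2 * \<eta> (Suc i) * C (x (Suc i) \<omega>) (y (Suc i) \<omega>) \<le>
        W i (x i \<omega>) (y i \<omega>)
        + (\<Sum>j\<in>UNIV. U (x i \<omega>) j - U (x i \<omega>) j * a (S i \<omega>) j)
        - 2 * \<eta> i * (\<Sum>j\<in>UNIV. B (x i \<omega>) (y i \<omega>) j * a (S i \<omega>) j)
        - 2 * \<eta> i * (R (x i \<omega>) * \<theta>S (S i \<omega>) - c\<theta> * R (x i \<omega>))"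
      using kappa_cond local_XK local_XG local_YF bound AE_space
    proof eventually_elim
      case (elim \<omega>)
      \<comment> \<open>\<open>local_XK\<close> at index \<open>k\<close> gives the segment that
        starts at \<open>x i\<close>; at the next index only the starting point
        \<open>x (Suc i)\<close> of the segment is used.\<close>
      have seg: "closed_segment (x i \<omega>) (xbar (Suc i) \<omega>) \<subseteq> XK"
        and x': "x (Suc i) \<omega> \<in> XK"
        using elim(2)[rule_format, of k] elim(2)[rule_format, of "Suc k"] unfolding i_def by auto
      have XG: "xh + P j (x (Suc i) \<omega> - xh) \<in> XG" if "j \<in> S i \<omega>" for j
        using elim(3) that by blast
      have bnd: "norm (x (Suc i) \<omega> - xh) \<le> \<rho>x" "op_norm P_NL (Q l (y (Suc i) \<omega> - yh)) \<le> \<rho> l" for l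
        using elim(5) by auto
      have kappa: "(norm (\<Sum>j\<in>S i \<omega>. sqrt (block_weight P Q w (D (x i \<omega>)) (S i \<omega>) j l * \<sigma> 0 l * \<tau> 0 j / \<pi> j)
               *\<^sub>R (Q l o\<^sub>L D (x i \<omega>) o\<^sub>L P j)))\<^sup>2 \<le> 1 - \<kappa>" for l
        using elim(1) by blast
      have st: "\<eta> i * \<sigma> 0 l * \<tau> i j \<le> \<sigma> 0 l * \<tau> 0 j" for l j
        using acc.sigma_tau_le[of i l j] by (simp add: acc.sigma_eq[of i] \<eta>_def)
      have \<sigma>_Suc: "\<sigma> (Suc i) = (\<lambda>l. \<eta> i / \<omega>b i * \<sigma> 0 l)"
        by (rule ext) (simp add: acc.sigma_eq[of "Suc i"] acc.eta_Suc \<eta>_def)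
      have \<gamma>Fb: "0 \<le> (if Q l o\<^sub>L P_NL = 0 then \<gamma>F l else \<gamma>F l - (p - 1) * \<zeta> l - \<alpha>y)" for l
        using gammaFbar_nonneg[of l] by (simp only: gammaFbar_def)
      note est = one_step[OF K_C1 P_dec Q_dec P_NL G_conv(1) G_ninf F_cvx F_ninf crit_x crit_y G_mono F_mono
        K_three_point L_nonneg K_lip p_range zeta alpha_pos \<gamma>Fb gammaGt w_pos w_recip pi_pos pi_le
        acc.tau_pos acc.tau_le sigma0 st acc.omega_pos acc.omega_0_le acc.omega_le_1 \<eta>_pos rho_nonneg
        delta_kappa kappa Lbar_def delta_cond refl step[OF elim(6), of i, unfolded \<sigma>_Suc] seg x' XG elim(4)[rule_format] bnd]
      have phi: "\<eta> i / \<tau> i j + 2 * \<eta> i * \<gamma>Gt j = \<eta> (Suc i) / \<tau> (Suc i) j" for j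
        unfolding \<eta>_def by (rule acc.phi_Suc[symmetric])
      have eta: "\<eta> i / \<omega>b i = \<eta> (Suc i)" unfolding \<eta>_def by (rule acc.eta_Suc[symmetric])
      have aa: "block_op P (\<lambda>j. if j \<in> S i \<omega> then 1 / \<pi> j else 0) = block_op P (a (S i \<omega>))"
        by (simp add: a_def[abs_def])
      have UU: "(\<Sum>j\<in>UNIV. U (x i \<omega>) j - U (x i \<omega>) j * a (S i \<omega>) j) =
          (\<Sum>j\<in>UNIV. 2 * \<eta> i * \<gamma>Gt j / \<pi> j * (norm (P j (x i \<omega> - xh)))\<^sup>2 * (1 - (if j \<in> S i \<omega> then 1 / \<pi> j else 0)))"
        by (intro sum.cong) (auto simp: U_def a_def right_diff_distrib)
      have RR: "2 * \<eta> i * (R (x i \<omega>) * \<theta>S (S i \<omega>) - c\<theta> * R (x i \<omega>)) =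
          2 * \<eta> i * (\<theta>S (S i \<omega>) - c\<theta>) * R (x i \<omega>)"
        by (simp add: algebra_simps)
      note est' = est[unfolded phi eta aa]
      \<comment> \<open>\<open>est'\<close> agrees with the goal up to rearrangement, so the rule
        leaves one equation for each side.\<close>
      show ?case
        unfolding UU RR unfolding W_def C_def B_block \<theta>S_def R_def c\<theta>_def
        by (rule order_trans[OF eq_refl order_trans[OF est' eq_refl]]) simp_all
    qed
    have i1: "integrable M (\<lambda>\<omega>. W i (x i \<omega>) (y i \<omega>))" for i by (rule int_iter)
    have i1': "integrable M (\<lambda>\<omega>. C (x i \<omega>) (y i \<omega>))" for i by (rule int_iter)
    have i2: "integrable M (\<lambda>\<omega>. U (x i \<omega>) j)" for j by (rule int_iter)
    have i3: "integrable M (\<lambda>\<omega>. U (x i \<omega>) j * a (S i \<omega>) j)" for j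
      by (rule int_iter_S[of "\<lambda>u v. U u j" i "\<lambda>T. a T j"])
    have i4: "integrable M (\<lambda>\<omega>. B (x i \<omega>) (y i \<omega>) j * a (S i \<omega>) j)" for j
      by (rule int_iter_S[of "\<lambda>u v. B u v j" i "\<lambda>T. a T j"])
    have i4': "integrable M (\<lambda>\<omega>. B (x i \<omega>) (y i \<omega>) j)" for j by (rule int_iter)
    have i5: "integrable M (\<lambda>\<omega>. R (x i \<omega>) * \<theta>S (S i \<omega>))"
      by (rule int_iter_S[of "\<lambda>u v. R u" i \<theta>S])
    have i6: "integrable M (\<lambda>\<omega>. R (x i \<omega>))" by (rule int_iter)
    have m3: "(\<integral>\<omega>. U (x i \<omega>) j * a (S i \<omega>) j \<partial>M) = (\<integral>\<omega>. U (x i \<omega>) j \<partial>M)" for j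
      by (rule mean_a)
    have m4: "(\<Sum>j\<in>UNIV. \<integral>\<omega>. B (x i \<omega>) (y i \<omega>) j * a (S i \<omega>) j \<partial>M) = (\<integral>\<omega>. C (x i \<omega>) (y i \<omega>) \<partial>M)"
    proof -
      have "(\<integral>\<omega>. B (x i \<omega>) (y i \<omega>) j * a (S i \<omega>) j \<partial>M) = (\<integral>\<omega>. B (x i \<omega>) (y i \<omega>) j \<partial>M)" for j
        by (rule mean_a)
      then show ?thesis using i4' by (simp add: B_C flip: Bochner_Integration.integral_sum)
    qed
    have m5: "c\<theta> * (\<integral>\<omega>. R (x i \<omega>) \<partial>M) \<le> (\<integral>\<omega>. R (x i \<omega>) * \<theta>S (S i \<omega>) \<partial>M)"
    proof (rule fs.cond_exp_ge)
      show "fs.determined i (\<lambda>\<omega>. R (x i \<omega>))" by (rule det_iter)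
      show "fs.determined (Suc i) (\<lambda>\<omega>. \<theta>S (S i \<omega>))" by (rule det_S)
      show "AE \<omega> in M. real_cond_exp M (Fil i) (\<lambda>\<omega>. \<theta>S (S i \<omega>)) \<omega> \<ge> c\<theta>"
        using theta_cond[of i] by (simp only: \<theta>S_def a_def[abs_def] c\<theta>_def)
    qed (simp add: R_def)
    have "V (Suc i) \<le> (\<integral>\<omega>. W i (x i \<omega>) (y i \<omega>)
        + (\<Sum>j\<in>UNIV. U (x i \<omega>) j - U (x i \<omega>) j * a (S i \<omega>) j)
        - 2 * \<eta> i * (\<Sum>j\<in>UNIV. B (x i \<omega>) (y i \<omega>) j * a (S i \<omega>) j)
        - 2 * \<eta> i * (R (x i \<omega>) * \<theta>S (S i \<omega>) - c\<theta> * R (x i \<omega>)) \<partial>M)"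
      unfolding V_def by (intro integral_mono_AE AE_step) (use i1 i1' i2 i3 i4 i5 i6 in auto)
    also have "\<dots> = (\<integral>\<omega>. W i (x i \<omega>) (y i \<omega>) \<partial>M) - 2 * \<eta> i * (\<integral>\<omega>. C (x i \<omega>) (y i \<omega>) \<partial>M)
        - 2 * \<eta> i * ((\<integral>\<omega>. R (x i \<omega>) * \<theta>S (S i \<omega>) \<partial>M) - c\<theta> * (\<integral>\<omega>. R (x i \<omega>) \<partial>M))"
      using i1 i1' i2 i3 i4 i5 i6 by (simp add: m3 m4)
    also have "\<dots> \<le> V i"
      unfolding V_def using i1 i1' m5 \<eta>_pos[of i] by simp
    finally show ?thesis by (simp add: i_def)
  qed
  have V_le: "V (Suc k) \<le> V 1" for k
    by (induction k) (auto intro: order_trans[OF V_Suc])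

  \<comment> \<open>Lower bound for the Lyapunov function\<close>
  have int_err: "integrable M (\<lambda>\<omega>. (norm (P j (x N \<omega> - xh)))\<^sup>2)" for j N
    by (rule int_iter)
  \<comment> \<open>The cross term is first bounded on the sample \<open>S N\<close>, and averaging
    removes the weights \<open>1 / \<pi> j\<close> from both sides. The primal weights in
    \<open>W\<close> keep their factor \<open>1 / \<pi> j\<close>, which is at least 1, so a share
    \<open>\<kappa>\<close> of the primal errors survives.\<close>
  have V_ge: "\<kappa> * (\<eta> N / \<tau> N j) * (\<integral>\<omega>. (norm (P j (x N \<omega> - xh)))\<^sup>2 \<partial>M) \<le> V N" for N j
  proof -
    define e where "e u j = \<eta> N / \<tau> N j * (norm (P j (u - xh)))\<^sup>2" for u j
    define q where "q v = (\<Sum>l\<in>UNIV. (norm (Q l (v - yh)))\<^sup>2 / \<sigma> 0 l)" for v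
    have e0: "0 \<le> e u j" for u j
      using \<eta>_pos[of N] acc.tau_pos[of N j] by (simp add: e_def)
    have i1: "integrable M (\<lambda>\<omega>. e (x N \<omega>) j)" for j by (rule int_iter)
    have i2: "integrable M (\<lambda>\<omega>. e (x N \<omega>) j * a (S N \<omega>) j)" for j
      by (rule int_iter_S[of "\<lambda>u v. e u j" N "\<lambda>T. a T j"])
    have i3: "integrable M (\<lambda>\<omega>. B (x N \<omega>) (y N \<omega>) j * a (S N \<omega>) j)" for j
      by (rule int_iter_S[of "\<lambda>u v. B u v j" N "\<lambda>T. a T j"])
    have i3': "integrable M (\<lambda>\<omega>. B (x N \<omega>) (y N \<omega>) j)" for j by (rule int_iter)
    have i4: "integrable M (\<lambda>\<omega>. q (y N \<omega>))" by (rule int_iter)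
    have i5: "integrable M (\<lambda>\<omega>. C (x N \<omega>) (y N \<omega>))" by (rule int_iter)
    have m2: "(\<integral>\<omega>. e (x N \<omega>) j * a (S N \<omega>) j \<partial>M) = (\<integral>\<omega>. e (x N \<omega>) j \<partial>M)" for j
      by (rule mean_a)
    have m3: "(\<Sum>j\<in>UNIV. \<integral>\<omega>. B (x N \<omega>) (y N \<omega>) j * a (S N \<omega>) j \<partial>M) = (\<integral>\<omega>. C (x N \<omega>) (y N \<omega>) \<partial>M)"
    proof -
      have "(\<integral>\<omega>. B (x N \<omega>) (y N \<omega>) j * a (S N \<omega>) j \<partial>M) = (\<integral>\<omega>. B (x N \<omega>) (y N \<omega>) j \<partial>M)" for j
        by (rule mean_a)
      then show ?thesis using i3' by (simp add: B_C flip: Bochner_Integration.integral_sum)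
    qed
    have AE_c: "AE \<omega> in M. 2 * \<eta> N * (\<Sum>j\<in>UNIV. B (x N \<omega>) (y N \<omega>) j * a (S N \<omega>) j) \<le>
        (1 - \<kappa>) * (\<Sum>j\<in>UNIV. e (x N \<omega>) j * a (S N \<omega>) j) + q (y N \<omega>)"
      using kappa_cond
    proof eventually_elim
      case (elim \<omega>)
      let ?u = "x N \<omega> - xh" and ?v = "y N \<omega> - yh" and ?T = "S N \<omega>"
      have sums: "(\<Sum>j\<in>UNIV. f j * a ?T j) = (\<Sum>j\<in>?T. f j / \<pi> j)" for f
        by (rule sum.mono_neutral_cong_right) (auto simp: a_def)
      have blk: "block_op P (a ?T) ?u = (\<Sum>j\<in>?T. (1 / \<pi> j) *\<^sub>R P j ?u)"
        unfolding block_op_apply by (rule sum.mono_neutral_cong_right) (auto simp: a_def)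
      have "2 * (D (x N \<omega>) (\<Sum>j\<in>?T. (1 / \<pi> j) *\<^sub>R P j ?u) \<bullet> ?v) \<le>
          (1 - \<kappa>) * (\<Sum>j\<in>?T. (norm (P j ?u))\<^sup>2 / (\<pi> j * \<tau> N j)) + (\<Sum>l\<in>UNIV. (norm (Q l ?v))\<^sup>2 / \<sigma> N l)"
        by (rule coupling_estimate[OF P_dec Q_dec w_pos w_recip pi_pos acc.tau_pos \<sigma>_pos _ acc.sigma_tau_le])
           (use elim delta_kappa in auto)
      then have "\<eta> N * (2 * (D (x N \<omega>) (\<Sum>j\<in>?T. (1 / \<pi> j) *\<^sub>R P j ?u) \<bullet> ?v)) \<le>
          \<eta> N * ((1 - \<kappa>) * (\<Sum>j\<in>?T. (norm (P j ?u))\<^sup>2 / (\<pi> j * \<tau> N j)) + (\<Sum>l\<in>UNIV. (norm (Q l ?v))\<^sup>2 / \<sigma> N l))"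
        using \<eta>_pos[of N] by (intro mult_left_mono) auto
      also have "\<dots> = (1 - \<kappa>) * (\<Sum>j\<in>?T. e (x N \<omega>) j / \<pi> j) + q (y N \<omega>)"
        using \<eta>_pos[of N]
        by (simp add: distrib_left sum_distrib_left e_def q_def acc.sigma_eq[of N] \<eta>_def mult.commute mult.left_commute)
      finally show ?case
        unfolding B_block blk sums by (simp add: inner_commute mult.left_commute mult.assoc)
    qed
    have "(\<integral>\<omega>. 2 * \<eta> N * (\<Sum>j\<in>UNIV. B (x N \<omega>) (y N \<omega>) j * a (S N \<omega>) j) \<partial>M) \<le>
        (\<integral>\<omega>. (1 - \<kappa>) * (\<Sum>j\<in>UNIV. e (x N \<omega>) j * a (S N \<omega>) j) + q (y N \<omega>) \<partial>M)"
      by (intro integral_mono_AE AE_c) (use i2 i3 i4 in auto)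
    then have c: "2 * \<eta> N * (\<integral>\<omega>. C (x N \<omega>) (y N \<omega>) \<partial>M) \<le>
        (1 - \<kappa>) * (\<Sum>j\<in>UNIV. \<integral>\<omega>. e (x N \<omega>) j \<partial>M) + (\<integral>\<omega>. q (y N \<omega>) \<partial>M)"
      using i2 i3 i4 by (simp add: m2 m3)
    have WW: "W N u v = (\<Sum>j\<in>UNIV. e u j / \<pi> j) + q v" for u v
      by (simp add: W_def e_def q_def)
    have ie: "0 \<le> (\<integral>\<omega>. e (x N \<omega>) j \<partial>M)" for j by (simp add: e0)
    have "V N = (\<Sum>j\<in>UNIV. (\<integral>\<omega>. e (x N \<omega>) j \<partial>M) / \<pi> j) + (\<integral>\<omega>. q (y N \<omega>) \<partial>M) - 2 * \<eta> N * (\<integral>\<omega>. C (x N \<omega>) (y N \<omega>) \<partial>M)"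
      unfolding V_def WW using i1 i4 i5 by simp
    moreover have "(\<Sum>j\<in>UNIV. \<integral>\<omega>. e (x N \<omega>) j \<partial>M) \<le> (\<Sum>j\<in>UNIV. (\<integral>\<omega>. e (x N \<omega>) j \<partial>M) / \<pi> j)"
      using pi_pos pi_le ie by (intro sum_mono) (simp add: le_divide_eq mult_left_le)
    moreover have "\<kappa> * (\<integral>\<omega>. e (x N \<omega>) j \<partial>M) \<le> \<kappa> * (\<Sum>j\<in>UNIV. \<integral>\<omega>. e (x N \<omega>) j \<partial>M)"
      using delta_kappa ie by (intro mult_left_mono member_le_sum) auto
    moreover have "\<kappa> * (\<eta> N / \<tau> N j) * (\<integral>\<omega>. (norm (P j (x N \<omega> - xh)))\<^sup>2 \<partial>M) = \<kappa> * (\<integral>\<omega>. e (x N \<omega>) j \<partial>M)"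
      by (simp add: e_def)
    ultimately show ?thesis using c by (simp add: left_diff_distrib)
  qed

  \<comment> \<open>Quadratic rate\<close>
  have rate: "\<exists>c. \<forall>N\<ge>1. (\<integral>\<omega>. (norm (P j (x N \<omega> - xh)))\<^sup>2 \<partial>M) \<le> c * (1 / (real N)\<^sup>2)" for j
  proof -
    obtain c where c: "0 < c" "\<And>N. c * (real N)\<^sup>2 \<le> \<eta> N / \<tau> N j"
      using acc.phi_quadratic_growth[of j] unfolding \<eta>_def by blast
    \<comment> \<open>The chain of decreasing expectations starts at index 1, hence the constant
      \<open>V 1\<close> and the restriction to \<open>1 \<le> N\<close>.\<close>
    have "(\<integral>\<omega>. (norm (P j (x N \<omega> - xh)))\<^sup>2 \<partial>M) \<le> V 1 / (\<kappa> * c) * (1 / (real N)\<^sup>2)" if N: "1 \<le> N" for N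
    proof -
      let ?E = "\<integral>\<omega>. (norm (P j (x N \<omega> - xh)))\<^sup>2 \<partial>M"
      have \<kappa>: "0 < \<kappa>" using delta_kappa by simp
      have "\<kappa> * (c * (real N)\<^sup>2) * ?E \<le> \<kappa> * (\<eta> N / \<tau> N j) * ?E"
        using c \<kappa> by (intro mult_right_mono mult_left_mono) auto
      also have "\<dots> \<le> V 1" using V_ge[of N j] V_le[of "N - 1"] N by simp
      finally show ?thesis using \<kappa> c N by (simp add: field_simps)
    qed
    then show ?thesis by blast
  qed
  show ?thesis
  proof (intro allI conjI)
    fix j
    obtain c where c: "\<And>N. 1 \<le> N \<Longrightarrow> (\<integral>\<omega>. (norm (P j (x N \<omega> - xh)))\<^sup>2 \<partial>M) \<le> c * (1 / (real N)\<^sup>2)"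
      using rate by blast
    have le: "eventually (\<lambda>N. (\<integral>\<omega>. (norm (P j (x N \<omega> - xh)))\<^sup>2 \<partial>M) \<le> c * (1 / (real N)\<^sup>2)) sequentially"
      using eventually_ge_at_top[of 1] by eventually_elim (rule c)
    show "integrable M (\<lambda>\<omega>. (norm (P j (x N \<omega> - xh)))\<^sup>2)" for N by (rule int_err)
    have "(\<lambda>N. c * (1 / real N)\<^sup>2) \<longlonglongrightarrow> c * 0\<^sup>2"
      by (intro tendsto_intros lim_1_over_n)
    then have "(\<lambda>N. c * (1 / (real N)\<^sup>2)) \<longlonglongrightarrow> 0" by (simp add: power_one_over)
    then show "(\<lambda>N. \<integral>\<omega>. (norm (P j (x N \<omega> - xh)))\<^sup>2 \<partial>M) \<longlonglongrightarrow> 0"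
      by (intro tendsto_sandwich[OF always_eventually le tendsto_const]) simp_all
    show "(\<lambda>N. \<integral>\<omega>. (norm (P j (x N \<omega> - xh)))\<^sup>2 \<partial>M) \<in> O(\<lambda>N. 1 / (real N)\<^sup>2)"
      by (rule bigoI[of _ c]) (use le in \<open>simp add: abs_of_nonneg\<close>)
  qed
qed

end
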